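(* Let $s,t$ be coprime integers greater than $1$, let $\sigma$ be an $s$-core, $\tau$ a $t$-core, and $n\ge0$ an integer. Then the set of partitions of $n$ with $s$-core $\sigma$ and $t$-core $\tau$ contains exactly one self-conjugate partition if and only if $\sigma=\sigma'$, $\tau=\tau'$ and one of the following holds: (1) $\mathrm{cor}_t(\sigma)=\mathrm{cor}_s(\tau)$ and $n=|\sigma|+|\tau|-|\mathrm{cor}_t(\sigma)|$; (2) $t$ is odd, $\mathrm{cor}_t(\sigma)\rightharpoondown_{s,t}\mathrm{cor}_s(\tau)$, and $n=|\tau|+t(\mathrm{wei}_t(\sigma)+1)$; (3) $s$ is odd, $\mathrm{cor}_s(\tau)\rightharpoondown_{t,s}\mathrm{cor}_t(\sigma)$, and $n=|\sigma|+s(\mathrm{wei}_s(\tau)+1)$; (4) $s$ and $t$ are both odd, $\mathrm{cor}_t(\sigma)\leftrightharpoons_{s,t}\mathrm{cor}_s(\tau)$, and $n=|\mathrm{cor}_t(\sigma)\star\mathrm{cor}_s(\tau)|+s(\mathrm{wei}_s(\tau)+1)+t(\mathrm{wei}_t(\sigma)+1)$; (5) $s$ and $t$ are both odd, $\mathrm{cor}_t(\sigma)=\mathrm{cor}_s(\tau)=\kappa_{s,t}$, and $n=|\sigma|+|\tau|-|\kappa_{s,t}|+st$.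
   Context: Partitions, size $|\lambda|$; beta-set $\mathcal B(\lambda)=\{\lambda_r-r:r\ge1\}$. The conjugate $\lambda'$ is given by $\lambda'_r=|\{c:\lambda_c\ge r\}|$; $\lambda$ is self-conjugate if $\lambda'=\lambda$. A rim $s$-hook is a connected set of $s$ nodes of the rim of the Young diagram (nodes $(r,c)$ with $(r+1,c+1)$ not a node) whose removal leaves a partition's diagram; $\lambda$ is an $s$-core if it has no rim $s$-hook. The $s$-core $\mathrm{cor}_s(\lambda)$ is obtained by repeatedly removing rim $s$-hooks, and the $s$-weight $\mathrm{wei}_s(\lambda)$ is the number of hooks removed, so $|\lambda|=|\mathrm{cor}_s(\lambda)|+s\,\mathrm{wei}_s(\lambda)$. An $(s,t)$-core is both an $s$-core and a $t$-core; $\kappa_{s,t}$ denotes the unique $(s,t)$-core of largest size. For $b\in\mathbb Z$ write $\bar b=-1-b$. For partitions $\alpha,\beta$ and positive integers $p,q$, write $\alpha\rightharpoondown_{p,q}\beta$ if there is an integer $b\in\mathcal B(\beta)\setminus\mathcal B(\alpha)$ with $\bar b-b\equiv q\pmod{2p}$ and $\mathcal B(\alpha)=(\mathcal B(\beta)\setminus\{b\})\cup\{\bar b\}$. For partitions $\alpha,\beta$ write $\alpha\leftrightharpoons_{s,t}\beta$ if there are distinct integers $b,c\in\mathcal B(\beta)\setminus\mathcal B(\alpha)$ with $\bar b-b\equiv t\pmod{2s}$, $\bar c-c\equiv -s\pmod{2t}$ and $\mathcal B(\alpha)=(\mathcal B(\beta)\setminus\{b,c\})\cup\{\bar b,\bar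 c\}$; in that case $\alpha\star\beta$ denotes the partition with beta-set $(\mathcal B(\beta)\setminus\{c\})\cup\{\bar c\}$. *)

theory Defs
  imports "HOL-Number_Theory.Cong"
begin

text \<open>
  A partition is its sequence of parts, padded with zeros. Rows, columns and parts are indexed
  from 0, so \<open>\<nu> r\<close> is the part \<open>\<nu>\<^bsub>r+1\<^esub>\<close> of the usual convention.
\<close>

definition is_partition :: "(nat \<Rightarrow> nat) \<Rightarrow> bool" where
  "is_partition \<nu> \<longleftrightarrow> antimono \<nu> \<and> finite {r. \<nu> r \<noteq> 0}"

definition psize :: "(nat \<Rightarrow> nat) \<Rightarrow> nat" where
  "psize \<nu> = (\<Sum>r | \<nu> r \<noteq> 0. \<nu> r)"

definition conjugate_partition :: "(nat \<Rightarrow> nat) \<Rightarrow> nat \<Rightarrow> nat" where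
  "conjugate_partition \<nu> r = card {c. \<nu> c \<ge> r + 1}"

definition beta_set :: "(nat \<Rightarrow> nat) \<Rightarrow> int set" where
  "beta_set \<nu> = {int (\<nu> r) - (int r + 1) | r. True}"

definition young_diagram :: "(nat \<Rightarrow> nat) \<Rightarrow> (nat \<times> nat) set" where
  "young_diagram \<nu> = {(r, c). c < \<nu> r}"

definition rim :: "(nat \<Rightarrow> nat) \<Rightarrow> (nat \<times> nat) set" where
  "rim \<nu> = {(r, c). (r, c) \<in> young_diagram \<nu> \<and> (r + 1, c + 1) \<notin> young_diagram \<nu>}"

definition adjacent_nodes :: "((nat \<times> nat) \<times> (nat \<times> nat)) set" where
  "adjacent_nodes = {((r, c), (r', c')).
     r = r' \<and> (c' = c + 1 \<or> c = c' + 1) \<or> c = c' \<and> (r' = r + 1 \<or> r = r' + 1)}"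

definition connected_nodes :: "(nat \<times> nat) set \<Rightarrow> bool" where
  "connected_nodes H \<longleftrightarrow> (\<forall>x\<in>H. \<forall>y\<in>H. (x, y) \<in> (adjacent_nodes \<inter> H \<times> H)\<^sup>*)"

definition is_rim_hook :: "nat \<Rightarrow> (nat \<Rightarrow> nat) \<Rightarrow> (nat \<times> nat) set \<Rightarrow> bool" where
  "is_rim_hook s \<nu> H \<longleftrightarrow>
     H \<subseteq> rim \<nu> \<and> card H = s \<and> connected_nodes H \<and>
     (\<exists>\<mu>. is_partition \<mu> \<and> young_diagram \<mu> = young_diagram \<nu> - H)"

definition remove_rim_hook :: "nat \<Rightarrow> (nat \<Rightarrow> nat) \<Rightarrow> (nat \<Rightarrow> nat) \<Rightarrow> bool" where
  "remove_rim_hook s \<nu> \<mu> \<longleftrightarrow>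
     is_partition \<mu> \<and> (\<exists>H. is_rim_hook s \<nu> H \<and> young_diagram \<mu> = young_diagram \<nu> - H)"

definition is_core :: "nat \<Rightarrow> (nat \<Rightarrow> nat) \<Rightarrow> bool" where
  "is_core s \<nu> \<longleftrightarrow> is_partition \<nu> \<and> \<not> (\<exists>H. is_rim_hook s \<nu> H)"

text \<open>
  The descriptions in \<open>cor\<close>, \<open>wei\<close> and \<open>kappa\<close> rely on well-known facts: the outcome and the number
  of steps of the removal process do not depend on the choices made (\<open>s > 0\<close>), and for coprime
  \<open>s, t\<close> there is a unique \<open>(s,t)\<close>-core of largest size.
\<close>

definition cor :: "nat \<Rightarrow> (nat \<Rightarrow> nat) \<Rightarrow> (nat \<Rightarrow> nat)" where
  "cor s \<nu> = (THE \<mu>. (remove_rim_hook s)\<^sup>*\<^sup>* \<nu> \<mu> \<and> is_core s \<mu>)"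

definition wei :: "nat \<Rightarrow> (nat \<Rightarrow> nat) \<Rightarrow> nat" where
  "wei s \<nu> = (THE w. \<exists>\<mu>. (remove_rim_hook s ^^ w) \<nu> \<mu> \<and> is_core s \<mu>)"

definition kappa :: "nat \<Rightarrow> nat \<Rightarrow> (nat \<Rightarrow> nat)" where
  "kappa s t = (THE \<kappa>. is_core s \<kappa> \<and> is_core t \<kappa> \<and>
     (\<forall>\<mu>. is_core s \<mu> \<and> is_core t \<mu> \<longrightarrow> psize \<mu> \<le> psize \<kappa>))"

definition bar :: "int \<Rightarrow> int" where
  "bar b = -1 - b"

text \<open>\<open>harpoon p q \<alpha> \<beta>\<close> is \<open>\<alpha> \<rightharpoondown>\<^bsub>p,q\<^esub> \<beta>\<close>.\<close>

definition harpoon :: "nat \<Rightarrow> nat \<Rightarrow> (nat \<Rightarrow> nat) \<Rightarrow> (nat \<Rightarrow> nat) \<Rightarrow> bool" where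
  "harpoon p q \<alpha> \<beta> \<longleftrightarrow>
     (\<exists>b \<in> beta_set \<beta> - beta_set \<alpha>.
        [bar b - b = int q] (mod (2 * int p)) \<and>
        beta_set \<alpha> = (beta_set \<beta> - {b}) \<union> {bar b})"

definition harpoons_via ::
  "nat \<Rightarrow> nat \<Rightarrow> (nat \<Rightarrow> nat) \<Rightarrow> (nat \<Rightarrow> nat) \<Rightarrow> int \<Rightarrow> int \<Rightarrow> bool" where
  "harpoons_via s t \<alpha> \<beta> b c \<longleftrightarrow>
     b \<noteq> c \<and> b \<in> beta_set \<beta> - beta_set \<alpha> \<and> c \<in> beta_set \<beta> - beta_set \<alpha> \<and>
     [bar b - b = int t] (mod (2 * int s)) \<and>
     [bar c - c = - int s] (mod (2 * int t)) \<and>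
     beta_set \<alpha> = (beta_set \<beta> - {b, c}) \<union> {bar b, bar c}"

text \<open>\<open>harpoons s t \<alpha> \<beta>\<close> is \<open>\<alpha> \<leftrightharpoons>\<^bsub>s,t\<^esub> \<beta>\<close>.\<close>

definition harpoons :: "nat \<Rightarrow> nat \<Rightarrow> (nat \<Rightarrow> nat) \<Rightarrow> (nat \<Rightarrow> nat) \<Rightarrow> bool" where
  "harpoons s t \<alpha> \<beta> \<longleftrightarrow> (\<exists>b c. harpoons_via s t \<alpha> \<beta> b c)"

text \<open>
  When \<open>\<alpha>\<close> and \<open>\<beta>\<close> are \<open>(s,t)\<close>-cores, \<open>s\<close> and \<open>t\<close> odd and coprime, at most one pair \<open>(b, c)\<close>
  qualifies, so the description below is then unambiguous.
\<close>

definition star :: "nat \<Rightarrow> nat \<Rightarrow> (nat \<Rightarrow> nat) \<Rightarrow> (nat \<Rightarrow> nat) \<Rightarrow> (nat \<Rightarrow> nat)" where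
  "star s t \<alpha> \<beta> = (THE \<gamma>. is_partition \<gamma> \<and>
     (\<exists>b c. harpoons_via s t \<alpha> \<beta> b c \<and> beta_set \<gamma> = (beta_set \<beta> - {c}) \<union> {bar c}))"

end

theory Submission
  imports Defs
begin

text \<open>
  Conjugation becomes \<open>b \<mapsto> bar b\<close> on beta-sets, and two beta-sets have the same \<open>s\<close>-core iff they have the
  same charge on every residue class modulo \<open>s\<close>. Translating whole residue classes modulo \<open>t\<close> by
  multiples of \<open>s\<close>, symmetrically under \<open>bar\<close>, fixes \<open>s\<close>-cores, permutes the \<open>t\<close>-runners and shifts sizes
  by an amount that depends only on the \<open>t\<close>-core; so \<open>\<tau>\<close> may be replaced by \<open>cor s \<tau>\<close>, and likewise
  \<open>\<sigma>\<close> by \<open>cor t \<sigma>\<close>, after which both are \<open>(s,t)\<close>-cores.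

  If beads sit at two opposite corners of a rectangle \<open>a, a + ks, a + lt, a + ks + lt\<close> and gaps at the other
  two, then moving the beads to the other diagonal, simultaneously in the rectangle and in its image
  under \<open>bar\<close>, gives another self-conjugate partition with the same size and cores. The move is only
  impossible when \<open>bar\<close> maps some corner to an adjacent one. Hence a unique solution is an \<open>(s,t)\<close>-core up to
  exchanging \<open>b\<close> and \<open>bar b\<close> for the central hooks of length \<open>s\<close>, \<open>t\<close> or \<open>st\<close>, which yields the five cases.
  Conversely each case forces an energy-minimal configuration: a diagonal hook exists by parity of the
  weight, and undoing it leaves too little energy unless it is the central one.
\<close>


section \<open>Beta-sets as Maya diagrams\<close>

text \<open>Two numerical facts carry the argument. A bead minus a gap of an (s,t)-core never lies
  in the semigroup generated by s and t, so it is at most the Frobenius number st - s - t; this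
  bound is what leaves too little energy in the converse. And that semigroup is symmetric about its
  Frobenius number, which makes the cone below (st - s - t - 1)/2 a self-dual core,
  \<open>kappa_set\<close>, the largest one. The congruences modulo 2p come from the centre: a
  central t-hook runs from c to \<open>bar c = c + t\<close>. Placing it changes the s-core as if
  the top bead b on the runner of c had moved to \<open>bar b\<close>, and
  \<open>bar b - b = t - 2 (b - c)\<close> with b - c divisible by s. The obstacle in the forward
  direction is that each rectangle can be blocked in four ways: most claims on the shape of B are
  proved by exhibiting a rectangle and refuting all four, the missing corners being supplied by
  comparing charges. Gaps of length divisible by st are settled before the others, since later
  refutations rely on closure under st.\<close>

definition maya :: "int set \<Rightarrow> bool" where
  "maya B \<longleftrightarrow> finite {b. (b \<in> B) \<noteq> (b < 0)}"

text \<open>Renormalised by subtracting the vacuum of negative integers, which makes the sum finite;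
  weight 1 gives the charge, the identity gives the energy.\<close>

definition wsum :: "(int \<Rightarrow> int) \<Rightarrow> int set \<Rightarrow> int" where
  "wsum w B = (\<Sum>b | (b \<in> B) \<noteq> (b < 0). (of_bool (b \<in> B) - of_bool (b < 0)) * w b)"

text \<open>On beta-sets this is the size of the partition. Its summands are nonnegative, so it
  serves as termination measure.\<close>

definition energy :: "int set \<Rightarrow> int" where
  "energy = wsum (\<lambda>b. b)"

text \<open>
  Quantifying over all \<open>m\<close>-periodic weights, rather than over residue classes, makes invariance under
  \<open>m\<close>-periodic substitutions immediate. For beta-sets of partitions it says that the \<open>m\<close>-cores agree.
\<close>

definition same_charge :: "int \<Rightarrow> int set \<Rightarrow> int set \<Rightarrow> bool" where
  "same_charge m B C \<longleftrightarrow> (\<forall>g. (\<forall>b. g (b + m) = g b) \<longrightarrow> wsum g B = wsum g C)"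

text \<open>For \<open>m > 0\<close> and the beta-set of a partition this is the
  \<open>m\<close>-core condition, see \<open>is_core_iff\<close>.\<close>

definition down_closed :: "int \<Rightarrow> int set \<Rightarrow> bool" where
  "down_closed m B \<longleftrightarrow> (\<forall>b\<in>B. b - m \<in> B)"

definition self_dual :: "int set \<Rightarrow> bool" where
  "self_dual B \<longleftrightarrow> (\<forall>b. b \<in> B \<longleftrightarrow> bar b \<notin> B)"

lemma bar_bar [simp]: "bar (bar b) = b"
  by (simp add: bar_def)

lemma wsum_superset:
  assumes "finite F" "{b. (b \<in> B) \<noteq> (b < 0)} \<subseteq> F"
  shows "wsum w B = (\<Sum>b\<in>F. (of_bool (b \<in> B) - of_bool (b < 0)) * w b)"
  unfolding wsum_def by (rule sum.mono_neutral_left) (use assms in auto)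

lemma maya_iff_bounded: "maya B \<longleftrightarrow> (\<exists>N\<ge>0. (\<forall>b < -N. b \<in> B) \<and> (\<forall>b > N. b \<notin> B))"
proof
  assume "maya B"
  then have "finite (abs ` {b. (b \<in> B) \<noteq> (b < 0)})" by (simp add: maya_def)
  then obtain N where N: "\<forall>x \<in> abs ` {b. (b \<in> B) \<noteq> (b < 0)}. x \<le> N"
    by (meson bdd_above_finite bdd_above.E)
  have N: "\<bar>b\<bar> \<le> N" if "(b \<in> B) \<noteq> (b < 0)" for b using N that by blast
  have "b \<in> B" if "b < - (max N 0)" for b
    using N[of b] that by (cases "b \<in> B"; cases "b < 0") auto
  moreover have "b \<notin> B" if "b > max N 0" for b
    using N[of b] that by (cases "b \<in> B") auto
  ultimately show "\<exists>N\<ge>0. (\<forall>b < -N. b \<in> B) \<and> (\<forall>b > N. b \<notin> B)"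
    by (meson max.cobounded2)
next
  assume "\<exists>N\<ge>0. (\<forall>b < -N. b \<in> B) \<and> (\<forall>b > N. b \<notin> B)"
  then obtain N where N: "N \<ge> 0" "\<forall>b < -N. b \<in> B" "\<forall>b > N. b \<notin> B" by blast
  have "{b. (b \<in> B) \<noteq> (b < 0)} \<subseteq> {-N..N}"
  proof
    fix b assume "b \<in> {b. (b \<in> B) \<noteq> (b < 0)}"
    then show "b \<in> {-N..N}" using N
      by (cases "b < -N"; cases "b > N") auto
  qed
  then show "maya B" unfolding maya_def by (rule finite_subset) simp
qed

lemma maya_bound:
  assumes "maya B"
  obtains N where "N \<ge> 0" "\<And>b. b < -N \<Longrightarrow> b \<in> B" "\<And>b. b > N \<Longrightarrow> b \<notin> B"
  using assms unfolding maya_iff_bounded by blast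

lemma maya_finite_diff:
  assumes "maya B" "maya C"
  shows "finite (B - C)"
proof (rule finite_subset)
  show "B - C \<subseteq> {b. (b \<in> B) \<noteq> (b < 0)} \<union> {b. (b \<in> C) \<noteq> (b < 0)}" by auto
  show "finite ({b. (b \<in> B) \<noteq> (b < 0)} \<union> {b. (b \<in> C) \<noteq> (b < 0)})"
    using assms by (simp add: maya_def)
qed

lemma maya_change:
  assumes "maya B" "finite (B - C)" "finite (C - B)"
  shows "maya C"
  unfolding maya_def
proof (rule finite_subset)
  show "{b. (b \<in> C) \<noteq> (b < 0)} \<subseteq> {b. (b \<in> B) \<noteq> (b < 0)} \<union> (B - C) \<union> (C - B)" by auto
  show "finite ({b. (b \<in> B) \<noteq> (b < 0)} \<union> (B - C) \<union> (C - B))"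
    using assms by (simp add: maya_def)
qed

text \<open>The vacuum terms cancel, so all later changes of charge and energy become finite sums
  over the beads that differ.\<close>

lemma wsum_diff:
  assumes "maya B" "maya C"
  shows "wsum w B - wsum w C = sum w (B - C) - sum w (C - B)"
proof -
  define F where "F = {b. (b \<in> B) \<noteq> (b < 0)} \<union> {b. (b \<in> C) \<noteq> (b < 0)}"
  have F: "finite F" "{b. (b \<in> B) \<noteq> (b < 0)} \<subseteq> F" "{b. (b \<in> C) \<noteq> (b < 0)} \<subseteq> F"
    using assms by (auto simp: F_def maya_def)
  have sub: "X - Y = {b \<in> F. b \<in> X - Y}"
    if "X = B \<and> Y = C \<or> X = C \<and> Y = B" for X Y
    using that by (auto simp: F_def)
  have sm: "sum w (X - Y) = (\<Sum>b\<in>F. of_bool (b \<in> X - Y) * w b)"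
    if "X = B \<and> Y = C \<or> X = C \<and> Y = B" for X Y
  proof -
    have "sum w (X - Y) = sum w {b \<in> F. b \<in> X - Y}" by (rule arg_cong[OF sub[OF that]])
    also have "\<dots> = (\<Sum>b\<in>F. if b \<in> X - Y then w b else 0)"
      using F(1) by (rule sum.inter_filter)
    also have "\<dots> = (\<Sum>b\<in>F. of_bool (b \<in> X - Y) * w b)" by (rule sum.cong) auto
    finally show ?thesis .
  qed
  have "wsum w B - wsum w C = (\<Sum>b\<in>F. (of_bool (b \<in> B) - of_bool (b \<in> C)) * w b)"
    unfolding wsum_superset[OF F(1,2)] wsum_superset[OF F(1,3)] sum_subtractf[symmetric]
    by (rule sum.cong) (auto simp: algebra_simps)
  also have "\<dots> = sum w (B - C) - sum w (C - B)"
    unfolding sm[of B C, simplified] sm[of C B, simplified] sum_subtractf[symmetric]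
    by (rule sum.cong) (auto simp: algebra_simps)
  finally show ?thesis .
qed

lemma maya_exchange:
  assumes "maya B"
  shows "maya (insert c (B - {a}))"
  by (rule maya_change[OF assms]) (auto intro: finite_subset[of _ "{a}"] finite_subset[of _ "{c}"])

lemma wsum_exchange:
  assumes "maya B" "a \<in> B" "c \<notin> B"
  shows "wsum w (insert c (B - {a})) = wsum w B - w a + w c"
proof -
  have "insert c (B - {a}) - B = {c}" "B - insert c (B - {a}) = {a}" using assms by auto
  then show ?thesis using wsum_diff[OF maya_exchange[OF assms(1), of c a] assms(1), of w] by simp
qed

lemma energy_exchange:
  assumes "maya B" "a \<in> B" "c \<notin> B"
  shows "energy (insert c (B - {a})) = energy B - a + c"
  unfolding energy_def by (rule wsum_exchange[OF assms])

lemma energy_nonneg: "energy B \<ge> 0"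
  unfolding energy_def wsum_def by (rule sum_nonneg) auto

lemma periodic_mult:
  fixes g :: "int \<Rightarrow> 'a"
  assumes "\<forall>b. g (b + m) = g b"
  shows "g (b + m * k) = g b"
proof (induction k rule: int_induct[where k = 0])
  case base show ?case by simp
next
  case (step1 i)
  have "g (b + m * (i + 1)) = g (b + m * i + m)" by (simp add: algebra_simps)
  with step1 assms show ?case by simp
next
  case (step2 i)
  have "g (b + m * i) = g (b + m * (i - 1) + m)" by (simp add: algebra_simps)
  with step2 assms show ?case by metis
qed

lemma periodic_cong:
  fixes g :: "int \<Rightarrow> 'a"
  assumes "\<forall>b. g (b + m) = g b" "m dvd b - c"
  shows "g b = g c"
proof -
  obtain k where "b - c = m * k" using assms(2) by blast
  then have "b = c + m * k" by simp
  then show ?thesis using periodic_mult[OF assms(1)] by metis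
qed

lemma same_chargeD: "same_charge m B C \<Longrightarrow> (\<And>b. g (b + m) = g b) \<Longrightarrow> wsum g B = wsum g C"
  by (simp add: same_charge_def)

lemma same_charge_refl [simp]: "same_charge m B B"
  by (simp add: same_charge_def)

lemma same_charge_sym: "same_charge m B C \<Longrightarrow> same_charge m C B"
  by (simp add: same_charge_def)

lemma same_charge_trans: "same_charge m A B \<Longrightarrow> same_charge m B C \<Longrightarrow> same_charge m A C"
  by (simp add: same_charge_def)

lemma same_charge_exchange:
  assumes "maya B" "a \<in> B" "c \<notin> B" "m dvd a - c"
  shows "same_charge m (insert c (B - {a})) B"
  unfolding same_charge_def
  by (simp add: wsum_exchange[OF assms(1-3)] periodic_cong[OF _ assms(4)])

lemma same_charge_exchange2:
  assumes "maya B" "a \<in> B" "c \<notin> B" "maya C" "a' \<in> C" "c' \<notin> C"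
    and "m dvd a - a'" "m dvd c - c'" "same_charge m B C"
  shows "same_charge m (insert c (B - {a})) (insert c' (C - {a'}))"
  unfolding same_charge_def
proof (intro allI impI)
  fix g :: "int \<Rightarrow> int" assume g: "\<forall>b. g (b + m) = g b"
  then show "wsum g (insert c (B - {a})) = wsum g (insert c' (C - {a'}))"
    using assms(9) periodic_cong[OF g assms(7)] periodic_cong[OF g assms(8)]
    by (simp add: wsum_exchange[OF assms(1-3)] wsum_exchange[OF assms(4-6)] same_charge_def)
qed

lemma periodic_class:
  "(of_bool (m dvd (b + m) - r) :: int) = of_bool (m dvd b - r)" for m b r :: int
proof -
  have "m dvd (b + m) - r \<longleftrightarrow> m dvd (b - r) + m" by (simp add: algebra_simps)
  then show ?thesis by simp
qed

section \<open>Down-closed sets as cores\<close>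

lemma down_closed_mult:
  assumes "down_closed m B" "b \<in> B" "k \<ge> 0"
  shows "b - m * k \<in> B"
proof -
  have "b - m * int n \<in> B" for n
  proof (induction n)
    case (Suc n)
    then have "b - m * int n - m \<in> B" using assms(1) by (auto simp: down_closed_def)
    then show ?case by (simp add: algebra_simps)
  qed (simp add: assms(2))
  from this[of "nat k"] assms(3) show ?thesis by simp
qed

lemma down_closed_le:
  assumes "down_closed m B" "b \<in> B" "c \<le> b" "m dvd b - c" "m > 0"
  shows "c \<in> B"
proof -
  obtain k where k: "b - c = m * k" using assms(4) by blast
  then have "k \<ge> 0" using assms(3,5) by (metis diff_ge_0_iff_ge zero_le_mult_iff not_less)
  from down_closed_mult[OF assms(1,2) this] k show ?thesis
    by (metis add_diff_cancel_left' diff_add_cancel diff_diff_eq2)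
qed

text \<open>Testing against the indicator of a residue class recovers the runner-by-runner charge
  from the definition by periodic weights.\<close>

lemma same_charge_class_card:
  assumes "maya B" "maya C" "same_charge m B C"
  shows "card {b \<in> B - C. m dvd b - r} = card {b \<in> C - B. m dvd b - r}"
proof -
  let ?g = "\<lambda>b. of_bool (m dvd b - r) :: int"
  have fin: "finite (B - C)" "finite (C - B)" using assms by (auto intro: maya_finite_diff)
  have c: "sum ?g X = int (card {b \<in> X. m dvd b - r})" if "finite X" for X
    using that by (simp add: sum.inter_filter[symmetric] of_bool_def flip: card_eq_sum)
  have "wsum ?g B = wsum ?g C"
    by (rule same_chargeD[OF assms(3)]) (rule periodic_class)
  with wsum_diff[OF assms(1,2), of ?g] c fin show ?thesis by simp
qed

text \<open>A bead \<open>b\<close> of one set missing in the other is balanced, by counting on its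
  runner, by a bead \<open>c\<close> of the other missing in the first. Down-closure applied to the
  higher of the two puts the lower one where it should be missing.\<close>

lemma core_unique:
  assumes "maya B" "maya C" "down_closed m B" "down_closed m C" "same_charge m B C" "m > 0"
  shows "B = C"
proof -
  have sub: "X \<subseteq> Y" if "maya X" "maya Y" "down_closed m X" "down_closed m Y" "same_charge m X Y" for X Y
  proof
    fix b assume "b \<in> X"
    show "b \<in> Y"
    proof (rule ccontr)
      assume "b \<notin> Y"
      then have "b \<in> {b' \<in> X - Y. m dvd b' - b}" using \<open>b \<in> X\<close> by simp
      moreover have "finite {b' \<in> X - Y. m dvd b' - b}"
        by (rule finite_subset[OF _ maya_finite_diff[OF that(1,2)]]) blast
      ultimately have "card {b' \<in> X - Y. m dvd b' - b} \<noteq> 0" by auto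
      then have "card {b' \<in> Y - X. m dvd b' - b} \<noteq> 0"
        using same_charge_class_card[OF that(1,2,5)] by simp
      then obtain c where c: "c \<in> Y" "c \<notin> X" "m dvd c - b" by (metis (no_types, lifting) DiffE card.empty empty_Collect_eq)
      show False
      proof (cases "c \<le> b")
        case True
        then show False using down_closed_le[OF that(3) \<open>b \<in> X\<close> True _ assms(6)] c
          by (metis dvd_diff_commute)
      next
        case False
        then show False using down_closed_le[OF that(4) c(1) _ c(3) assms(6)] \<open>b \<notin> Y\<close> by simp
      qed
    qed
  qed
  show ?thesis
    using sub[OF assms(1-5)] sub[OF assms(2,1,4,3) same_charge_sym[OF assms(5)]] by blast
qed

text \<open>Pushing one bead down by \<open>m\<close> costs exactly \<open>m\<close> units of
  energy, and energy is nonnegative; \<open>k\<close> counts the pushes. The last clause serves the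
  equality case in \<open>core_energy_eq\<close>.\<close>

lemma core_exists:
  assumes "maya B" "m > 0"
  shows "\<exists>C k. maya C \<and> down_closed m C \<and> same_charge m B C \<and> energy B = energy C + m * int k \<and> (k = 0 \<longrightarrow> C = B)"
  using assms(1)
proof (induction "nat (energy B)" arbitrary: B rule: less_induct)
  case less
  show ?case
  proof (cases "down_closed m B")
    case True
    then show ?thesis using less.prems by (intro exI[of _ B] exI[of _ 0]) simp
  next
    case False
    then obtain z where z: "z \<in> B" "z - m \<notin> B" by (auto simp: down_closed_def)
    define B' where "B' = insert (z - m) (B - {z})"
    have B': "maya B'" "energy B' = energy B - m" "same_charge m B' B"
      using maya_exchange[OF less.prems] energy_exchange[OF less.prems z]
        same_charge_exchange[OF less.prems z] by (auto simp: B'_def)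
    then have "nat (energy B') < nat (energy B)" using energy_nonneg[of B'] assms(2) by linarith
    from less.hyps[OF this B'(1)] obtain C k where C: "maya C" "down_closed m C" "same_charge m B' C"
      "energy B' = energy C + m * int k" by blast
    then have "energy B = energy C + m * int (Suc k)" using B'(2) by (simp add: algebra_simps)
    then show ?thesis using C B'(3) same_charge_sym same_charge_trans by blast
  qed
qed

lemma core_energy:
  assumes "maya B" "maya C" "down_closed m C" "same_charge m B C" "m > 0"
  obtains k where "energy B = energy C + m * int k" "k = 0 \<Longrightarrow> B = C"
proof -
  obtain C' k where C': "maya C'" "down_closed m C'" "same_charge m B C'"
    "energy B = energy C' + m * int k" "k = 0 \<longrightarrow> C' = B"
    using core_exists[OF assms(1,5)] by blast
  have "C' = C" by (rule core_unique[OF C'(1) assms(2) C'(2) assms(3) _ assms(5)])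
      (use C'(3) assms(4) same_charge_sym same_charge_trans in blast)
  with C' that show thesis by blast
qed

lemma core_energy_le:
  assumes "maya B" "maya C" "down_closed m C" "same_charge m B C" "m > 0"
  shows "energy C \<le> energy B"
proof -
  obtain k where "energy B = energy C + m * int k" using core_energy[OF assms] by metis
  moreover have "m * int k \<ge> 0" using assms(5) by simp
  ultimately show ?thesis by simp
qed

lemma core_energy_eq:
  assumes "maya B" "maya C" "down_closed m C" "same_charge m B C" "m > 0" "energy B \<le> energy C"
  shows "B = C"
proof -
  obtain k where k: "energy B = energy C + m * int k" "k = 0 \<Longrightarrow> B = C" using core_energy[OF assms(1-5)] by metis
  then have "m * int k \<le> 0" using assms(6) by simp
  then have "k = 0" using assms(5) by (metis mult_pos_pos not_le of_nat_0_less_iff neq0_conv)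
  then show ?thesis by (rule k(2))
qed

section \<open>Self-duality and bounded substitutions\<close>

lemma self_dualD: "self_dual B \<Longrightarrow> bar b \<in> B \<longleftrightarrow> b \<notin> B"
  unfolding self_dual_def by blast

lemma self_dual_exchange:
  assumes "self_dual B" "a \<in> B"
  shows "self_dual (insert (bar a) (B - {a}))"
proof -
  have "bar a \<noteq> a" unfolding bar_def by presburger
  then show ?thesis using assms unfolding self_dual_def by (metis Diff_iff bar_bar insert_iff singletonD)
qed

text \<open>\<open>bar\<close> permutes the support of the sum and changes the sign of every term.
  Charge zero is what allows the return from self-dual sets to partitions.\<close>

lemma self_dual_charge:
  assumes "self_dual B"
  shows "wsum (\<lambda>_. 1) B = 0"
proof -
  let ?F = "{b. (b \<in> B) \<noteq> (b < 0)}"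
  let ?f = "\<lambda>b. (of_bool (b \<in> B) - of_bool (b < 0)) * 1 :: int"
  note sd = self_dualD[OF assms]
  have neg: "bar b < 0 \<longleftrightarrow> \<not> b < 0" for b by (auto simp: bar_def)
  have "bij_betw bar ?F ?F"
    by (rule bij_betw_byWitness[where f' = bar]) (auto simp: sd neg)
  then have "sum ?f ?F = sum (\<lambda>b. ?f (bar b)) ?F" by (rule sum.reindex_bij_betw[symmetric])
  also have "\<dots> = sum (\<lambda>b. - ?f b) ?F"
    by (rule sum.cong) (auto simp: sd neg)
  also have "\<dots> = - sum ?f ?F" by (rule sum_negf)
  finally show ?thesis unfolding wsum_def by linarith
qed

lemma bij_bounded_maya:
  assumes "maya B" "bij \<phi>" "\<And>b. \<bar>\<phi> b - b\<bar> \<le> M"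
  shows "maya (\<phi> ` B)"
proof -
  obtain N where N: "N \<ge> 0" "\<And>b. b < -N \<Longrightarrow> b \<in> B" "\<And>b. b > N \<Longrightarrow> b \<notin> B"
    using maya_bound[OF assms(1)] by metis
  have M: "M \<ge> 0" using assms(3)[of 0] by linarith
  have "b \<in> \<phi> ` B" if "b < -(N + M)" for b
  proof -
    obtain c where c: "b = \<phi> c" using assms(2) by (metis bij_pointE)
    then have "c < -N" using assms(3)[of c] that by linarith
    then show ?thesis using N(2) c by blast
  qed
  moreover have "b \<notin> \<phi> ` B" if "b > N + M" for b
  proof
    assume "b \<in> \<phi> ` B"
    then obtain c where c: "b = \<phi> c" "c \<in> B" by blast
    then have "c > N" using assms(3)[of c] that by linarith
    then show False using N(3) c by blast
  qed
  ultimately show ?thesis unfolding maya_iff_bounded using N(1) M by (intro exI[of _ "N + M"]) simp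
qed

text \<open>Only a difference of two sums can be substituted: \<open>\<phi>\<close> moves the vacuum
  as well, and this common contribution cancels.\<close>

lemma wsum_image_diff:
  assumes "maya B" "maya C" "bij \<phi>" "\<And>b. \<bar>\<phi> b - b\<bar> \<le> M"
  shows "wsum w (\<phi> ` B) - wsum w (\<phi> ` C) = wsum (\<lambda>b. w (\<phi> b)) B - wsum (\<lambda>b. w (\<phi> b)) C"
proof -
  have inj: "inj \<phi>" using assms(3) by (rule bij_is_inj)
  have "sum w (\<phi> ` X - \<phi> ` Y) = sum (\<lambda>b. w (\<phi> b)) (X - Y)" for X Y
    using inj by (simp add: image_set_diff[symmetric] sum.reindex inj_on_subset o_def)
  then show ?thesis
    using wsum_diff[OF bij_bounded_maya[OF assms(1,3,4)] bij_bounded_maya[OF assms(2,3,4)]]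
      wsum_diff[OF assms(1,2)] by simp
qed

text \<open>
  With \<open>L\<close> a multiple of \<open>s\<close> and \<open>m = t\<close>: if the \<open>t\<close>-core is also an \<open>s\<close>-core, then the charges of the
  \<open>t\<close>-runners decrease along steps by \<open>s\<close>, so an inversion between two runners is always compensated.
\<close>

lemma same_charge_shift_card:
  assumes "maya B" "maya C" "same_charge m B C" "down_closed L C"
  shows "card {b. m dvd b - r \<and> b \<notin> B \<and> b + L \<in> B} \<le> card {b. m dvd b - r \<and> b \<in> B \<and> b + L \<notin> B}"
    and "finite {b. m dvd b - r \<and> b \<in> B \<and> b + L \<notin> B}"
    and "finite {b. m dvd b - r \<and> b \<notin> B \<and> b + L \<in> B}"
proof -
  let ?g = "\<lambda>b. of_bool (m dvd b - r) :: int"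
  let ?s = "\<lambda>b::int. b - L"
  have bij: "bij ?s" by (rule o_bij[of "\<lambda>b. b + L"]) auto
  have bd: "\<bar>?s b - b\<bar> \<le> \<bar>L\<bar>" for b by simp
  have mem: "b \<in> ?s ` X \<longleftrightarrow> b + L \<in> X" for b X by (auto simp: image_iff) (metis add_diff_cancel_right')
  have mB: "maya (?s ` B)" "maya (?s ` C)" using bij_bounded_maya[OF _ bij bd] assms(1,2) by auto
  have fin: "finite (B - ?s ` B)" "finite (?s ` B - B)" "finite (C - ?s ` C)"
    using maya_finite_diff assms mB by auto
  have c: "sum ?g X = int (card {b \<in> X. m dvd b - r})" if "finite X" for X
    using that by (simp add: sum.inter_filter[symmetric] of_bool_def flip: card_eq_sum)
  have e1: "{b \<in> ?s ` B - B. m dvd b - r} = {b. m dvd b - r \<and> b \<notin> B \<and> b + L \<in> B}"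
    and e2: "{b \<in> B - ?s ` B. m dvd b - r} = {b. m dvd b - r \<and> b \<in> B \<and> b + L \<notin> B}"
    by (auto simp: mem)
  show "finite {b. m dvd b - r \<and> b \<in> B \<and> b + L \<notin> B}"
    unfolding e2[symmetric] by (rule finite_subset[OF _ fin(1)]) blast
  show "finite {b. m dvd b - r \<and> b \<notin> B \<and> b + L \<in> B}"
    unfolding e1[symmetric] by (rule finite_subset[OF _ fin(2)]) blast
  have "?s ` C - C = {}" using assms(4) by (auto simp: down_closed_def)
  then have "sum ?g (?s ` C - C) = 0" by (simp only: sum.empty)
  then have "wsum ?g C - wsum ?g (?s ` C) \<ge> 0"
    using wsum_diff[OF assms(2) mB(2), of ?g] sum_nonneg[of "C - ?s ` C" ?g] by simp
  moreover have "wsum ?g C = wsum ?g B"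
    by (rule sym, rule same_chargeD[OF assms(3)]) (rule periodic_class)
  \<comment> \<open>The shifted indicator is again \<open>m\<close>-periodic, so the equality of
    charges applies to the shifted sets too.\<close>
  moreover have "wsum ?g (?s ` B) - wsum ?g (?s ` C) = 0"
  proof -
    have "?g (?s (b + m)) = ?g (?s b)" for b
      using periodic_class[of m "b - L" r] by (simp add: algebra_simps)
    then have "wsum (\<lambda>b. ?g (?s b)) B = wsum (\<lambda>b. ?g (?s b)) C"
      by (rule same_chargeD[OF assms(3)])
    then show ?thesis using wsum_image_diff[OF assms(1,2) bij bd, of ?g] by simp
  qed
  ultimately have "wsum ?g B - wsum ?g (?s ` B) \<ge> 0" by simp
  then show "card {b. m dvd b - r \<and> b \<notin> B \<and> b + L \<in> B} \<le> card {b. m dvd b - r \<and> b \<in> B \<and> b + L \<notin> B}"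
    unfolding e1[symmetric] e2[symmetric]
    using wsum_diff[OF assms(1) mB(1), of ?g] c[OF fin(1)] c[OF fin(2)] by simp
qed


section \<open>Self-dual sets\<close>

lemma bar_neq [simp]: "bar a \<noteq> a" "a \<noteq> bar a"
  unfolding bar_def by presburger+

lemma bar_inject [simp]: "bar a = bar b \<longleftrightarrow> a = b"
  by (auto simp: bar_def)

lemma bar_dvd_diff: "m dvd bar a - bar b \<longleftrightarrow> m dvd a - b"
proof -
  have "bar a - bar b = b - a" by (simp add: bar_def)
  then show ?thesis by (metis dvd_diff_commute)
qed

lemma self_dual_exchange2:
  assumes "self_dual B" "a \<in> B" "c \<notin> B" "bar a \<noteq> c"
  shows "self_dual (insert c (insert (bar a) (B - {a, bar c})))"
  unfolding self_dual_def
proof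
  fix b
  have e: "bar b = c \<longleftrightarrow> b = bar c" "bar b = bar a \<longleftrightarrow> b = a" "bar b = a \<longleftrightarrow> b = bar a" "bar b = bar c \<longleftrightarrow> b = c"
    by (auto simp: bar_def)
  have "a \<noteq> c" using assms by auto
  moreover have "bar a \<notin> B" "bar c \<in> B" using assms self_dualD by blast+
  ultimately show "(b \<in> insert c (insert (bar a) (B - {a, bar c}))) =
         (bar b \<notin> insert c (insert (bar a) (B - {a, bar c})))"
    using assms self_dualD[OF assms(1), of b] by (auto simp: e)
qed

text \<open>The hook from \<open>z\<close> to \<open>z - m\<close> and its mirror image from
  \<open>bar (z - m)\<close> to \<open>bar z\<close> are removed together; the excluded equation
  describes a hook that is its own mirror image.\<close>

lemma self_dual_remove_two:
  assumes "maya B" "self_dual B" "z \<in> B" "z - m \<notin> B" "z \<noteq> bar (z - m)"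
  obtains B' where "maya B'" "self_dual B'" "same_charge m B' B" "energy B' = energy B - 2 * m"
    "\<And>b. b \<in> B' \<longleftrightarrow> b = z - m \<or> b = bar z \<or> b \<in> B \<and> b \<noteq> z \<and> b \<noteq> bar (z - m)"
proof -
  define C where "C = insert (z - m) (B - {z})"
  have C: "maya C" "same_charge m C B" "energy C = energy B - m"
    unfolding C_def using maya_exchange[OF assms(1)] same_charge_exchange[OF assms(1,3,4)]
      energy_exchange[OF assms(1,3,4)] by auto
  define B' where "B' = insert (bar z) (C - {bar (z - m)})"
  have bz: "bar z \<notin> B" "bar (z - m) \<in> B" using assms self_dualD by blast+
  have in1: "bar (z - m) \<in> C" unfolding C_def using bz assms(5) by auto
  have "bar z \<noteq> z - m" using assms(5) by (metis bar_bar)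
  then have in2: "bar z \<notin> C" unfolding C_def using bz by auto
  have d: "bar (z - m) - bar z = m" by (simp add: bar_def)
  then have "m dvd bar (z - m) - bar z" by simp
  then have "maya B'" "same_charge m B' C" "energy B' = energy C - bar (z - m) + bar z"
    unfolding B'_def using maya_exchange[OF C(1)] same_charge_exchange[OF C(1) in1 in2]
      energy_exchange[OF C(1) in1 in2] by auto
  moreover have mem: "\<And>b. b \<in> B' \<longleftrightarrow> b = z - m \<or> b = bar z \<or> b \<in> B \<and> b \<noteq> z \<and> b \<noteq> bar (z - m)"
    unfolding B'_def C_def by auto
  moreover have "self_dual B'"
  proof -
    have "B' = insert (z - m) (insert (bar z) (B - {z, bar (z - m)}))" using mem by auto
    then show ?thesis using self_dual_exchange2[OF assms(2,3,4)] \<open>bar z \<noteq> z - m\<close> by simp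
  qed
  ultimately show thesis using that C d same_charge_trans by (smt (verit))
qed

text \<open>Off the self-dual runner, \<open>m\<close>-hooks can be removed in pairs exchanged by \<open>bar\<close>.\<close>

lemma even_weight:
  assumes "maya B" "self_dual B" "maya C" "down_closed m C" "same_charge m B C" "m > 0"
    and "\<And>a. a \<in> B \<Longrightarrow> m dvd a - bar a \<Longrightarrow> a < bar a"
  shows "2 * m dvd energy B - energy C"
  using assms(1,2,5,7)
proof (induction "nat (energy B)" arbitrary: B rule: less_induct)
  case less
  show ?case
  proof (cases "down_closed m B")
    case True
    then have "B = C" using core_unique[OF less.prems(1) assms(3) True assms(4) less.prems(3) assms(6)] by simp
    then show ?thesis by simp
  next
    case False
    then obtain z where z: "z \<in> B" "z - m \<notin> B" by (auto simp: down_closed_def)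
    \<comment> \<open>Beads on the self-dual runner are negative by hypothesis, but \<open>z\<close>
      and \<open>bar (z - m)\<close> cannot both be negative, so the removable hook lies off this
      runner.\<close>
    have nd: "\<not> m dvd z - bar z"
    proof
      assume d: "m dvd z - bar z"
      then have "z < bar z" using less.prems(4) z by blast
      have "bar (z - m) \<in> B" using z self_dualD[OF less.prems(2)] by blast
      moreover have "bar (z - m) - bar (bar (z - m)) = - (z - bar z) + 2 * m" by (simp add: bar_def)
      then have "m dvd bar (z - m) - bar (bar (z - m))" using d
        by (metis dvd_add dvd_minus_iff dvd_triv_right)
      ultimately have "bar (z - m) < bar (bar (z - m))" using less.prems(4) by blast
      then show False using \<open>z < bar z\<close> assms(6) by (simp add: bar_def)
    qed
    have "z - bar z = m" if "z = bar (z - m)" using that by (simp add: bar_def)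
    then have "z \<noteq> bar (z - m)" using nd by auto
    then obtain B' where B': "maya B'" "self_dual B'" "same_charge m B' B" "energy B' = energy B - 2 * m"
      "\<And>b. b \<in> B' \<longleftrightarrow> b = z - m \<or> b = bar z \<or> b \<in> B \<and> b \<noteq> z \<and> b \<noteq> bar (z - m)"
      using self_dual_remove_two[OF less.prems(1,2) z] by metis
    \<comment> \<open>Both new beads lie off the self-dual runner, so the hypothesis survives the
      removal.\<close>
    have lt: "a < bar a" if "a \<in> B'" "m dvd a - bar a" for a
    proof -
      have "a \<noteq> bar z" using nd that(2) by (metis bar_bar dvd_diff_commute)
      moreover have "a \<noteq> z - m"
      proof
        assume "a = z - m"
        then have "z - bar z = (a - bar a) + m * 2" by (simp add: bar_def)
        then show False using nd that(2) by simp
      qed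
      ultimately show ?thesis using that B'(5) less.prems(4) by blast
    qed
    have "nat (energy B') < nat (energy B)" using energy_nonneg[of B'] B'(4) assms(6) by linarith
    from less.hyps[OF this B'(1,2) same_charge_trans[OF B'(3) less.prems(3)] lt]
    have "2 * m dvd energy B' - energy C" .
    then have "2 * m dvd (energy B' - energy C) + 2 * m" by (simp only: dvd_add_triv_right_iff)
    then show ?thesis using B'(4) by simp
  qed
qed

text \<open>Without such a bead all hooks would come off in mirror pairs. This produces the first
  hook to undo in the uniqueness proofs.\<close>

lemma odd_weight_diagonal:
  assumes "maya B" "self_dual B" "maya C" "down_closed m C" "same_charge m B C" "m > 0"
    and "energy B - energy C = m * (2 * k + 1)"
  obtains a where "a \<in> B" "m dvd a - bar a" "bar a < a"
proof (rule ccontr)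
  assume "\<not> thesis"
  then have "a < bar a" if "a \<in> B" "m dvd a - bar a" for a
    using that \<open>\<And>a. a \<in> B \<Longrightarrow> m dvd a - bar a \<Longrightarrow> bar a < a \<Longrightarrow> thesis\<close> bar_neq(1)[of a]
    by (metis linorder_neqE_linordered_idom)
  then have "2 * m dvd m * (2 * k + 1)" using even_weight[OF assms(1-6)] assms(7) by metis
  then have "m * 2 dvd m * (2 * k + 1)" by (simp only: mult.commute)
  then have "2 dvd 2 * k + 1" using assms(6) by (subst (asm) dvd_mult_cancel_left) auto
  then show False by presburger
qed

text \<open>Removing the only hook leads from a self-dual set to a self-dual core, so the hook must
  be its own mirror image, which fixes its position.\<close>

lemma weight_one:
  assumes "maya B" "self_dual B" "maya C" "self_dual C" "down_closed m C" "same_charge m B C" "m > 0"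
    and "energy B = energy C + m"
  obtains c where "bar c = c + m" "c \<in> C" "bar c \<notin> C" "B = insert (bar c) (C - {c})"
proof -
  have "\<not> down_closed m B"
    using core_unique[OF assms(1,3) _ assms(5,6,7)] assms(7,8) by auto
  then obtain z where z: "z \<in> B" "z - m \<notin> B" by (auto simp: down_closed_def)
  define B' where "B' = insert (z - m) (B - {z})"
  have "maya B'" "same_charge m B' B" "energy B' = energy B - m"
    unfolding B'_def using maya_exchange[OF assms(1)] same_charge_exchange[OF assms(1) z]
      energy_exchange[OF assms(1) z] by auto
  then have "B' = C"
    using core_energy_eq[OF _ assms(3,5) _ assms(7), of B'] assms(6,8) same_charge_trans by force
  then have C: "C = insert (z - m) (B - {z})" by (simp add: B'_def)
  have "bar z = z - m"
  proof (rule ccontr)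
    assume n: "bar z \<noteq> z - m"
    have "z \<notin> C" using C assms(7) by simp
    then have "bar z \<in> C" using self_dualD[OF assms(4)] by blast
    then have "bar z \<in> B" using C n by auto
    then show False using z self_dualD[OF assms(2)] by blast
  qed
  then have "bar (z - m) = z" by (metis bar_bar)
  show thesis
  proof (rule that[of "z - m"])
    show "z - m \<in> C" "bar (z - m) \<notin> C" unfolding \<open>bar (z - m) = z\<close> using C assms(7) by simp_all
    show "B = insert (bar (z - m)) (C - {z - m})" unfolding \<open>bar (z - m) = z\<close> C using z by auto
  qed (simp add: \<open>bar (z - m) = z\<close>)
qed

text \<open>Each runner has beads far below and gaps far above, so somewhere it steps from a bead to
  a gap.\<close>

lemma maya_ascend:
  assumes "maya B" "m > 0"
  obtains e where "m dvd e - r" "e \<in> B" "e + m \<notin> B"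
proof -
  obtain N where N: "N \<ge> 0" "\<And>b. b < -N \<Longrightarrow> b \<in> B" "\<And>b. b > N \<Longrightarrow> b \<notin> B"
    using maya_bound[OF assms(1)] by metis
  \<comment> \<open>The starting point lies on the runner of \<open>r\<close> and below
    \<open>-N\<close>, because \<open>m \<ge> 1\<close>.\<close>
  define P where "P = (\<lambda>k::nat. r - m * (\<bar>r\<bar> + N + 1) + m * int k \<notin> B)"
  have m1: "m * x \<ge> x" if "x \<ge> 0" for x using that assms(2)
    by (metis mult_le_cancel_right1 not_less zless_iff_Suc_zadd int_one_le_iff_zero_less)
  have "P (nat (2 * (\<bar>r\<bar> + N + 1)))"
  proof -
    have "m * (\<bar>r\<bar> + N + 1) \<ge> \<bar>r\<bar> + N + 1" using m1[of "\<bar>r\<bar> + N + 1"] N(1) by simp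
    then show ?thesis unfolding P_def using N(1) by (intro N(3)) (simp add: algebra_simps)
  qed
  moreover have "\<not> P 0"
  proof -
    have "m * (\<bar>r\<bar> + N + 1) \<ge> \<bar>r\<bar> + N + 1" using m1[of "\<bar>r\<bar> + N + 1"] N(1) by simp
    then show ?thesis unfolding P_def using N(2)[of "r - m * (\<bar>r\<bar> + N + 1)"] by simp
  qed
  ultimately obtain k where k: "\<not> P k" "P (Suc k)" using nat_induct[of "\<lambda>k. \<not> P k"] by blast
  show thesis
  proof (rule that)
    show "m dvd (r - m * (\<bar>r\<bar> + N + 1) + m * int k) - r" by (simp add: algebra_simps)
    show "r - m * (\<bar>r\<bar> + N + 1) + m * int k \<in> B" using k(1) by (simp add: P_def)
    show "r - m * (\<bar>r\<bar> + N + 1) + m * int k + m \<notin> B" using k(2) by (simp add: P_def algebra_simps)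
  qed
qed


section \<open>Switching rectangles\<close>

definition solution :: "int \<Rightarrow> int \<Rightarrow> int set \<Rightarrow> int set \<Rightarrow> int \<Rightarrow> int set \<Rightarrow> bool" where
  "solution s t \<sigma> \<tau> n B \<longleftrightarrow>
     maya B \<and> self_dual B \<and> same_charge s B \<sigma> \<and> same_charge t B \<tau> \<and> energy B = n"

text \<open>\<open>a\<close>, \<open>d\<close> and \<open>p\<close>, \<open>q\<close> are the
  diagonals of a rectangle with sides divisible by \<open>s\<close> and \<open>t\<close>; the
  conclusion lists the only obstruction to the mirrored switch. The inequalities exclude degenerate
  rectangles, where one bead would have to move twice.\<close>

definition unswitchable :: "int \<Rightarrow> int \<Rightarrow> int set \<Rightarrow> bool" where
  "unswitchable s t B \<longleftrightarrow> (\<forall>a\<in>B. \<forall>d\<in>B. \<forall>p. \<forall>q. p \<notin> B \<longrightarrow> q \<notin> B \<longrightarrow> a + d = p + q \<longrightarrow> s dvd a - p \<longrightarrow> t dvd a - q \<longrightarrow>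
     a \<noteq> d \<longrightarrow> p \<noteq> q \<longrightarrow> bar a = p \<or> bar a = q \<or> bar d = p \<or> bar d = q)"

lemma solution_swap: "solution s t \<sigma> \<tau> n B \<longleftrightarrow> solution t s \<tau> \<sigma> n B"
  by (auto simp: solution_def)

lemma unswitchableD:
  assumes "unswitchable s t B" "a \<in> B" "d \<in> B" "p \<notin> B" "q \<notin> B" "a + d = p + q" "s dvd a - p" "t dvd a - q"
    "a \<noteq> d" "p \<noteq> q"
  shows "bar a = p \<or> bar a = q \<or> bar d = p \<or> bar d = q"
  using assms unfolding unswitchable_def by blast

lemma unswitchable_swap: "unswitchable s t B \<Longrightarrow> unswitchable t s B"
  unfolding unswitchable_def by (metis add.commute)

lemma unique_solution_unswitchable:
  assumes sol: "solution s t \<sigma> \<tau> n B" and uniq: "\<And>C. solution s t \<sigma> \<tau> n C \<Longrightarrow> C = B"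
  shows "unswitchable s t B"
  unfolding unswitchable_def
proof (intro ballI allI impI)
  fix a d p q
  assume h: "a \<in> B" "d \<in> B" "p \<notin> B" "q \<notin> B" "a + d = p + q" "s dvd a - p" "t dvd a - q" "a \<noteq> d" "p \<noteq> q"
  have B: "maya B" "self_dual B" "same_charge s B \<sigma>" "same_charge t B \<tau>" "energy B = n"
    using sol by (auto simp: solution_def)
  note sd = self_dualD[OF B(2)]
  show "bar a = p \<or> bar a = q \<or> bar d = p \<or> bar d = q"
  proof (rule ccontr)
    assume neg: "\<not> ?thesis"
    have m: "bar a \<notin> B" "bar d \<notin> B" "bar p \<in> B" "bar q \<in> B" using sd h by auto
    have ne: "bar p \<noteq> a" "bar q \<noteq> a" "bar p \<noteq> d" "bar q \<noteq> d" using neg by (metis bar_bar)+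
    \<comment> \<open>Opposite corners are both beads or both gaps, hence never mirror images of
      each other; \<open>ne\<close> and \<open>neg\<close> rule this out for adjacent corners. So
      the rectangle and its image can be switched at once.\<close>
    define C where "C = (B - {a, d, bar p, bar q}) \<union> {p, q, bar a, bar d}"
    have d1: "B - C = {a, d, bar p, bar q}" and d2: "C - B = {p, q, bar a, bar d}"
      unfolding C_def using h(1-4) m by auto
    have mC: "maya C" by (rule maya_change[OF B(1)]) (simp_all add: d1 d2)
    have w: "wsum w C = wsum w B - w a - w d - w (bar p) - w (bar q) + w p + w q + w (bar a) + w (bar d)" for w
      using wsum_diff[OF B(1) mC, of w] ne h neg unfolding d1 d2 by (simp add: eq_commute)
    have dv: "d - q = p - a" "d - p = q - a" using h(5) by simp_all
    have sdv: "s dvd d - q" "t dvd d - p" unfolding dv using h(6,7) by (simp_all add: dvd_diff_commute)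
    have gs: "same_charge s C B" unfolding same_charge_def
    proof (intro allI impI)
      fix g :: "int \<Rightarrow> int" assume g: "\<forall>b. g (b + s) = g b"
      note c = periodic_cong[OF g]
      show "wsum g C = wsum g B" unfolding w
        using c[OF h(6)] c[OF sdv(1)] c[of "bar a" "bar p"] c[of "bar d" "bar q"] h(6) sdv(1)
        by (simp add: bar_dvd_diff)
    qed
    have gt: "same_charge t C B" unfolding same_charge_def
    proof (intro allI impI)
      fix g :: "int \<Rightarrow> int" assume g: "\<forall>b. g (b + t) = g b"
      note c = periodic_cong[OF g]
      show "wsum g C = wsum g B" unfolding w
        using c[OF h(7)] c[OF sdv(2)] c[of "bar a" "bar q"] c[of "bar d" "bar p"] h(7) sdv(2)
        by (simp add: bar_dvd_diff)
    qed
    have "energy C = energy B" unfolding energy_def w using h(5) by (simp add: bar_def)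
    moreover have "self_dual C" unfolding self_dual_def
    proof
      fix b
      have e: "bar b = x \<longleftrightarrow> b = bar x" "bar b = bar x \<longleftrightarrow> b = x" for x by (auto simp: bar_def)
      show "b \<in> C \<longleftrightarrow> bar b \<notin> C" unfolding C_def
        using h(1-4,8,9) m ne neg by (simp only: Un_iff Diff_iff insert_iff empty_iff e sd) (auto simp: sd)
    qed
    ultimately have "solution s t \<sigma> \<tau> n C" unfolding solution_def
      using mC gs gt B same_charge_trans by blast
    then have "C = B" by (rule uniq)
    then show False using d1 by auto
  qed
qed

text \<open>Supplies missing corners of rectangles: the inversion \<open>b\<close>,
  \<open>b + L\<close> must be compensated on the same runner modulo \<open>m\<close>.\<close>

lemma same_charge_witness:
  assumes "maya B" "maya C" "same_charge m B C" "down_closed L C" "b \<notin> B" "b + L \<in> B"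
  obtains c where "m dvd c - b" "c \<in> B" "c + L \<notin> B"
proof -
  let ?X = "{c. m dvd c - b \<and> c \<notin> B \<and> c + L \<in> B}" and ?Y = "{c. m dvd c - b \<and> c \<in> B \<and> c + L \<notin> B}"
  note sh = same_charge_shift_card[OF assms(1-4), of b]
  have "b \<in> ?X" using assms by simp
  then have "card ?X > 0" using sh(3) by (metis card_gt_0_iff empty_iff)
  then have "?Y \<noteq> {}" using sh(1) by (metis (no_types, lifting) card.empty not_less)
  then show thesis using that by blast
qed

text \<open>Two inversions need two compensating places, and one of these avoids any prescribed
  \<open>e\<close>.\<close>

lemma same_charge_witness2:
  assumes "maya B" "maya C" "same_charge m B C" "down_closed L C" "b \<notin> B" "b + L \<in> B"
    and "b' \<noteq> b" "m dvd b' - b" "b' \<notin> B" "b' + L \<in> B"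
  obtains c where "m dvd c - b" "c \<in> B" "c + L \<notin> B" "c \<noteq> e"
proof -
  let ?X = "{c. m dvd c - b \<and> c \<notin> B \<and> c + L \<in> B}" and ?Y = "{c. m dvd c - b \<and> c \<in> B \<and> c + L \<notin> B}"
  note sh = same_charge_shift_card[OF assms(1-4), of b]
  have "{b, b'} \<subseteq> ?X" using assms by simp
  then have "card {b, b'} \<le> card ?X" using sh(3) by (rule card_mono[rotated])
  then have "card ?Y \<ge> 2" using sh(1) assms(7) by (simp add: eq_commute)
  then have "\<not> ?Y \<subseteq> {e}" using card_mono[of "{e}" ?Y] by auto
  then show thesis using that by blast
qed

text \<open>Reduces divisibility goals to naming the coefficients of a linear combination.\<close>

lemma dvd_combine: "m dvd x \<Longrightarrow> m dvd y \<Longrightarrow> z = x * i + y * j \<Longrightarrow> m dvd z" for m x y z i j :: int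
  by simp

section \<open>Gaps at distances divisible by st\<close>

locale coprime_pair =
  fixes s t :: int
  assumes s_gt_1: "s > 1" and t_gt_1: "t > 1" and coprime_st: "coprime s t"
begin

lemma swap: "coprime_pair t s"
  using s_gt_1 t_gt_1 coprime_st by unfold_locales (simp_all add: ac_simps)

lemma s_dvd_t_mult: "s dvd t * k \<longleftrightarrow> s dvd k"
  using coprime_st by (simp add: coprime_dvd_mult_right_iff)

lemma not_s_dvd_t: "\<not> s dvd t"
  using coprime_common_divisor[OF coprime_st dvd_refl] s_gt_1 by (auto simp: zdvd1_eq)

lemma not_s_dvd_2t: "odd s \<Longrightarrow> \<not> s dvd 2 * t"
  using not_s_dvd_t by (metis coprime_dvd_mult_right_iff coprime_right_2_iff_odd)

lemma st_dvd: "s dvd x \<Longrightarrow> t dvd x \<Longrightarrow> s * t dvd x"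
  using coprime_st by (simp add: divides_mult)

lemma st_pos: "s * t > 0"
  using s_gt_1 t_gt_1 by simp

lemma down_closed_st: "down_closed s C \<Longrightarrow> down_closed (s * t) C"
  using down_closed_mult[of s C _ t] t_gt_1 by (auto simp: down_closed_def)

text \<open>
  An \<open>st\<close>-hook can be moved to any \<open>st\<close>-runner \<open>c\<close> that shares its residue modulo \<open>t\<close>;
  the conditions on \<open>c\<close> keep this move away from its mirror image.
\<close>

lemma gap_aux:
  assumes B: "maya B" "unswitchable s t B" and b: "b \<in> B" "b - (s * t) * m \<notin> B" "m > 0"
    and c: "t dvd c - b" "\<not> s dvd c - b" "\<not> s dvd c - bar b" "\<not> s * t dvd c - bar c"
  shows "bar b = b - (s * t) * m"
proof -
  have "(s * t) * m > 0" using st_pos b(3) by simp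
  \<comment> \<open>On the runner of \<open>c\<close> a bead followed by a gap at the same distance
    is chosen, so that the beads \<open>b\<close>, \<open>e\<close> and the gaps \<open>?p\<close>,
    \<open>?q\<close> form a rectangle.\<close>
  then obtain e where e: "(s * t) * m dvd e - c" "e \<in> B" "e + (s * t) * m \<notin> B"
    using maya_ascend[OF B(1)] by metis
  have est: "s * t dvd e - c" using e(1) by (metis dvd_mult_left)
  then have es: "s dvd e - c" and et: "t dvd e - c" by (auto dest: dvd_mult_left dvd_mult_right)
  let ?p = "b - (s * t) * m" and ?q = "e + (s * t) * m"
  have 1: "s dvd b - ?p" by (simp add: mult.assoc)
  have 2: "t dvd b - ?q"
    by (rule dvd_combine[of t "c - b" "(e - c) + s * t * m" _ "-1" "-1"]) (use c(1) et in simp_all)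
  have es': "\<not> s dvd e - b" using es c(2) by (metis dvd_add_right_iff diff_add_cancel add_diff_eq)
  have ebs: "\<not> s dvd e - bar b" using es c(3) by (metis dvd_add_right_iff diff_add_cancel add_diff_eq)
  have ne1: "b \<noteq> e" using es' by auto
  have ne2: "?p \<noteq> ?q"
  proof
    assume "?p = ?q"
    then have "e - b = s * (- t * m - t * m)" by (simp add: algebra_simps)
    then show False using es' by simp
  qed
  have ee: "\<not> s * t dvd e - bar e"
  proof
    assume "s * t dvd e - bar e"
    then have "s * t dvd c - bar c"
      by (rule dvd_combine[of _ _ "e - c" _ 1 "-2"]) (use est in \<open>simp_all add: bar_def\<close>)
    then show False using c(4) by simp
  qed
  have "bar b = ?p \<or> bar b = ?q \<or> bar e = ?p \<or> bar e = ?q"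
    by (rule unswitchableD[OF B(2) b(1) e(2) b(2) e(3) _ 1 2 ne1 ne2]) simp
  moreover have "bar b \<noteq> ?q"
  proof
    assume "bar b = ?q"
    then have "e - bar b = s * (- t * m)" by simp
    then show False using ebs by simp
  qed
  moreover have "bar e \<noteq> ?p"
  proof
    assume "bar e = ?p"
    then have "e - bar b = s * (t * m)" by (simp add: bar_def)
    then show False using ebs by simp
  qed
  moreover have "bar e \<noteq> ?q"
  proof
    assume "bar e = ?q"
    then have "e - bar e = s * t * (- m)" by simp
    then show False using ee by simp
  qed
  ultimately show ?thesis by blast
qed

text \<open>The candidate is \<open>b + t\<close>; if it falls into the class of
  \<open>bar b\<close> modulo \<open>s\<close>, then \<open>b + t * 2\<close> is taken, which
  \<open>s \<ge> 3\<close> keeps out of the class of \<open>b\<close>.\<close>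

lemma gap_choice:
  assumes "s \<ge> 3" "\<not> t dvd b - bar b \<or> s dvd b - bar b"
  obtains c where "t dvd c - b" "\<not> s dvd c - b" "\<not> s dvd c - bar b" "\<not> s * t dvd c - bar c"
proof (cases "s dvd b - bar b")
  case True
  have "b - bar b = 2 * b + 1" by (simp add: bar_def)
  then have "odd s" using True by (metis dvd_trans even_add even_mult_iff odd_one dvd_triv_left)
  have 1: "\<not> s dvd (b + t) - bar b"
  proof
    assume "s dvd (b + t) - bar b"
    then have "s dvd t" by (rule dvd_combine[OF _ True, of _ _ 1 "-1"]) simp
    then show False using not_s_dvd_t by simp
  qed
  have 2: "\<not> s * t dvd (b + t) - bar (b + t)"
  proof
    assume "s * t dvd (b + t) - bar (b + t)"
    then have "s dvd (b + t) - bar (b + t)" by (rule dvd_mult_left)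
    then have "s dvd 2 * t" by (rule dvd_combine[OF _ True, of _ _ 1 "-1"]) (simp add: bar_def)
    then show False using not_s_dvd_2t[OF \<open>odd s\<close>] by simp
  qed
  show thesis by (rule that[of "b + t"]) (use 1 2 not_s_dvd_t in simp_all)
next
  case False
  then have nt: "\<not> t dvd b - bar b" using assms(2) by blast
  have c4: "\<not> s * t dvd (b + t * k) - bar (b + t * k)" for k
  proof
    assume "s * t dvd (b + t * k) - bar (b + t * k)"
    then have "t dvd (b + t * k) - bar (b + t * k)" by (rule dvd_mult_right)
    then have "t dvd b - bar b" by (rule dvd_combine[of _ _ t _ 1 "- 2 * k"]) (simp_all add: bar_def)
    then show False using nt by simp
  qed
  show thesis
  proof (cases "s dvd (b + t) - bar b")
    case False
    show thesis by (rule that[of "b + t"]) (use False not_s_dvd_t c4[of 1] in simp_all)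
  next
    case True
    have "\<not> s dvd (b + t * 2) - bar b"
    proof
      assume "s dvd (b + t * 2) - bar b"
      then have "s dvd t" by (rule dvd_combine[OF _ True, of _ _ 1 "-1"]) simp
      then show False using not_s_dvd_t by simp
    qed
    moreover have "\<not> s dvd (b + t * 2) - b"
      using s_dvd_t_mult[of 2] assms(1) zdvd_imp_le[of s 2] by auto
    ultimately show thesis using that[of "b + t * 2"] c4[of 2] by simp
  qed
qed

end

text \<open>The hypotheses of \<open>gap_choice\<close> hold for \<open>(s, t)\<close> or for
  \<open>(t, s)\<close>: not both numbers are 2, and if one of them is 2 it does not divide the odd
  number \<open>b - bar b\<close>.\<close>

lemma (in coprime_pair) gap_dual:
  assumes B: "maya B" "unswitchable s t B" and b: "b \<in> B" "b - (s * t) * m \<notin> B" "m > 0"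
  shows "bar b = b - (s * t) * m"
proof -
  have 2: "\<not> 2 dvd b - bar b" unfolding bar_def by presburger
  consider "s \<ge> 3" "\<not> t dvd b - bar b \<or> s dvd b - bar b" | "t \<ge> 3" "\<not> s dvd b - bar b \<or> t dvd b - bar b"
  proof -
    have "s = 2 \<or> s \<ge> 3" "t = 2 \<or> t \<ge> 3" "\<not> (s = 2 \<and> t = 2)"
      using s_gt_1 t_gt_1 coprime_st by auto
    then show ?thesis using that 2 by blast
  qed
  then show ?thesis
  proof cases
    case 1
    then obtain c where "t dvd c - b" "\<not> s dvd c - b" "\<not> s dvd c - bar b" "\<not> s * t dvd c - bar c"
      by (rule gap_choice)
    then show ?thesis using gap_aux[OF B b] by blast
  next
    case 2
    interpret sw: coprime_pair t s by (rule swap)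
    obtain c where "s dvd c - b" "\<not> t dvd c - b" "\<not> t dvd c - bar b" "\<not> t * s dvd c - bar c"
      using sw.gap_choice[OF 2] by metis
    then show ?thesis using sw.gap_aux[OF B(1) unswitchable_swap[OF B(2)], of b m c] b
      by (simp add: mult.commute[of t s])
  qed
qed

text \<open>Splitting a longer gap at \<open>b - s * t\<close> would give a second self-mirror
  interval sharing exactly one end with the first.\<close>

lemma (in coprime_pair) gap_one:
  assumes B: "maya B" "unswitchable s t B" and b: "b \<in> B" "b - (s * t) * m \<notin> B" "m > 0"
  shows "m = 1"
proof (rule ccontr)
  assume "m \<noteq> 1"
  then have m: "m - 1 > 0" using b(3) by simp
  have d: "bar b = b - (s * t) * m" by (rule gap_dual[OF B b])
  show False
  proof (cases "b - s * t \<in> B")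
    case True
    have e: "b - s * t - (s * t) * (m - 1) = b - (s * t) * m" by (simp add: algebra_simps)
    have "bar (b - s * t) = bar b" using gap_dual[OF B True _ m] b(2) d unfolding e by simp
    then show False using st_pos s_gt_1 t_gt_1 by simp
  next
    case False
    then have "bar b = b - (s * t) * 1" using gap_dual[OF B b(1), of 1] by simp
    then show False using d \<open>m \<noteq> 1\<close> s_gt_1 t_gt_1 by auto
  qed
qed


section \<open>Rigid self-dual sets\<close>

text \<open>As \<open>b + m\<close> is a gap, \<open>bar b - m = bar (b + m)\<close> is a bead: the
  top bead of a runner moves to the first gap of the mirror runner.\<close>

lemma self_dual_core_exchange_closed:
  assumes "self_dual C" "down_closed m C" "b \<in> C" "b + m \<notin> C" "\<not> m dvd b - bar b"
  shows "down_closed m (insert (bar b) (C - {b}))"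
  unfolding down_closed_def
proof
  fix x assume x: "x \<in> insert (bar b) (C - {b})"
  have "bar b - m = bar (b + m)" by (simp add: bar_def)
  then have "bar b - m \<in> C" using assms(1,4) self_dualD by metis
  moreover have "bar b - m \<noteq> b"
  proof
    assume "bar b - m = b"
    then have "b - bar b = - m" by simp
    then show False using assms(5) by simp
  qed
  moreover have "x - m \<in> C" "x - m \<noteq> b" if "x \<in> C"
    using that assms(2,4) by (auto simp: down_closed_def)
  ultimately show "x - m \<in> insert (bar b) (C - {b})" using x by auto
qed

text \<open>The charge sees only the runner of \<open>c\<close>, so the core results from moving the
  top bead \<open>b\<close> of that runner instead of \<open>c\<close>.\<close>

lemma self_dual_core_exchange:
  assumes C: "maya C" "self_dual C" "down_closed m C" and m: "m > 0"
    and c: "c \<in> C" "\<not> m dvd c - bar c"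
    and D: "maya D" "down_closed m D" "same_charge m D (insert (bar c) (C - {c}))"
  obtains b where "b \<in> C" "m dvd b - c" "b + m \<notin> C" "bar b \<notin> C" "\<not> m dvd b - bar b" "D = insert (bar b) (C - {b})"
proof -
  obtain b where b: "m dvd b - c" "b \<in> C" "b + m \<notin> C" using maya_ascend[OF C(1) m] by metis
  have nd: "\<not> m dvd b - bar b"
  proof
    assume "m dvd b - bar b"
    then have "m dvd c - bar c"
      by (rule dvd_combine[of _ _ "b - c" _ 1 "-2"]) (use b(1) in \<open>simp_all add: bar_def\<close>)
    then show False using c(2) by simp
  qed
  have nb: "bar b \<notin> C" "bar c \<notin> C" using b(2) c(1) self_dualD[OF C(2)] by blast+
  have "same_charge m (insert (bar b) (C - {b})) (insert (bar c) (C - {c}))"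
    by (rule same_charge_exchange2[OF C(1) b(2) nb(1) C(1) c(1) nb(2)]) (simp_all add: b bar_dvd_diff)
  then have "same_charge m D (insert (bar b) (C - {b}))"
    using D(3) same_charge_sym same_charge_trans by blast
  then have "D = insert (bar b) (C - {b})"
    using core_unique[OF D(1) maya_exchange[OF C(1)] D(2) self_dual_core_exchange_closed[OF C(2,3) b(2,3) nd] _ m]
    by blast
  then show thesis using that b nb nd by blast
qed

text \<open>The setting of the forward direction. It is symmetric under exchanging \<open>s\<close>,
  \<open>\<alpha>\<close> with \<open>t\<close>, \<open>\<beta>\<close>, so most arguments are made
  for one of the two moduli only.\<close>

locale rigid_pair = coprime_pair s t for s t :: int +
  fixes B \<alpha> \<beta> :: "int set"
  assumes maya_B: "maya B" and sd_B: "self_dual B" and unsw: "unswitchable s t B"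
    and maya_\<alpha>: "maya \<alpha>" and \<alpha>_s: "down_closed s \<alpha>" and \<alpha>_t: "down_closed t \<alpha>"
    and maya_\<beta>: "maya \<beta>" and \<beta>_s: "down_closed s \<beta>" and \<beta>_t: "down_closed t \<beta>"
    and charge_s: "same_charge s B \<alpha>" and charge_t: "same_charge t B \<beta>"
begin

lemma rigid_swap: "rigid_pair t s B \<beta> \<alpha>"
  using swap maya_B sd_B unswitchable_swap[OF unsw] maya_\<alpha> \<alpha>_s \<alpha>_t maya_\<beta> \<beta>_s \<beta>_t charge_s charge_t
  by (simp add: rigid_pair_def rigid_pair_axioms_def)

lemma not_t_dvd_s: "\<not> t dvd s"
  by (rule coprime_pair.not_s_dvd_t[OF swap])

lemma in_bar: "b \<notin> B \<Longrightarrow> bar b \<in> B" and notin_bar: "b \<in> B \<Longrightarrow> bar b \<notin> B"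
  using self_dualD[OF sd_B] by blast+

lemma \<alpha>_closed_mult: "k \<ge> 0 \<Longrightarrow> down_closed (t * k) \<alpha>"
  using down_closed_mult[OF \<alpha>_t] by (auto simp: down_closed_def)

end

text \<open>The excluded bead is the outer end of the central hook of length \<open>st\<close>, which leads to the fifth case.\<close>

locale rigid_pair_closed = rigid_pair +
  assumes no_middle: "\<forall>b\<in>B. bar b \<noteq> b - s * t"
begin

lemma rigid_closed_swap: "rigid_pair_closed t s B \<beta> \<alpha>"
  using rigid_swap no_middle by (simp add: rigid_pair_closed_def rigid_pair_closed_axioms_def mult.commute)

text \<open>By \<open>gap_one\<close> and \<open>gap_dual\<close> a violation would be the excluded
  central hook.\<close>

lemma closed_st: "b \<in> B \<Longrightarrow> c \<le> b \<Longrightarrow> s * t dvd b - c \<Longrightarrow> c \<in> B"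
proof (rule ccontr)
  assume h: "b \<in> B" "c \<le> b" "s * t dvd b - c" "c \<notin> B"
  then obtain m where m: "b - c = s * t * m" by blast
  have "b - c > 0" using h by (metis diff_gt_0_iff_gt order_le_less)
  then have "m > 0" using m st_pos by (metis zero_less_mult_pos)
  moreover have "c = b - s * t * m" using m by simp
  ultimately have "m = 1" "bar b = b - s * t * m"
    using gap_one[OF maya_B unsw h(1)] gap_dual[OF maya_B unsw h(1)] h(4) by auto
  then show False using no_middle h(1) by auto
qed

lemma no_st_gap: "b \<in> B \<Longrightarrow> c \<notin> B \<Longrightarrow> c \<le> b \<Longrightarrow> t dvd b - c \<Longrightarrow> \<not> s dvd b - c"
  using closed_st st_dvd by blast

text \<open>A bead further out on the self-dual \<open>t\<close>-runner would form a switchable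
  rectangle with a bead next to the centre.\<close>

lemma diagonal_t:
  assumes a: "a \<in> B" "t dvd a - bar a" "bar a < a"
  shows "a - bar a = t"
proof (rule ccontr)
  assume ne: "a - bar a \<noteq> t"
  obtain i where i: "a - bar a = t * i" using a(2) by blast
  have "t * i = 2 * a + 1" using i by (simp add: bar_def)
  then have oddi: "odd (t * i)" by simp
  then have "odd t" "odd i" by auto
  have "t * i > 0" using i a(3) by simp
  then have "i > 0" using t_gt_1 by (metis zero_less_mult_pos order_less_trans zero_less_one)
  moreover have "i \<noteq> 1" using ne i by auto
  moreover obtain j where "i = 2 * j + 1" using \<open>odd i\<close> by (rule oddE)
  ultimately have j: "i = 2 * j + 1" "j \<ge> 1" by linarith+
  \<comment> \<open>The middle step of the chain from \<open>bar a\<close> to \<open>a\<close>: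
    \<open>c\<close> and \<open>c + t\<close> are mirror images, so exactly one of them is a bead,
    and both lie strictly between \<open>bar a\<close> and \<open>a\<close> since
    \<open>j \<ge> 1\<close>.\<close>
  define c where "c = bar a + t * j"
  have c: "bar c = c + t" using i j(1) by (simp add: c_def bar_def algebra_simps)
  obtain l where l: "l = j \<or> l = j + 1" "bar a + t * l \<in> B"
  proof (cases "c \<in> B")
    case True then show thesis using that[of j] by (simp add: c_def)
  next
    case False
    then have "c + t \<in> B" using in_bar c by metis
    then show thesis using that[of "j + 1"] by (simp add: c_def algebra_simps)
  qed
  define y where "y = bar a + t * l"
  have y: "y \<in> B" using l by (simp add: y_def)
  have yb: "bar y - y = t \<or> bar y - y = - t" using l(1) c by (auto simp: y_def c_def bar_def algebra_simps)
  have na: "bar a \<notin> B" using a(1) by (rule notin_bar)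
  have lpos: "l > 0" using l j by auto
  have sl: "\<not> s dvd t * l"
    using no_st_gap[OF y na] lpos t_gt_1 by (simp add: y_def)
  have "bar a + t * l \<in> B" using y by (simp add: y_def)
  \<comment> \<open>The pair \<open>bar a\<close>, \<open>y\<close> is an inversion of length
    \<open>t * l\<close>; the compensating pair completes a rectangle with diagonals
    \<open>y\<close>, \<open>b\<close> and \<open>b + t * l\<close>, \<open>bar a\<close>.\<close>
  then obtain b where b: "s dvd b - bar a" "b \<in> B" "b + t * l \<notin> B"
    using same_charge_witness[OF maya_B maya_\<alpha> charge_s \<alpha>_closed_mult na] lpos by (metis less_imp_le)
  have "bar y = b + t * l \<or> bar y = bar a \<or> bar b = b + t * l \<or> bar b = bar a"
  proof (rule unswitchableD[OF unsw y b(2,3) na])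
    show "y + b = b + t * l + bar a" by (simp add: y_def)
    show "s dvd y - (b + t * l)" by (rule dvd_combine[OF b(1) dvd_refl, of _ "-1" 0]) (simp add: y_def)
    show "t dvd y - bar a" by (simp add: y_def)
    show "y \<noteq> b" using sl b(1) by (auto simp: y_def)
    show "b + t * l \<noteq> bar a"
    proof
      assume "b + t * l = bar a"
      then have "t * l = - (b - bar a)" by simp
      then show False using sl b(1) by (metis dvd_minus_iff)
    qed
  qed
  then show False
  proof (elim disjE)
    assume "bar y = b + t * l"
    then have "bar y - y = b - bar a" by (simp add: y_def)
    then show False using b(1) yb not_s_dvd_t by (metis dvd_minus_iff)
  next
    assume "bar y = bar a"
    then have "y = a" by simp
    then have "t * l = t * i" using i unfolding y_def by linarith
    then show False using l(1) j t_gt_1 by auto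
  next
    \<comment> \<open>Here the opposite side is itself symmetric. Oddness of \<open>t\<close> makes
      \<open>b - bar a\<close> divisible by \<open>s * t\<close>, and closure under
      \<open>s * t\<close> refutes either order of \<open>b\<close> and
      \<open>bar a\<close>.\<close>
    assume h: "bar b = b + t * l"
    obtain k where k: "b - bar a = s * k" using b(1) by blast
    have "2 * (s * k) = t * (i - l)" using h i k by (simp add: bar_def algebra_simps)
    then have "t dvd s * (2 * k)" by (metis dvd_triv_left mult.left_commute)
    then have "t dvd 2 * k" using coprime_pair.s_dvd_t_mult[OF swap] by blast
    then have "t dvd k" using \<open>odd t\<close> by (metis coprime_dvd_mult_right_iff coprime_right_2_iff_odd)
    then have st: "s * t dvd b - bar a" unfolding k by simp
    show False
    proof (cases "bar a \<le> b")
      case True then show False using closed_st[OF b(2) True st] na by simp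
    next
      case False
      have "s * t dvd y - (b + t * l)" by (rule dvd_combine[OF st dvd_refl, of _ "-1" 0]) (simp add: y_def)
      then show False using closed_st[OF y, of "b + t * l"] False b(3) by (simp add: y_def)
    qed
  next
    assume "bar b = bar a"
    then have "b = a" by simp
    then show False using no_st_gap[OF a(1) na _ a(2)] a(3) b(1) by simp
  qed
qed

text \<open>Needed when the central \<open>t\<close>-hook is undone: the bead \<open>bar c\<close>
  disappears, so no bead may stand \<open>s\<close> above it.\<close>

lemma shift_up:
  assumes c: "bar c = c + t" "bar c \<in> B"
  shows "bar c + s \<notin> B"
proof
  assume gs: "bar c + s \<in> B"
  have odd: "odd t" using c(1) unfolding bar_def by presburger
  have nc: "c \<notin> B" using c(2) notin_bar by blast
  have nts: "\<not> s dvd t" "\<not> t dvd s" by (rule not_s_dvd_t not_t_dvd_s)+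
  show False
  \<comment> \<open>If \<open>c + s\<close> is a gap, a compensating pair \<open>b\<close>,
    \<open>b + t\<close> completes a rectangle with \<open>c + s\<close>, \<open>bar c + s\<close>;
    if it is a bead, \<open>c\<close>, \<open>c + s\<close> is an inversion, and a pair
    \<open>b\<close>, \<open>b + s\<close> completes one.\<close>
  proof (cases "c + s \<in> B")
    case False
    have "c + t \<in> B" using c by simp
    then obtain b where b: "s dvd b - c" "b \<in> B" "b + t \<notin> B"
      using same_charge_witness[OF maya_B maya_\<alpha> charge_s \<alpha>_t nc] by metis
    have "bar b = c + s \<or> bar b = b + t \<or> bar (bar c + s) = c + s \<or> bar (bar c + s) = b + t"
    proof (rule unswitchableD[OF unsw b(2) gs False b(3)])
      show "b + (bar c + s) = c + s + (b + t)" using c(1) by simp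
      show "s dvd b - (c + s)" by (rule dvd_combine[OF b(1) dvd_refl, of _ 1 "-1"]) simp
      show "b \<noteq> bar c + s"
      proof
        assume "b = bar c + s"
        then have "s dvd t" using c(1) by (intro dvd_combine[OF b(1) dvd_refl, of _ 1 "-1"]) simp
        then show False using nts by simp
      qed
      show "c + s \<noteq> b + t"
      proof
        assume "c + s = b + t"
        then have "s dvd t" by (intro dvd_combine[OF b(1) dvd_refl, of _ "-1" 1]) simp
        then show False using nts by simp
      qed
    qed simp
    then show False
    proof (elim disjE)
      assume "bar b = c + s"
      then have "t = (b - c) * 1 + s * 1" using c(1) by (simp add: bar_def)
      then show False using dvd_combine[OF b(1) dvd_refl] nts by blast
    next
      assume "bar b = b + t"
      then have "b = c" using c(1) by (simp add: bar_def)
      then show False using b(2) nc by simp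
    next
      assume "bar (bar c + s) = c + s"
      then show False using s_gt_1 by (simp add: bar_def)
    next
      assume "bar (bar c + s) = b + t"
      then have "t = (b - c) * (-1) + s * (-1)" by (simp add: bar_def)
      then show False using dvd_combine[OF b(1) dvd_refl] nts by blast
    qed
  next
    case True
    then obtain b where b: "t dvd b - c" "b \<in> B" "b + s \<notin> B"
      using same_charge_witness[OF maya_B maya_\<beta> charge_t \<beta>_s nc] by metis
    have "bar b = b + s \<or> bar b = c \<or> bar (c + s) = b + s \<or> bar (c + s) = c"
    proof (rule unswitchableD[OF unsw b(2) True b(3) nc])
      show "t dvd b - c" by (rule b(1))
      show "b \<noteq> c + s" using b(1) nts by auto
      show "b + s \<noteq> c"
      proof
        assume "b + s = c"
        then have "s = - (b - c)" by simp
        then show False using b(1) nts by (metis dvd_minus_iff)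
      qed
    qed simp_all
    then show False
    proof (elim disjE)
      assume "bar b = b + s"
      then have "s = (b - c) * (-2) + t * 1" using c(1) by (simp add: bar_def)
      then show False using dvd_combine[OF b(1) dvd_refl] nts by blast
    next
      assume "bar b = c"
      then have "b = bar c" by (metis bar_bar)
      then show False using b(3) gs by simp
    next
      assume "bar (c + s) = b + s"
      then have "2 * s = t - (b - c)" using c(1) by (simp add: bar_def)
      then have "t dvd 2 * s" using b(1) by (metis dvd_diff dvd_refl)
      then show False using coprime_pair.not_s_dvd_2t[OF swap odd] by simp
    next
      assume "bar (c + s) = c"
      then have "s = t" using c(1) by (simp add: bar_def)
      then show False using nts by simp
    qed
  qed
qed

text \<open>Treats the blocked case \<open>bar z = b + s\<close> of \<open>descent\<close>. Then
  \<open>z - s\<close>, \<open>b\<close> and its mirror image are two inversions of the same length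
  \<open>bar z - z\<close>, a multiple of \<open>t\<close>, so the compensating \<open>y\<close> can
  be chosen different from \<open>z\<close>.\<close>

lemma descent_aux:
  assumes z: "z \<in> B" "z - s \<notin> B" "bar z \<noteq> z - t" and b: "b \<in> B" "bar z = b + s" "t dvd b - (z - s)"
  shows False
proof -
  have L: "b = z - s + (bar z - z)" using b(2) by simp
  have td: "t dvd bar z - z" using b(3) L by simp
  have lt: "z < bar z"
  proof (rule ccontr)
    assume "\<not> z < bar z"
    then have "bar z < z" using bar_neq(1)[of z] by linarith
    moreover have "t dvd z - bar z" using td by (simp add: dvd_diff_commute)
    ultimately have "z - bar z = t" using diagonal_t z(1) by blast
    then show False using z(3) by simp
  qed
  obtain k where k: "bar z - z = t * k" using td by blast
  have "t * k > 0" using k lt by simp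
  then have kpos: "k > 0" using t_gt_1 by (metis zero_less_mult_pos order_less_trans zero_less_one)
  have sL: "\<not> s dvd bar z - z"
    using no_st_gap[OF b(1) z(2)] L lt td by simp
  have nz: "z + s \<notin> B" using notin_bar[OF b(1)] b(2) by (simp add: bar_def algebra_simps)
  have bz: "bar z + s \<in> B" using in_bar[OF z(2)] by (simp add: bar_def algebra_simps)
  have cl: "down_closed (bar z - z) \<alpha>" unfolding k using \<alpha>_closed_mult kpos by simp
  have b': "z - s + (bar z - z) \<in> B" using b(1) L by simp
  obtain y where y: "s dvd y - (z - s)" "y \<in> B" "y + (bar z - z) \<notin> B" "y \<noteq> z"
  proof (rule same_charge_witness2[OF maya_B maya_\<alpha> charge_s cl z(2) b', of "z + s" z])
    show "z + s \<noteq> z - s" using s_gt_1 by simp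
    show "s dvd z + s - (z - s)" by simp
    show "z + s + (bar z - z) \<in> B" using bz by (simp add: algebra_simps)
  qed (rule nz)
  have "bar y = z - s \<or> bar y = y + (bar z - z) \<or> bar b = z - s \<or> bar b = y + (bar z - z)"
  proof (rule unswitchableD[OF unsw y(2) b(1) z(2) y(3)])
    show "y + b = z - s + (y + (bar z - z))" using L by simp
    show "t dvd y - (y + (bar z - z))" using td by (simp add: dvd_diff_commute)
    show "y \<noteq> b" using y(1) sL L by auto
    show "z - s \<noteq> y + (bar z - z)"
    proof
      assume "z - s = y + (bar z - z)"
      then have "bar z - z = - (y - (z - s))" by simp
      then show False using y(1) sL by (metis dvd_minus_iff)
    qed
  qed (rule y(1))
  then show False
  proof (elim disjE)
    assume "bar y = z - s"
    then have "bar z - z = (y - (z - s)) * 1 + s * (-2)" by (simp add: bar_def)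
    then show False using dvd_combine[OF y(1) dvd_refl] sL by blast
  next
    assume "bar y = y + (bar z - z)"
    then have "y = z" by (simp add: bar_def)
    then show False using y(4) by simp
  next
    assume "bar b = z - s"
    then show False using b(2) s_gt_1 by (simp add: bar_def)
  next
    assume "bar b = y + (bar z - z)"
    then have "bar z - z = (y - (z - s)) * (-1) + s * 2" using b(2) by (simp add: bar_def)
    then show False using dvd_combine[OF y(1) dvd_refl] sL by blast
  qed
qed

text \<open>The alternatives: the step is the central \<open>s\<close>-hook, leaves the upper end of
  the central \<open>t\<close>-hook, or reaches its lower end. Any other step forces each
  compensating \<open>b\<close> to be the lower end of the central \<open>s\<close>-hook; then the
  mirror step lies on the same \<open>t\<close>-runner and asks for a second such
  \<open>b\<close>.\<close>

lemma descent:
  assumes z: "z \<in> B" "z - s \<notin> B"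
  shows "bar z = z - s \<or> bar z = z - t \<or> bar (z - s) = z - s + t"
proof (rule ccontr)
  assume neg: "\<not> ?thesis"
  have step: "bar z = b + s \<or> bar b = z - s \<or> bar b = b + s" if b: "t dvd b - (z - s)" "b \<in> B" "b + s \<notin> B" for b
  proof -
    have "bar z = z - s \<or> bar z = b + s \<or> bar b = z - s \<or> bar b = b + s"
    proof (rule unswitchableD[OF unsw z(1) b(2) z(2) b(3)])
      show "t dvd z - (b + s)" by (rule dvd_combine[OF b(1) dvd_refl, of _ "-1" 0]) simp
      show "z \<noteq> b" using b(1) not_t_dvd_s by auto
      show "z - s \<noteq> b + s"
      proof
        assume "z - s = b + s"
        then have "s = - (b - (z - s))" by simp
        then show False using b(1) not_t_dvd_s by (metis dvd_minus_iff)
      qed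
    qed simp_all
    then show ?thesis using neg by blast
  qed
  have not2: "\<not> bar z = b + s" if "t dvd b - (z - s)" "b \<in> B" for b
    using descent_aux[OF z _ that(2) _ that(1)] neg by blast
  \<comment> \<open>The mirror image of the situation excluded by \<open>not2\<close>, with
    \<open>b\<close> in the role of \<open>z\<close>.\<close>
  have not3: "\<not> bar b = z - s" if b: "t dvd b - (z - s)" "b \<in> B" "b + s \<notin> B" for b
  proof
    assume h: "bar b = z - s"
    then have hb: "b = bar (z - s)" by (metis bar_bar)
    have e: "b - s = bar z" unfolding hb by (simp add: bar_def)
    have e2: "bar (b + s) = z - s - s" using h by (simp add: bar_def)
    show False
    proof (rule descent_aux[of b "z - s - s"])
      show "b \<in> B" by (rule b(2))
      show "b - s \<notin> B" unfolding e by (rule notin_bar[OF z(1)])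
      show "bar b \<noteq> b - t" using neg hb by auto
      show "z - s - s \<in> B" using in_bar[OF b(3)] e2 by simp
      show "bar b = z - s - s + s" using h by simp
      show "t dvd z - s - s - (b - s)" by (rule dvd_combine[OF b(1) dvd_refl, of _ "-1" 0]) simp
    qed
  qed
  have zz: "z - s + s \<in> B" using z by simp
  obtain b where b: "t dvd b - (z - s)" "b \<in> B" "b + s \<notin> B"
    using same_charge_witness[OF maya_B maya_\<beta> charge_t \<beta>_s z(2) zz] by metis
  have bb: "bar b = b + s" using step[OF b] not2[OF b(1,2)] not3[OF b] by blast
  have tz: "t dvd bar z - (z - s)"
    by (rule dvd_combine[OF b(1) dvd_refl, of _ 2 0]) (use bb in \<open>simp add: bar_def\<close>)
  obtain b' where b': "t dvd b' - (z - s)" "b' \<in> B" "b' + s \<notin> B" "b' \<noteq> b"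
  proof (rule same_charge_witness2[OF maya_B maya_\<beta> charge_t \<beta>_s z(2) zz, of "bar z" b])
    show "bar z \<noteq> z - s" using neg by blast
    show "bar z \<notin> B" by (rule notin_bar[OF z(1)])
    show "bar z + s \<in> B" using in_bar[OF z(2)] by (simp add: bar_def algebra_simps)
  qed (rule tz)
  have "bar b' = b' + s" using step[OF b'(1-3)] not2[OF b'(1,2)] not3[OF b'(1-3)] by blast
  then have "b' = b" using bb by (simp add: bar_def)
  then show False using b'(4) by simp
qed

text \<open>Undoes the central hooks of lengths \<open>s\<close> and \<open>t\<close> where present:
  their lower ends are forced in, their upper ends forced out. The symmetric form lets one proof of
  closure serve both moduli.\<close>

definition toggled :: "int set" where
  "toggled = {b. bar b = b + s \<or> bar b = b + t \<or> b \<in> B \<and> bar b \<noteq> b - s \<and> bar b \<noteq> b - t}"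

lemma diagonal_s:
  assumes "a \<in> B" "s dvd a - bar a" "bar a < a"
  shows "a - bar a = s"
  by (rule rigid_pair_closed.diagonal_t[OF rigid_closed_swap assms])

lemma toggled_closed_s: "down_closed s toggled"
  unfolding down_closed_def
proof
  fix z assume z: "z \<in> toggled"
  show "z - s \<in> toggled"
  proof (rule ccontr)
    assume "z - s \<notin> toggled"
    then have w: "bar (z - s) \<noteq> z - s + s" "bar (z - s) \<noteq> z - s + t"
      "z - s \<notin> B \<or> bar (z - s) = z - s - s \<or> bar (z - s) = z - s - t"
      by (auto simp: toggled_def)
    consider "bar z = z + s" | "bar z = z + t" | "z \<in> B" "bar z \<noteq> z - s" "bar z \<noteq> z - t"
      using z by (auto simp: toggled_def)
    then show False
    proof cases
      case 1
      \<comment> \<open>A gap here would make its mirror image a bead on the self-dual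
        \<open>s\<close>-runner at distance \<open>3 * s\<close>, against
        \<open>diagonal_s\<close>.\<close>
      then have e: "bar (z - s) = z - s + 3 * s" by (simp add: bar_def)
      then have "z - s \<notin> B" using w(3) s_gt_1 t_gt_1 by auto
      then have "bar (z - s) \<in> B" by (rule in_bar)
      moreover have e': "bar (z - s) - bar (bar (z - s)) = 3 * s" unfolding bar_bar using e by linarith
      moreover have "s dvd bar (z - s) - bar (bar (z - s))" unfolding e' by simp
      moreover have "bar (bar (z - s)) < bar (z - s)" using e' s_gt_1 by linarith
      ultimately show False using diagonal_s[of "bar (z - s)"] s_gt_1 by linarith
    next
      case 2
      then have e: "bar (z - s) = z - s + (2 * s + t)" by (simp add: bar_def)
      then have nw: "z - s \<notin> B" using w(3) s_gt_1 t_gt_1 by auto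
      show False
      proof (cases "z \<in> B")
        case True
        then show False using descent[OF True nw] 2 e s_gt_1 t_gt_1 by auto
      next
        case False
        then have "bar z + s \<notin> B" using shift_up[OF 2] in_bar by blast
        moreover have "bar z + s = bar (z - s)" by (simp add: bar_def)
        ultimately show False using in_bar[OF nw] by simp
      qed
    next
      case 3
      consider "z - s \<notin> B" | "z - s \<in> B" "bar (z - s) = z - s - s" | "z - s \<in> B" "bar (z - s) = z - s - t"
        using w(3) by blast
      then show False
      proof cases
        case 1 then show False using descent[OF 3(1) 1] 3 w by blast
      next
        case 2
        then have "z - bar z = 3 * s" by (simp add: bar_def)
        then show False using diagonal_s[OF 3(1)] s_gt_1 by simp
      next
        case c: 3
        have "bar (z - s - t) = z - s" using c(2) by (metis bar_bar)
        then have "z - s + s \<notin> B" using shift_up[of "z - s - t"] c(1) by simp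
        then show False using 3(1) by simp
      qed
    qed
  qed
qed

lemma toggled_closed_t: "down_closed t toggled"
proof -
  interpret sw: rigid_pair_closed t s B \<beta> \<alpha> by (rule rigid_closed_swap)
  have "sw.toggled = toggled" unfolding toggled_def sw.toggled_def by blast
  then show ?thesis using sw.toggled_closed_s by simp
qed

end


section \<open>Toggling the middle hooks\<close>

definition set_harpoon :: "int \<Rightarrow> int \<Rightarrow> int set \<Rightarrow> int set \<Rightarrow> bool" where
  "set_harpoon p q A C \<longleftrightarrow> (\<exists>b \<in> C - A. [bar b - b = q] (mod (2 * p)) \<and> A = (C - {b}) \<union> {bar b})"

definition set_harpoons :: "int \<Rightarrow> int \<Rightarrow> int set \<Rightarrow> int set \<Rightarrow> int \<Rightarrow> int \<Rightarrow> bool" where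
  "set_harpoons s t A C b c \<longleftrightarrow> b \<noteq> c \<and> b \<in> C - A \<and> c \<in> C - A \<and> [bar b - b = t] (mod (2 * s)) \<and>
     [bar c - c = - s] (mod (2 * t)) \<and> A = (C - {b, c}) \<union> {bar b, bar c}"

definition semigroup2 :: "int \<Rightarrow> int \<Rightarrow> int \<Rightarrow> bool" where
  "semigroup2 s t x \<longleftrightarrow> (\<exists>i\<ge>0. \<exists>j\<ge>0. x = i * s + j * t)"

text \<open>The cone of the numerical semigroup generated by \<open>s\<close> and \<open>t\<close>,
  with apex at half the Frobenius number \<open>s * t - s - t\<close>, rounded down. It is the
  beta-set of the largest core, see \<open>kappa_partition\<close>.\<close>

definition kappa_set :: "int \<Rightarrow> int \<Rightarrow> int set" where
  "kappa_set s t = {b. semigroup2 s t ((s * t - s - t - 1) div 2 - b)}"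

lemma exchange_back: "x \<in> B \<Longrightarrow> y \<notin> B \<Longrightarrow> insert x (insert y (B - {x}) - {y}) = B"
  by auto

context coprime_pair
begin

text \<open>Origin of the modulus \<open>2 * s\<close>: the top bead \<open>b\<close> on the
  \<open>s\<close>-runner of \<open>c\<close> satisfies
  \<open>bar b - b - t = - (2 * (b - c))\<close>, and \<open>s\<close> divides
  \<open>b - c\<close>.\<close>

lemma harpoon_of_exchange:
  assumes C: "maya C" "self_dual C" "down_closed s C" and c: "bar c = c + t" "c \<in> C"
    and D: "maya D" "down_closed s D" "same_charge s D (insert (bar c) (C - {c}))"
  obtains b where "b \<in> C" "bar b \<notin> C" "s dvd b - c" "[bar b - b = t] (mod (2 * s))" "D = insert (bar b) (C - {b})" "b + s \<notin> C"
proof -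
  have "c - bar c = - t" using c(1) by simp
  then have nd: "\<not> s dvd c - bar c" using not_s_dvd_t by simp
  have "s > 0" using s_gt_1 by simp
  then obtain b where b: "b \<in> C" "s dvd b - c" "b + s \<notin> C" "bar b \<notin> C" "D = insert (bar b) (C - {b})"
    using self_dual_core_exchange[OF C _ c(2) nd D] by metis
  have "2 * s dvd 2 * (b - c)" using b(2) by (intro mult_dvd_mono) simp_all
  moreover have "bar b - b - t = - (2 * (b - c))" using c(1) by (simp add: bar_def)
  ultimately have "[bar b - b = t] (mod (2 * s))" unfolding cong_iff_dvd_diff by (metis dvd_minus_iff)
  then show thesis using that b by blast
qed

end

context rigid_pair_closed
begin

lemma s_pos: "s > 0" and t_pos: "t > 0"
  using s_gt_1 t_gt_1 by simp_all

lemma toggle_none: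
  assumes "\<forall>x\<in>B. bar x \<noteq> x - s" "\<forall>x\<in>B. bar x \<noteq> x - t"
  shows "toggled = B"
proof -
  have "b \<in> B" if "bar b = b + s \<or> bar b = b + t" for b
  proof (rule ccontr)
    assume "b \<notin> B"
    then have "bar b \<in> B" by (rule in_bar)
    then have "bar (bar b) \<noteq> bar b - s" "bar (bar b) \<noteq> bar b - t" using assms by blast+
    then show False using that unfolding bar_bar by linarith
  qed
  then show ?thesis using assms unfolding toggled_def by blast
qed

lemma toggle_t:
  assumes x: "x \<in> B" "bar x = x - t" and "\<forall>x\<in>B. bar x \<noteq> x - s"
  shows "toggled = insert (bar x) (B - {x})"
proof -
  have 1: "b \<in> B" if "bar b = b + s" for b
  proof (rule ccontr)
    assume "b \<notin> B"
    then have "bar b \<in> B" by (rule in_bar)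
    then have "bar (bar b) \<noteq> bar b - s" using assms(3) by blast
    then show False using that unfolding bar_bar by linarith
  qed
  have 2: "bar b = b + t \<longleftrightarrow> b = bar x" "bar b = b - t \<longleftrightarrow> b = x" for b
    using x(2) by (auto simp: bar_def)
  have 3: "x \<noteq> b" if "bar b = b + s" for b using that x(2) t_gt_1 s_gt_1 by auto
  show ?thesis unfolding toggled_def 2 using 1 3 assms(3) by blast
qed

lemma toggle_both:
  assumes x: "x \<in> B" "bar x = x - t" and y: "y \<in> B" "bar y = y - s"
  shows "toggled = insert (bar y) (insert (bar x) (B - {x}) - {y})" "x \<noteq> y" "bar x \<noteq> y"
proof -
  have 2: "bar b = b + t \<longleftrightarrow> b = bar x" "bar b = b - t \<longleftrightarrow> b = x" "bar b = b + s \<longleftrightarrow> b = bar y" "bar b = b - s \<longleftrightarrow> b = y" for b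
    using x(2) y(2) by (auto simp: bar_def)
  show "x \<noteq> y" using x y not_s_dvd_t by auto
  show "bar x \<noteq> y" using notin_bar[OF x(1)] y(1) by auto
  then show "toggled = insert (bar y) (insert (bar x) (B - {x}) - {y})"
    unfolding toggled_def 2 by auto
qed

lemma conclude_none:
  assumes "\<forall>x\<in>B. bar x \<noteq> x - s" "\<forall>x\<in>B. bar x \<noteq> x - t"
  shows "B = \<alpha>" "B = \<beta>"
proof -
  have "down_closed s B" "down_closed t B"
    using toggle_none[OF assms] toggled_closed_s toggled_closed_t by simp_all
  then show "B = \<alpha>" "B = \<beta>"
    using core_unique[OF maya_B maya_\<alpha> _ \<alpha>_s charge_s s_pos] core_unique[OF maya_B maya_\<beta> _ \<beta>_t charge_t t_pos] by auto
qed

text \<open>Undoing the central \<open>t\<close>-hook leaves \<open>\<beta>\<close>. Redoing it and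
  passing to the \<open>s\<close>-core replaces the exchange at the centre by one at a top bead,
  which is the harpoon relation.\<close>

lemma conclude_t:
  assumes x: "x \<in> B" "bar x = x - t" and nx: "\<forall>x\<in>B. bar x \<noteq> x - s"
  shows "odd t" "set_harpoon s t \<alpha> \<beta>" "energy B = energy \<beta> + t"
proof -
  show "odd t" using x(2) unfolding bar_def by presburger
  define \<gamma> where "\<gamma> = insert (bar x) (B - {x})"
  have nb: "bar x \<notin> B" using notin_bar x(1) .
  have "down_closed t \<gamma>" using toggle_t[OF x nx] toggled_closed_t \<gamma>_def by simp
  moreover have "maya \<gamma>" unfolding \<gamma>_def by (rule maya_exchange[OF maya_B])
  moreover have "same_charge t \<gamma> B" unfolding \<gamma>_def
    by (rule same_charge_exchange[OF maya_B x(1) nb]) (simp add: x(2))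
  ultimately have \<gamma>: "\<gamma> = \<beta>"
    using core_unique[OF _ maya_\<beta> _ \<beta>_t same_charge_trans[OF _ charge_t] t_pos] by blast
  have sdg: "self_dual \<gamma>" unfolding \<gamma>_def by (rule self_dual_exchange[OF sd_B x(1)])
  have "energy \<gamma> = energy B - x + bar x" unfolding \<gamma>_def by (rule energy_exchange[OF maya_B x(1) nb])
  then show "energy B = energy \<beta> + t" using x(2) \<gamma> by simp
  have Beq: "B = insert (bar (bar x)) (\<beta> - {bar x})"
    unfolding \<gamma>[symmetric] \<gamma>_def bar_bar using exchange_back[OF x(1) nb] by simp
  have "same_charge s \<alpha> (insert (bar (bar x)) (\<beta> - {bar x}))"
    using charge_s Beq same_charge_sym by simp
  moreover have "bar (bar x) = bar x + t" unfolding bar_bar using x(2) by linarith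
  moreover have "bar x \<in> \<beta>" unfolding \<gamma>[symmetric] \<gamma>_def by simp
  ultimately obtain b where b: "b \<in> \<beta>" "bar b \<notin> \<beta>" "[bar b - b = t] (mod (2 * s))" "\<alpha> = insert (bar b) (\<beta> - {b})"
    using harpoon_of_exchange[OF maya_\<beta> _ \<beta>_s, of "bar x" \<alpha>] maya_\<alpha> \<alpha>_s sdg \<gamma> by metis
  then show "set_harpoon s t \<alpha> \<beta>" unfolding set_harpoon_def by (intro bexI[of _ b]) auto
qed

text \<open>With both hooks undone an (s,t)-core \<open>\<gamma>\<close> remains. Redoing the
  \<open>t\<close>-hook and taking the \<open>s\<close>-core flips a bead \<open>b\<close> and gives
  \<open>\<alpha>\<close>; redoing the \<open>s\<close>-hook and taking the \<open>t\<close>-core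
  flips a bead \<open>c'\<close> and gives \<open>\<beta>\<close>. Thus \<open>\<gamma>\<close> is
  the star partition.\<close>

lemma conclude_both:
  assumes x: "x \<in> B" "bar x = x - t" and y: "y \<in> B" "bar y = y - s"
  obtains b c where "odd s" "odd t" "set_harpoons s t \<alpha> \<beta> b c"
    "energy B = energy ((\<beta> - {c}) \<union> {bar c}) + s + t"
proof -
  have od: "odd t" "odd s" using x(2) y(2) unfolding bar_def by presburger+
  define \<gamma>1 where "\<gamma>1 = insert (bar x) (B - {x})"
  define \<gamma> where "\<gamma> = insert (bar y) (\<gamma>1 - {y})"
  note tb = toggle_both[OF x y]
  have nb: "bar x \<notin> B" "bar y \<notin> B" using notin_bar x(1) y(1) by blast+
  have g1: "maya \<gamma>1" "self_dual \<gamma>1" "energy \<gamma>1 = energy B - t" "same_charge t \<gamma>1 B"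
    unfolding \<gamma>1_def using maya_exchange[OF maya_B] self_dual_exchange[OF sd_B x(1)]
      energy_exchange[OF maya_B x(1) nb(1)] same_charge_exchange[OF maya_B x(1) nb(1)] x(2) by auto
  have y1: "y \<in> \<gamma>1" "bar y \<notin> \<gamma>1" unfolding \<gamma>1_def using y(1) tb(2) nb by auto
  have g: "maya \<gamma>" "self_dual \<gamma>" "energy \<gamma> = energy B - t - s" "same_charge s \<gamma> \<gamma>1"
    unfolding \<gamma>_def using maya_exchange[OF g1(1)] self_dual_exchange[OF g1(2) y1(1)]
      energy_exchange[OF g1(1) y1] same_charge_exchange[OF g1(1) y1] y(2) g1(3) by auto
  have gc: "down_closed s \<gamma>" "down_closed t \<gamma>"
    using toggled_closed_s toggled_closed_t tb(1) by (simp_all add: \<gamma>_def \<gamma>1_def)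
  have memg: "z \<in> \<gamma> \<longleftrightarrow> z = bar x \<or> z = bar y \<or> z \<in> B \<and> z \<noteq> x \<and> z \<noteq> y" for z
    unfolding \<gamma>_def \<gamma>1_def using tb y(1) nb by auto
  have xg: "bar x \<in> \<gamma>" "x \<notin> \<gamma>" "bar y \<in> \<gamma>" "y \<notin> \<gamma>"
    using memg tb(2,3) nb x(1) y(1) bar_neq by auto
  have By: "B = insert x (insert y (\<gamma> - {bar y}) - {bar x})"
    using memg tb(2,3) nb x(1) y(1) by auto
  have Bx: "B = insert y (insert x (\<gamma> - {bar x}) - {bar y})"
    using memg tb(2,3) nb x(1) y(1) by auto
  have chs: "same_charge s B (insert x (\<gamma> - {bar x}))"
  proof -
    have "same_charge s (insert y (insert x (\<gamma> - {bar x}) - {bar y})) (insert x (\<gamma> - {bar x}))"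
      by (rule same_charge_exchange[OF maya_exchange[OF g(1)]]) (use xg tb y(2) in auto)
    then show ?thesis using Bx by simp
  qed
  have cht: "same_charge t B (insert y (\<gamma> - {bar y}))"
  proof -
    have "same_charge t (insert x (insert y (\<gamma> - {bar y}) - {bar x})) (insert y (\<gamma> - {bar y}))"
      by (rule same_charge_exchange[OF maya_exchange[OF g(1)]]) (use xg tb x(2) in auto)
    then show ?thesis using By by simp
  qed
  have "same_charge s \<alpha> (insert (bar (bar x)) (\<gamma> - {bar x}))"
    using chs charge_s same_charge_sym same_charge_trans unfolding bar_bar by blast
  moreover have "bar (bar x) = bar x + t" unfolding bar_bar using x(2) by linarith
  ultimately obtain b where b: "b \<in> \<gamma>" "bar b \<notin> \<gamma>" "s dvd b - bar x" "[bar b - b = t] (mod (2 * s))" "\<alpha> = insert (bar b) (\<gamma> - {b})" "b + s \<notin> \<gamma>"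
    using harpoon_of_exchange[OF g(1,2) gc(1) _ xg(1) maya_\<alpha> \<alpha>_s] by metis
  interpret sw: coprime_pair t s by (rule swap)
  have "same_charge t \<beta> (insert (bar (bar y)) (\<gamma> - {bar y}))"
    using cht charge_t same_charge_sym same_charge_trans unfolding bar_bar by blast
  moreover have "bar (bar y) = bar y + s" unfolding bar_bar using y(2) by linarith
  ultimately obtain c' where c': "c' \<in> \<gamma>" "bar c' \<notin> \<gamma>" "t dvd c' - bar y" "[bar c' - c' = s] (mod (2 * t))" "\<beta> = insert (bar c') (\<gamma> - {c'})" "c' + t \<notin> \<gamma>"
    using sw.harpoon_of_exchange[OF g(1,2) gc(2) _ xg(3) maya_\<beta> \<beta>_t] by metis
  have xy: "x = bar x + t" "y = bar y + s" using x(2) y(2) by simp_all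
  \<comment> \<open>If both flips used the same bead, then \<open>b\<close> and the fourth corner
    \<open>d\<close> against the gaps \<open>bar x\<close>, \<open>bar y\<close> would be a
    switchable rectangle in \<open>B\<close>.\<close>
  have bc: "b \<noteq> c'"
  proof
    assume eq: "b = c'"
    have tb': "t dvd b - bar y" using c'(3) eq by simp
    \<comment> \<open>\<open>b\<close> is the top bead of its runner in \<open>\<gamma>\<close> for
      both moduli.\<close>
    have ge: "bar x \<le> b" "bar y \<le> b"
    proof -
      show "bar x \<le> b"
      proof (rule ccontr)
        assume "\<not> bar x \<le> b"
        then have "bar x > b" by simp
        moreover have d: "s dvd bar x - (b + s)" by (rule dvd_combine[OF b(3) dvd_refl, of _ "-1" "-1"]) simp
        moreover have "bar x \<ge> b + s" using zdvd_imp_le[of s "bar x - b"] b(3) \<open>bar x > b\<close>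
          by (simp add: dvd_diff_commute)
        ultimately have "b + s \<in> \<gamma>" using down_closed_le[OF gc(1) xg(1) _ _ s_pos] by blast
        then show False using b(6) by simp
      qed
      show "bar y \<le> b"
      proof (rule ccontr)
        assume "\<not> bar y \<le> b"
        then have "bar y > b" by simp
        moreover have d: "t dvd bar y - (b + t)" by (rule dvd_combine[OF tb' dvd_refl, of _ "-1" "-1"]) simp
        moreover have "bar y \<ge> b + t" using zdvd_imp_le[of t "bar y - b"] tb' \<open>bar y > b\<close>
          by (simp add: dvd_diff_commute)
        ultimately have "b + t \<in> \<gamma>" using down_closed_le[OF gc(2) xg(3) _ _ t_pos] by blast
        then show False using c'(6) eq by simp
      qed
    qed
    have nex: "b \<noteq> bar x"
    proof
      assume "b = bar x"
      then have "s = (b - bar y) * 2 + t * 1" using x(2) y(2) by (simp add: bar_def)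
      then show False using dvd_combine[OF tb' dvd_refl] not_t_dvd_s by blast
    qed
    have ney: "b \<noteq> bar y"
    proof
      assume "b = bar y"
      then have "t = (b - bar x) * 2 + s * 1" using x(2) y(2) by (simp add: bar_def)
      then show False using dvd_combine[OF b(3) dvd_refl] not_s_dvd_t by blast
    qed
    define d where "d = bar x + bar y - b"
    have dlt: "d < bar x" "d < bar y" using ge nex ney by (auto simp: d_def)
    have "s dvd bar y - d" using b(3) by (simp add: d_def algebra_simps)
    then have dg: "d \<in> \<gamma>" using down_closed_le[OF gc(1) xg(3) _ _ s_pos] dlt(2) by simp
    have "bar b = bar x \<or> bar b = bar y \<or> bar d = bar x \<or> bar d = bar y"
    proof (rule unswitchableD[OF unsw _ _ nb])
      show "b \<in> B" using b(1) memg nex ney by blast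
      show "d \<in> B" using dg memg[of d] dlt by auto
    qed (use b(3) tb' tb(2) ge dlt in \<open>auto simp: d_def\<close>)
    then have "b = x \<or> b = y \<or> d = x \<or> d = y" by simp
    then show False using b(1) dg xg by blast
  qed
  \<comment> \<open>The relation is read from \<open>\<beta>\<close> to \<open>\<alpha>\<close>, so
    the bead flipped to obtain \<open>\<beta>\<close> enters as its mirror image; hence the sign in
    \<open>- s\<close>.\<close>
  define c where "c = bar c'"
  have \<beta>c: "(\<beta> - {c}) \<union> {bar c} = \<gamma>" unfolding c_def c'(5) using c'(1,2) by auto
  have "bar c - c = - (bar c' - c')" by (simp add: c_def)
  then have cc: "[bar c - c = - s] (mod (2 * t))" using c'(4)
    by (metis cong_minus_minus_iff)
  have "set_harpoons s t \<alpha> \<beta> b c"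
    unfolding set_harpoons_def
  proof (intro conjI)
    show "b \<noteq> c" using b(1) c'(2) c_def by auto
    show "b \<in> \<beta> - \<alpha>" using b(1) bc unfolding b(5) c'(5) by auto
    show "c \<in> \<beta> - \<alpha>" using c'(2) bc unfolding b(5) c'(5) c_def by auto
    show "\<alpha> = (\<beta> - {b, c}) \<union> {bar b, bar c}" unfolding b(5) c'(5) c_def using b(1,2) c'(1,2) bc by auto
  qed (use b(4) cc in auto)
  then show thesis using that od g(3) \<beta>c by simp
qed

end


section \<open>Numerical semigroups and the middle st-hook\<close>

context coprime_pair
begin

lemma crt:
  obtains p where "s dvd p - u" "t dvd p - v"
proof -
  obtain i j where ij: "i * s + j * t = 1"
    using bezout_int[of s t] coprime_st by (auto simp: coprime_iff_gcd_eq_1)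
  define p where "p = v * (i * s) + u * (j * t)"
  have "p - u = v * (i * s) + u * (j * t) - u * (i * s + j * t)" using ij by (simp add: p_def)
  then have 1: "p - u = s * (v * i - u * i)" by (simp add: algebra_simps)
  have "p - v = v * (i * s) + u * (j * t) - v * (i * s + j * t)" using ij by (simp add: p_def)
  then have 2: "p - v = t * (u * j - v * j)" by (simp add: algebra_simps)
  show thesis by (rule that[of p]) (simp_all only: 1 2 dvd_triv_left)
qed

lemma semigroup_representation:
  obtains i j where "x = i * s + j * t" "0 \<le> j" "j < s"
proof -
  obtain p where p: "s dvd p - x" "t dvd p - 0" by (rule crt)
  then obtain q where q: "p = t * q" by auto
  have "s dvd x - (q mod s) * t"
  proof -
    define k r where "k = q div s" and "r = q mod s"
    have "q = s * k + r" by (simp add: k_def r_def)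
    then have "x - r * t = (p - x) * (-1) + s * (k * t)" using q by (simp add: algebra_simps)
    then show ?thesis using dvd_combine[OF p(1) dvd_refl] unfolding r_def by blast
  qed
  then obtain i where "x - (q mod s) * t = s * i" by blast
  then show thesis using that[of i "q mod s"] s_gt_1 by (simp add: algebra_simps)
qed

text \<open>With \<open>j\<close> reduced modulo \<open>s\<close>, a representation with nonnegative
  coefficients has at least as large a \<open>t\<close>-coefficient, hence at most as large an
  \<open>s\<close>-coefficient.\<close>

lemma semigroup_iff:
  assumes "0 \<le> j" "j < s"
  shows "semigroup2 s t (i * s + j * t) \<longleftrightarrow> i \<ge> 0"
proof
  assume "semigroup2 s t (i * s + j * t)"
  then obtain i' j' where h: "i' \<ge> 0" "j' \<ge> 0" "i * s + j * t = i' * s + j' * t"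
    by (auto simp: semigroup2_def)
  then have e: "t * (j' - j) = s * (i - i')" by (simp add: algebra_simps)
  then have "s dvd j' - j" using s_dvd_t_mult by (metis dvd_triv_left)
  then obtain k where k: "j' - j = s * k" by blast
  have "k \<ge> 0"
  proof (rule ccontr)
    assume "\<not> k \<ge> 0"
    then have "s * k \<le> s * (-1)" using s_gt_1 by (intro mult_left_mono) auto
    then show False using k h(2) assms(2) by simp
  qed
  have "s * (i - i') = s * (t * k)" using e k by (simp add: algebra_simps)
  then have "i = i' + t * k" using s_gt_1 by simp
  moreover have "t * k \<ge> 0" using \<open>k \<ge> 0\<close> t_gt_1 by simp
  ultimately show "i \<ge> 0" using h(1) by simp
next
  assume "i \<ge> 0" then show "semigroup2 s t (i * s + j * t)" using assms(1) by (auto simp: semigroup2_def)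
qed

text \<open>Sylvester's symmetry: reflection turns the normal form \<open>(i, j)\<close> into
  \<open>(- 1 - i, s - 1 - j)\<close>.\<close>

lemma semigroup_dual: "semigroup2 s t x \<longleftrightarrow> \<not> semigroup2 s t (s * t - s - t - x)"
proof -
  obtain i j where ij: "x = i * s + j * t" "0 \<le> j" "j < s" by (rule semigroup_representation)
  have "s * t - s - t - x = (- 1 - i) * s + (s - 1 - j) * t" using ij(1) by (simp add: algebra_simps)
  moreover have "semigroup2 s t ((- 1 - i) * s + (s - 1 - j) * t) \<longleftrightarrow> - 1 - i \<ge> 0"
    by (rule semigroup_iff) (use ij in auto)
  moreover have "semigroup2 s t x \<longleftrightarrow> i \<ge> 0" unfolding ij(1) by (rule semigroup_iff) (use ij in auto)
  ultimately show ?thesis by auto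
qed

lemma semigroup_nonneg: "semigroup2 s t x \<Longrightarrow> x \<ge> 0"
  using s_gt_1 t_gt_1 by (auto simp: semigroup2_def)

lemma semigroup_zero: "semigroup2 s t 0"
  unfolding semigroup2_def by (intro exI[of _ 0] conjI) simp_all

lemma semigroup_add_s: "semigroup2 s t x \<Longrightarrow> semigroup2 s t (x + s)"
proof -
  assume "semigroup2 s t x"
  then obtain i j where "i \<ge> 0" "j \<ge> 0" "x = i * s + j * t" by (auto simp: semigroup2_def)
  then show ?thesis unfolding semigroup2_def by (intro exI[of _ "i + 1"] conjI exI[of _ j]) (auto simp: algebra_simps)
qed

lemma semigroup_swap: "semigroup2 t s x \<longleftrightarrow> semigroup2 s t x"
  unfolding semigroup2_def by (metis add.commute)

lemma semigroup_add_t: "semigroup2 s t x \<Longrightarrow> semigroup2 s t (x + t)"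
  using coprime_pair.semigroup_add_s[OF swap] semigroup_swap by blast

lemma semigroup_large: "x > s * t - s - t \<Longrightarrow> semigroup2 s t x"
  using semigroup_dual[of x] semigroup_nonneg[of "s * t - s - t - x"] by linarith

lemma frobenius_odd: "odd (s * t - s - t)"
proof -
  have "odd s \<or> odd t" using coprime_st by (meson coprime_common_divisor odd_one)
  then show ?thesis by auto
qed

lemma kappa_top: "2 * ((s * t - s - t - 1) div 2) + 1 = s * t - s - t"
  using frobenius_odd by presburger

lemma cone_maya: "maya {b. semigroup2 s t (h - b)}"
proof -
  define N where "N = \<bar>h\<bar> + \<bar>s * t - s - t\<bar>"
  have "\<forall>b < -N. semigroup2 s t (h - b)" using semigroup_large by (auto simp: N_def)
  moreover have "\<forall>b > N. \<not> semigroup2 s t (h - b)" using semigroup_nonneg by (force simp: N_def)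
  ultimately show ?thesis unfolding maya_iff_bounded by (intro exI[of _ N]) (simp add: N_def)
qed

lemma kappa_set_maya: "maya (kappa_set s t)"
  unfolding kappa_set_def by (rule cone_maya)

lemma kappa_set_self_dual: "self_dual (kappa_set s t)"
  unfolding self_dual_def
proof
  fix b
  let ?h = "(s * t - s - t - 1) div 2"
  have "s * t - s - t - (?h - b) = ?h - bar b" using kappa_top by (simp add: bar_def)
  then show "b \<in> kappa_set s t \<longleftrightarrow> bar b \<notin> kappa_set s t"
    unfolding kappa_set_def mem_Collect_eq using semigroup_dual[of "?h - b"] by metis
qed

lemma kappa_set_closed: "down_closed s (kappa_set s t)" "down_closed t (kappa_set s t)"
proof -
  have "h - (b - c) = h - b + c" for h b c :: int by simp
  then show "down_closed s (kappa_set s t)" "down_closed t (kappa_set s t)"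
    unfolding down_closed_def kappa_set_def mem_Collect_eq Ball_def
    using semigroup_add_s semigroup_add_t by metis+
qed

text \<open>Self-duality pins the apex: the mirror image of \<open>h\<close> is a gap, which bounds
  \<open>2 * h + 1\<close> above by the Frobenius number; that number is itself a semigroup gap,
  which bounds it below.\<close>

lemma cone_self_dual:
  assumes "self_dual {b. semigroup2 s t (h - b)}"
  shows "{b. semigroup2 s t (h - b)} = kappa_set s t"
proof -
  note sd = self_dualD[OF assms, unfolded mem_Collect_eq]
  have "\<not> semigroup2 s t (h - bar h)" using sd[of h] semigroup_zero by simp
  then have 1: "2 * h + 1 \<le> s * t - s - t" using semigroup_large[of "h - bar h"] by (force simp: bar_def)
  have "\<not> semigroup2 s t (s * t - s - t)" using semigroup_dual[of 0] semigroup_zero by simp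
  moreover have "h - (h - (s * t - s - t)) = s * t - s - t" by simp
  ultimately have "semigroup2 s t (h - bar (h - (s * t - s - t)))" using sd[of "h - (s * t - s - t)"] by metis
  then have "h - bar (h - (s * t - s - t)) \<ge> 0" by (rule semigroup_nonneg)
  then have "2 * h + 1 \<ge> s * t - s - t" by (simp add: bar_def)
  then have "h = (s * t - s - t - 1) div 2" using 1 by linarith
  then show ?thesis by (simp add: kappa_set_def)
qed

text \<open>Every element lies below the top of its \<open>t\<close>-runner, and by congruence that
  top lies a multiple of \<open>s\<close> below the maximum \<open>h\<close>; the other inclusion is
  down-closure.\<close>

lemma cone_if_tops_congruent:
  assumes C: "maya C" "down_closed s C" "down_closed t C"
    and tops: "\<And>x y. x \<in> C \<Longrightarrow> x + t \<notin> C \<Longrightarrow> y \<in> C \<Longrightarrow> y + t \<notin> C \<Longrightarrow> s dvd x - y"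
  shows "\<exists>h. C = {b. semigroup2 s t (h - b)}"
proof -
  obtain N where N: "N \<ge> 0" "\<And>b. b < -N \<Longrightarrow> b \<in> C" "\<And>b. b > N \<Longrightarrow> b \<notin> C"
    using maya_bound[OF C(1)] by metis
  define h where "h = Max (C \<inter> {-N-1..N})"
  have fin: "finite (C \<inter> {-N-1..N})" by simp
  have ne: "- N - 1 \<in> C \<inter> {-N-1..N}" using N by auto
  have hC: "h \<in> C" using Max_in[OF fin] ne unfolding h_def by blast
  have hmax: "b \<le> h" if "b \<in> C" for b
  proof (cases "b < -N - 1")
    case True then show ?thesis using Max_ge[OF fin ne] unfolding h_def by linarith
  next
    case False
    then have "b \<in> C \<inter> {-N-1..N}" using that N(3)[of b] by force
    then show ?thesis using Max_ge[OF fin] unfolding h_def by blast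
  qed
  have ht: "h + t \<notin> C" using hmax[of "h + t"] t_gt_1 by auto
  have t0: "t > 0" and s0: "s > 0" using t_gt_1 s_gt_1 by auto
  have "C = {b. semigroup2 s t (h - b)}"
  proof (intro set_eqI iffI)
    fix b assume "b \<in> C"
    obtain e where e: "t dvd e - b" "e \<in> C" "e + t \<notin> C" using maya_ascend[OF C(1) t0] by metis
    have "b \<le> e"
    proof (rule ccontr)
      assume "\<not> b \<le> e"
      then have "b \<ge> e + t" using zdvd_imp_le[of t "b - e"] e(1) by (simp add: dvd_diff_commute)
      moreover have "t dvd b - (e + t)" by (rule dvd_combine[OF e(1) dvd_refl, of _ "-1" "-1"]) simp
      ultimately have "e + t \<in> C" using down_closed_le[OF C(3) \<open>b \<in> C\<close> _ _ t0] by blast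
      then show False using e(3) by simp
    qed
    obtain j where j: "e - b = t * j" using e(1) by blast
    obtain i where i: "h - e = s * i" using tops[OF hC ht e(2,3)] by blast
    have "j \<ge> 0" using j \<open>b \<le> e\<close> t0 by (metis diff_ge_0_iff_ge zero_le_mult_iff not_less)
    moreover have "i \<ge> 0" using i hmax[OF e(2)] s0 by (metis diff_ge_0_iff_ge zero_le_mult_iff not_less)
    moreover have "h - b = i * s + j * t" using i j by (simp add: algebra_simps)
    ultimately show "b \<in> {b. semigroup2 s t (h - b)}" by (auto simp: semigroup2_def)
  next
    fix b assume "b \<in> {b. semigroup2 s t (h - b)}"
    then obtain i j where ij: "i \<ge> 0" "j \<ge> 0" "h - b = i * s + j * t" by (auto simp: semigroup2_def)
    have "h - s * i - t * j \<in> C" using down_closed_mult[OF C(3) down_closed_mult[OF C(2) hC ij(1)] ij(2)] .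
    moreover have "h - s * i - t * j = b" using ij(3) by (simp add: algebra_simps)
    ultimately show "b \<in> C" by simp
  qed
  then show ?thesis by blast
qed

end

section \<open>Undoing the central st-hook\<close>

context rigid_pair
begin

context
  fixes b0 :: int
  assumes b0: "b0 \<in> B" "bar b0 = b0 - s * t"
begin

definition "B0 = insert (bar b0) (B - {b0})"

lemma bar_b0_notin: "bar b0 \<notin> B"
  using notin_bar b0(1) by blast

lemma B0_maya: "maya B0" and B0_self_dual: "self_dual B0"
  unfolding B0_def using maya_exchange[OF maya_B] self_dual_exchange[OF sd_B b0(1)] by auto

lemma B0_energy: "energy B0 = energy B - s * t"
  unfolding B0_def using energy_exchange[OF maya_B b0(1) bar_b0_notin] b0(2) by simp

lemma B0_charge: "same_charge s B0 \<alpha>" "same_charge t B0 \<beta>"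
proof -
  have "same_charge s B0 B" "same_charge t B0 B"
    unfolding B0_def by (rule same_charge_exchange[OF maya_B b0(1) bar_b0_notin], simp add: b0(2))+
  then show "same_charge s B0 \<alpha>" "same_charge t B0 \<beta>"
    using charge_s charge_t same_charge_trans by blast+
qed

lemma gap_is_b0: "b \<in> B \<Longrightarrow> b - s * t * m \<notin> B \<Longrightarrow> m > 0 \<Longrightarrow> b = b0 \<and> m = 1"
proof -
  assume h: "b \<in> B" "b - s * t * m \<notin> B" "m > 0"
  then have "m = 1" "bar b = b - s * t * m"
    using gap_one[OF maya_B unsw h] gap_dual[OF maya_B unsw h] by auto
  then show "b = b0 \<and> m = 1" using b0(2) by (simp add: bar_def)
qed

text \<open>The delicate places are just below \<open>bar b0\<close> and just above
  \<open>b0\<close>; a violation there would be a gap of length \<open>s * t * 2\<close>, against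
  \<open>gap_is_b0\<close>.\<close>

lemma B0_closed_st: "down_closed (s * t) B0"
  unfolding down_closed_def
proof
  fix b assume b: "b \<in> B0"
  have e: "b0 - s * t * 2 = bar b0 - s * t" using b0(2) by simp
  show "b - s * t \<in> B0"
  proof (cases "b = bar b0")
    case True
    have "b0 - s * t * 2 \<in> B" using gap_is_b0[OF b0(1), of 2] by auto
    then show ?thesis unfolding B0_def True e[symmetric] using st_pos by auto
  next
    case False
    then have bB: "b \<in> B" "b \<noteq> b0" using b by (auto simp: B0_def)
    then have 1: "b - s * t \<in> B" using gap_is_b0[OF bB(1), of 1] by auto
    show ?thesis
    proof (cases "b - s * t = b0")
      case True
      have "b - s * t * 2 = bar b0" using True b0(2) by simp
      then have "b - s * t * 2 \<notin> B" using bar_b0_notin by simp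
      then show ?thesis using gap_is_b0[OF bB(1), of 2] by auto
    next
      case False then show ?thesis using 1 by (simp add: B0_def)
    qed
  qed
qed

text \<open>As \<open>B0\<close> is down-closed for \<open>s * t\<close>, its beads on each such
  runner form a ray; this is its end.\<close>

definition top_of :: "int \<Rightarrow> int" where
  "top_of r = (SOME e. s * t dvd e - r \<and> (\<forall>x. s * t dvd x - r \<longrightarrow> (x \<in> B0 \<longleftrightarrow> x \<le> e)))"

lemma top_of: "s * t dvd top_of r - r" "s * t dvd x - r \<Longrightarrow> x \<in> B0 \<longleftrightarrow> x \<le> top_of r"
proof -
  obtain e where e: "s * t dvd e - r" "e \<in> B0" "e + s * t \<notin> B0"
    using maya_ascend[OF B0_maya st_pos] by metis
  have "x \<in> B0 \<longleftrightarrow> x \<le> e" if x: "s * t dvd x - r" for x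
  proof
    assume "x \<in> B0"
    show "x \<le> e"
    proof (rule ccontr)
      assume "\<not> x \<le> e"
      moreover have d: "s * t dvd x - e" by (rule dvd_combine[OF x e(1), of _ 1 "-1"]) simp
      ultimately have "x \<ge> e + s * t" using zdvd_imp_le[of "s * t" "x - e"] by simp
      moreover have "s * t dvd x - (e + s * t)" by (rule dvd_combine[OF d dvd_refl, of _ 1 "-1"]) simp
      ultimately show False using down_closed_le[OF B0_closed_st \<open>x \<in> B0\<close> _ _ st_pos] e(3) by blast
    qed
  next
    assume "x \<le> e"
    moreover have "s * t dvd e - x" by (rule dvd_combine[OF x e(1), of _ "-1" 1]) simp
    ultimately show "x \<in> B0" using down_closed_le[OF B0_closed_st e(2) _ _ st_pos] by blast
  qed
  then have "\<exists>e. s * t dvd e - r \<and> (\<forall>x. s * t dvd x - r \<longrightarrow> (x \<in> B0 \<longleftrightarrow> x \<le> e))" using e(1) by blast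
  from someI_ex[OF this, folded top_of_def]
  show "s * t dvd top_of r - r" "s * t dvd x - r \<Longrightarrow> x \<in> B0 \<longleftrightarrow> x \<le> top_of r" by auto
qed

lemma top_of_eqI:
  assumes "s * t dvd e - r" "e \<in> B0" "e + s * t \<notin> B0"
  shows "top_of r = e"
proof -
  have "s * t dvd (e + s * t) - r" by (rule dvd_combine[OF assms(1) dvd_refl, of _ 1 1]) simp
  then have 1: "e \<le> top_of r" "\<not> e + s * t \<le> top_of r" using top_of(2) assms by blast+
  have "s * t dvd top_of r - e" by (rule dvd_combine[OF assms(1) top_of(1)[of r], of _ "-1" 1]) simp
  then show ?thesis using 1 zdvd_imp_le[of "s * t" "top_of r - e"] by fastforce
qed

lemma top_of_mem: "top_of r \<in> B0" "top_of r + s * t \<notin> B0"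
proof -
  show "top_of r \<in> B0" using top_of(2)[OF top_of(1)] by simp
  have "s * t dvd (top_of r + s * t) - r" by (rule dvd_combine[OF top_of(1)[of r] dvd_refl, of _ 1 1]) simp
  then show "top_of r + s * t \<notin> B0" using top_of(2) st_pos by fastforce
qed

lemma top_of_cong: "s * t dvd r - r' \<Longrightarrow> top_of r = top_of r'"
proof (rule top_of_eqI)
  assume h: "s * t dvd r - r'"
  show "s * t dvd top_of r' - r" by (rule dvd_combine[OF h top_of(1)[of r'], of _ "-1" 1]) simp
qed (rule top_of_mem)+

lemma top_of_b0: "s dvd r - b0 \<Longrightarrow> t dvd r - b0 \<Longrightarrow> top_of r = bar b0"
proof -
  assume "s dvd r - b0" "t dvd r - b0"
  then have d: "s * t dvd r - b0" by (rule st_dvd)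
  show ?thesis
  proof (rule top_of_eqI)
    show "s * t dvd bar b0 - r" by (rule dvd_combine[OF d dvd_refl, of _ "-1" "-1"]) (simp add: b0(2))
    show "bar b0 \<in> B0" by (simp add: B0_def)
    show "bar b0 + s * t \<notin> B0" using b0(2) bar_b0_notin st_pos by (auto simp: B0_def)
  qed
qed

lemma B0_iff: "\<not> (s dvd x - b0) \<or> \<not> (t dvd x - b0) \<Longrightarrow> x \<in> B0 \<longleftrightarrow> x \<in> B"
  by (auto simp: B0_def b0(2))

text \<open>
  With the central \<open>st\<close>-hook present, every rectangle through its ends is unobstructed. This makes the
  tops of the \<open>st\<close>-runners additive in rows and columns, so all \<open>t\<close>-runners are translates of each other.
\<close>

lemma top_of_additive_base:
  assumes p: "s dvd p - x" "t dvd p - b0" and q: "s dvd q - b0" "t dvd q - x"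
  shows "top_of x + bar b0 = top_of p + top_of q"
proof -
  consider "s dvd x - b0" | "t dvd x - b0" | "\<not> s dvd x - b0" "\<not> t dvd x - b0" by blast
  then show ?thesis
  proof cases
    case 1
    have "s dvd p - b0" by (rule dvd_combine[OF p(1) 1, of _ 1 1]) simp
    then have "top_of p = bar b0" using p(2) top_of_b0 by blast
    moreover have "s dvd q - x" by (rule dvd_combine[OF q(1) 1, of _ 1 "-1"]) simp
    then have "top_of q = top_of x" using q(2) st_dvd top_of_cong by blast
    ultimately show ?thesis by simp
  next
    case 2
    have "t dvd q - b0" by (rule dvd_combine[OF q(2) 2, of _ 1 1]) simp
    then have "top_of q = bar b0" using q(1) top_of_b0 by blast
    moreover have "t dvd p - x" by (rule dvd_combine[OF p(2) 2, of _ 1 "-1"]) simp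
    then have "top_of p = top_of x" using p(1) st_dvd top_of_cong by blast
    ultimately show ?thesis by simp
  next
    case 3
    define u v where "u = top_of p" and "v = top_of q"
    have ust: "s dvd u - p" "t dvd u - p" "s dvd v - q" "t dvd v - q"
      using top_of(1) dvd_mult_left dvd_mult_right unfolding u_def v_def by blast+
    have u: "s dvd u - x" "t dvd u - b0"
      using dvd_add[OF ust(1) p(1)] dvd_add[OF ust(2) p(2)] by simp_all
    have v: "s dvd v - b0" "t dvd v - x"
      using dvd_add[OF ust(3) q(1)] dvd_add[OF ust(4) q(2)] by simp_all
    have nu: "\<not> s dvd u - b0" using u(1) 3(1) by (metis dvd_diff_right_iff diff_diff_eq2 diff_add_cancel dvd_add_right_iff add_diff_eq)
    have nv: "\<not> t dvd v - b0" using v(2) 3(2) by (metis dvd_diff_right_iff diff_diff_eq2 diff_add_cancel dvd_add_right_iff add_diff_eq)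
    have uB: "u \<in> B" "u + s * t \<notin> B"
    proof -
      show "u \<in> B" using top_of_mem(1)[of p] B0_iff[of u] nu by (simp add: u_def)
      have "\<not> s dvd (u + s * t) - b0"
        using nu by (metis add_diff_eq diff_add_eq dvd_add_left_iff dvd_triv_left)
      then show "u + s * t \<notin> B" using top_of_mem(2)[of p] B0_iff[of "u + s * t"] by (simp add: u_def)
    qed
    have vB: "v \<in> B" "v + s * t \<notin> B"
    proof -
      show "v \<in> B" using top_of_mem(1)[of q] B0_iff[of v] nv by (simp add: v_def)
      have "\<not> t dvd (v + s * t) - b0"
        using nv by (metis add_diff_eq diff_add_eq dvd_add_left_iff dvd_triv_right)
      then show "v + s * t \<notin> B" using top_of_mem(2)[of q] B0_iff[of "v + s * t"] by (simp add: v_def)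
    qed
    \<comment> \<open>The top that additivity predicts for the runner of \<open>x\<close>.\<close>
    define y where "y = u + v - bar b0"
    have sbb: "s dvd b0 - bar b0" "t dvd b0 - bar b0" by (simp_all add: b0(2))
    have ys: "s dvd y - x" by (rule dvd_combine[OF dvd_add[OF u(1) v(1)] sbb(1), of _ 1 1]) (simp add: y_def)
    have yt: "t dvd y - x" by (rule dvd_combine[OF dvd_add[OF u(2) v(2)] sbb(2), of _ 1 1]) (simp add: y_def)
    have ny: "\<not> s dvd y - b0" "\<not> t dvd y - b0"
    proof -
      show "\<not> s dvd y - b0"
      proof
        assume "s dvd y - b0"
        then have "s dvd x - b0" by (rule dvd_combine[OF _ ys, of _ _ 1 "-1"]) simp
        then show False using 3 by simp
      qed
      show "\<not> t dvd y - b0"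
      proof
        assume "t dvd y - b0"
        then have "t dvd x - b0" by (rule dvd_combine[OF _ yt, of _ _ 1 "-1"]) simp
        then show False using 3 by simp
      qed
    qed
    \<comment> \<open>Otherwise the beads \<open>u\<close>, \<open>v\<close> and the gaps
      \<open>y\<close>, \<open>bar b0\<close> form an unobstructed rectangle.\<close>
    have yB: "y \<in> B"
    proof (rule ccontr)
      assume nyB: "y \<notin> B"
      have "bar u = y \<or> bar u = bar b0 \<or> bar v = y \<or> bar v = bar b0"
      proof (rule unswitchableD[OF unsw uB(1) vB(1) nyB bar_b0_notin])
        show "u + v = y + bar b0" by (simp add: y_def)
        show "s dvd u - y" by (rule dvd_combine[OF u(1) ys, of _ 1 "-1"]) simp
        show "t dvd u - bar b0" by (rule dvd_combine[OF u(2) sbb(2), of _ 1 1]) simp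
        show "u \<noteq> v" using nu v(1) by auto
        show "y \<noteq> bar b0" using ny(1) sbb(1) by (auto simp: dvd_diff_commute)
      qed
      then show False
      proof (elim disjE)
        assume "bar u = y"
        then have "y - b0 = (u - b0) * (-1) + (b0 - bar b0) * (-1)" by (simp add: bar_def)
        then show False using ny(2) dvd_combine[OF u(2) sbb(2)] by blast
      next
        assume "bar u = bar b0" then show False using nu by simp
      next
        assume "bar v = y"
        then have "y - b0 = (v - b0) * (-1) + (b0 - bar b0) * (-1)" by (simp add: bar_def)
        then show False using ny(1) dvd_combine[OF v(1) sbb(1)] by blast
      next
        assume "bar v = bar b0" then show False using nv by simp
      qed
    qed
    \<comment> \<open>Otherwise the beads \<open>b0\<close>, \<open>y + s * t\<close> and the gaps
      \<open>u + s * t\<close>, \<open>v + s * t\<close> do so, because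
      \<open>b0 = bar b0 + s * t\<close>.\<close>
    have ystB: "y + s * t \<notin> B"
    proof
      assume h: "y + s * t \<in> B"
      have "bar b0 = v + s * t \<or> bar b0 = u + s * t \<or> bar (y + s * t) = v + s * t \<or> bar (y + s * t) = u + s * t"
      proof (rule unswitchableD[OF unsw b0(1) h vB(2) uB(2)])
        show "b0 + (y + s * t) = v + s * t + (u + s * t)" using b0(2) by (simp add: y_def)
        show "s dvd b0 - (v + s * t)" by (rule dvd_combine[OF v(1) dvd_triv_left, of _ "-1" "-1" t]) simp
        show "t dvd b0 - (u + s * t)" by (rule dvd_combine[OF u(2) dvd_triv_right, of _ "-1" "-1" s]) simp
        show "b0 \<noteq> y + s * t" using ny(1) by auto
        show "v + s * t \<noteq> u + s * t" using nu v(1) by auto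
      qed
      then show False
      proof (elim disjE)
        assume "bar b0 = v + s * t"
        then have "v - b0 = t * (- s * 2)" using b0(2) by simp
        then show False using nv by simp
      next
        assume "bar b0 = u + s * t"
        then have "u - b0 = s * (- t * 2)" using b0(2) by simp
        then show False using nu by simp
      next
        assume "bar (y + s * t) = v + s * t"
        then have "y - b0 = - (v - b0) - 3 * (s * t)" using b0(2) unfolding bar_def by linarith
        then have "y - b0 = (v - b0) * (-1) + s * (- t * 3)" by (simp add: algebra_simps)
        then show False using ny(1) dvd_combine[OF v(1) dvd_refl] by blast
      next
        assume "bar (y + s * t) = u + s * t"
        then have "y - b0 = - (u - b0) - 3 * (s * t)" using b0(2) unfolding bar_def by linarith
        then have "y - b0 = (u - b0) * (-1) + t * (- s * 3)" by (simp add: algebra_simps)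
        then show False using ny(2) dvd_combine[OF u(2) dvd_refl] by blast
      qed
    qed
    have "top_of x = y"
    proof (rule top_of_eqI)
      show "s * t dvd y - x" using ys yt by (rule st_dvd)
      show "y \<in> B0" using yB B0_iff ny by blast
      have "\<not> s dvd (y + s * t) - b0"
        using ny(1) by (metis add_diff_eq diff_add_eq dvd_add_left_iff dvd_triv_left)
      then show "y + s * t \<notin> B0" using ystB B0_iff by blast
    qed
    then show ?thesis by (simp add: y_def u_def v_def)
  qed
qed

text \<open>Relative to \<open>b0\<close> each top splits into a part depending on the class modulo
  \<open>s\<close> and one depending on the class modulo \<open>t\<close>; both sides combine the
  same four parts.\<close>

lemma top_of_additive:
  assumes "s dvd a - p" "s dvd d - q" "t dvd a - q" "t dvd d - p"
  shows "top_of a + top_of d = top_of p + top_of q"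
proof -
  obtain ca where ca: "s dvd ca - a" "t dvd ca - b0" by (rule crt)
  obtain cd where cd: "s dvd cd - d" "t dvd cd - b0" by (rule crt)
  obtain ra where ra: "s dvd ra - b0" "t dvd ra - a" by (rule crt)
  obtain rd where rd: "s dvd rd - b0" "t dvd rd - d" by (rule crt)
  have "top_of a + bar b0 = top_of ca + top_of ra" by (rule top_of_additive_base[OF ca ra])
  moreover have "top_of d + bar b0 = top_of cd + top_of rd" by (rule top_of_additive_base[OF cd rd])
  moreover have "top_of p + bar b0 = top_of ca + top_of rd"
    by (rule top_of_additive_base[OF _ ca(2) rd(1)])
      (use dvd_add[OF ca(1) assms(1)] dvd_add[OF rd(2) assms(4)] in simp_all)
  moreover have "top_of q + bar b0 = top_of cd + top_of ra"
    by (rule top_of_additive_base[OF _ cd(2) ra(1)])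
      (use dvd_add[OF cd(1) assms(2)] dvd_add[OF ra(2) assms(3)] in simp_all)
  ultimately show ?thesis by linarith
qed

text \<open>Beads are at most the tops of their runners and gaps exceed them, so the equation of
  sums would contradict additivity.\<close>

lemma B0_no_rectangle:
  assumes "a \<in> B0" "d \<in> B0" "p \<notin> B0" "a + d = p + q" "s dvd a - p" "t dvd a - q"
  shows "q \<in> B0"
proof (rule ccontr)
  assume nq: "q \<notin> B0"
  have e: "d - q = - (a - p)" "d - p = - (a - q)" using assms(4) by simp_all
  have "s dvd d - q" "t dvd d - p" unfolding e using assms(5,6) by (simp_all only: dvd_minus_iff)
  then have "top_of a + top_of d = top_of p + top_of q" using top_of_additive assms(5,6) by blast
  moreover have "a \<le> top_of a" "d \<le> top_of d" "p > top_of p" "q > top_of q"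
    using top_of(2) assms(1-3) nq by (metis cancel_comm_monoid_add_class.diff_cancel dvd_0_right not_less)+
  ultimately show False using assms(4) by linarith
qed

lemma B0_closed_s: "down_closed s B0"
  unfolding down_closed_def
proof
  fix z assume z: "z \<in> B0"
  show "z - s \<in> B0"
  proof (rule ccontr)
    assume n: "z - s \<notin> B0"
    have zz: "z - s + s \<in> B0" using z by simp
    obtain b where b: "t dvd b - (z - s)" "b \<in> B0" "b + s \<notin> B0"
      using same_charge_witness[OF B0_maya maya_\<beta> B0_charge(2) \<beta>_s n zz] by metis
    have "t dvd z - (b + s)" by (rule dvd_combine[OF b(1) dvd_refl, of _ "-1" 0]) simp
    then show False using B0_no_rectangle[OF z b(2) n, of "b + s"] b(3) by simp
  qed
qed

lemma B0_closed_t: "down_closed t B0"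
  unfolding down_closed_def
proof
  fix z assume z: "z \<in> B0"
  show "z - t \<in> B0"
  proof (rule ccontr)
    assume n: "z - t \<notin> B0"
    have zz: "z - t + t \<in> B0" using z by simp
    obtain b where b: "s dvd b - (z - t)" "b \<in> B0" "b + t \<notin> B0"
      using same_charge_witness[OF B0_maya maya_\<alpha> B0_charge(1) \<alpha>_t n zz] by metis
    have "s dvd z - (b + t)" by (rule dvd_combine[OF b(1) dvd_refl, of _ "-1" 0]) simp
    then show False using B0_no_rectangle[OF z b(2) b(3), of "z - t"] n by simp
  qed
qed

lemma B0_kappa: "B0 = kappa_set s t"
proof -
  have "s dvd x - y" if h: "x \<in> B0" "x + t \<notin> B0" "y \<in> B0" "y + t \<notin> B0" for x y
  proof -
    have t0: "t > 0" using t_gt_1 by simp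
    have mx: "w \<le> z" if "z + t \<notin> B0" "w \<in> B0" "t dvd w - z" for w z
    proof (rule ccontr)
      assume "\<not> w \<le> z"
      then have "w \<ge> z + t" using zdvd_imp_le[of t "w - z"] that(3) by simp
      moreover have "t dvd w - (z + t)" by (rule dvd_combine[OF that(3) dvd_refl, of _ 1 "-1"]) simp
      ultimately show False using down_closed_le[OF B0_closed_t that(2) _ _ t0] that(1) by blast
    qed
    have tp: "top_of z = z" if "z \<in> B0" "z + t \<notin> B0" for z
    proof (rule top_of_eqI)
      show "z + s * t \<notin> B0" using mx[OF that(2), of "z + s * t"] st_pos by auto
    qed (use that in auto)
    obtain p where p: "s dvd p - x" "t dvd p - y" by (rule crt)
    obtain q where q: "s dvd q - y" "t dvd q - x" by (rule crt)
    have "top_of x + top_of y = top_of p + top_of q"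
      by (rule top_of_additive) (use p q in \<open>simp_all add: dvd_diff_commute\<close>)
    moreover have "t dvd top_of p - y" "t dvd top_of q - x" "s dvd top_of p - x"
      using dvd_add[OF dvd_mult_right[OF top_of(1)[of p]] p(2)] dvd_add[OF dvd_mult_right[OF top_of(1)[of q]] q(2)]
        dvd_add[OF dvd_mult_left[OF top_of(1)[of p]] p(1)] by simp_all
    \<comment> \<open>As the sums agree, both inequalities are equalities; so \<open>y\<close> is
      the top for \<open>p\<close>, which was chosen congruent to \<open>x\<close> modulo
      \<open>s\<close>.\<close>
    moreover have "top_of p \<le> y" "top_of q \<le> x"
      using mx[OF h(4) top_of_mem(1)] mx[OF h(2) top_of_mem(1)] calculation by blast+
    ultimately have "top_of p = y" using tp h by simp
    then show "s dvd x - y" using \<open>s dvd top_of p - x\<close> by (simp add: dvd_diff_commute)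
  qed
  then obtain h where "B0 = {b. semigroup2 s t (h - b)}"
    using cone_if_tops_congruent[OF B0_maya B0_closed_s B0_closed_t] by metis
  then show ?thesis using cone_self_dual B0_self_dual by simp
qed

lemma middle_conclusion:
  "odd s" "odd t" "\<alpha> = kappa_set s t" "\<beta> = kappa_set s t" "energy B = energy (kappa_set s t) + s * t"
proof -
  have "s * t = 2 * b0 + 1" using b0(2) by (simp add: bar_def)
  then have "odd (s * t)" by simp
  then show "odd s" "odd t" by auto
  show "\<alpha> = kappa_set s t"
    using core_unique[OF B0_maya maya_\<alpha> B0_closed_s \<alpha>_s B0_charge(1)] s_gt_1 B0_kappa by simp
  show "\<beta> = kappa_set s t"
    using core_unique[OF B0_maya maya_\<beta> B0_closed_t \<beta>_t B0_charge(2)] t_gt_1 B0_kappa by simp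
  show "energy B = energy (kappa_set s t) + s * t"
    using B0_energy B0_kappa by simp
qed

end

end


section \<open>Classification when both cores are (s,t)-cores\<close>

definition sym_core :: "int \<Rightarrow> int \<Rightarrow> int set \<Rightarrow> bool" where
  "sym_core s t C \<longleftrightarrow> maya C \<and> self_dual C \<and> down_closed s C \<and> down_closed t C"

lemma self_dual_core_mem:
  assumes "self_dual C" "down_closed m C" "bar c = c + m"
  shows "c \<in> C" "bar c \<notin> C"
proof -
  show "c \<in> C"
  proof (rule ccontr)
    assume n: "c \<notin> C"
    then have "bar c \<in> C" using self_dualD[OF assms(1)] by blast
    then have "bar c - m \<in> C" using assms(2) by (auto simp: down_closed_def)
    then show False using assms(3) n by simp
  qed
  then show "bar c \<notin> C" using self_dualD[OF assms(1)] by blast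
qed

lemma half_point:
  assumes "odd m"
  obtains c where "bar c = c + m"
proof -
  obtain k where "m = 2 * k + 1" using assms by (rule oddE)
  then have "bar (- k - 1) = (- k - 1) + m" by (simp add: bar_def)
  then show thesis by (rule that)
qed

lemma diagonal_multiple:
  assumes "m dvd a - bar a" "bar a < a" "m > 0"
  obtains i where "a - bar a = m * (2 * i + 1)" "i \<ge> 0"
proof -
  obtain j where j: "a - bar a = m * j" using assms(1) by blast
  then have "m * j = 2 * a + 1" by (simp add: bar_def)
  then have "odd (m * j)" by simp
  then have "odd j" by simp
  then obtain i where i: "j = 2 * i + 1" by (rule oddE)
  have "m * j > 0" using assms(2) j by simp
  then have "j > 0" using assms(3) by (metis zero_less_mult_pos)
  then show thesis using that[of i] i j by simp
qed

section \<open>Uniqueness of the solution in each case\<close>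

context coprime_pair
begin

text \<open>Decodes the harpoon congruence: \<open>b\<close> lies on the \<open>s\<close>-runner of
  the lower end \<open>c\<close> of the central \<open>t\<close>-hook.\<close>

lemma half_point_dvd:
  assumes "bar c = c + t" "[bar b - b = t] (mod (2 * s))"
  shows "s dvd c - b"
proof -
  have "2 * s dvd bar b - b - t" using assms(2) by (simp add: cong_iff_dvd_diff)
  moreover have "bar b - b - t = 2 * (c - b)" using assms(1) by (simp add: bar_def)
  ultimately have "2 * s dvd 2 * (c - b)" by metis
  then show ?thesis by (rule zdvd_mult_cancel) simp
qed

text \<open>Only one \<open>t\<close> of energy is available above the \<open>t\<close>-core, so
  \<open>weight_one\<close> leaves the central hook as the only choice; the harpoon relation gives
  it the right \<open>s\<close>-core.\<close>

lemma harpoon_unique_solution: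
  assumes \<alpha>: "sym_core s t \<alpha>" and \<beta>: "sym_core s t \<beta>"
    and h: "odd t" "set_harpoon s t \<alpha> \<beta>" "n = energy \<beta> + t"
  shows "\<exists>!B. solution s t \<alpha> \<beta> n B"
proof -
  have b': "maya \<beta>" "self_dual \<beta>" "down_closed t \<beta>" using \<beta> by (auto simp: sym_core_def)
  obtain b where b: "b \<in> \<beta>" "b \<notin> \<alpha>" "[bar b - b = t] (mod (2 * s))" "\<alpha> = (\<beta> - {b}) \<union> {bar b}"
    using h(2) by (auto simp: set_harpoon_def)
  obtain c where c: "bar c = c + t" using half_point[OF h(1)] .
  note cm = self_dual_core_mem[OF b'(2,3) c]
  have nb: "bar b \<notin> \<beta>" using b(1) self_dualD[OF b'(2)] by blast
  have sd: "s dvd c - b" by (rule half_point_dvd[OF c b(3)])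
  define B0 where "B0 = insert (bar c) (\<beta> - {c})"
  have m0: "maya B0" "self_dual B0" unfolding B0_def
    using maya_exchange[OF b'(1)] self_dual_exchange[OF b'(2) cm(1)] by auto
  have "same_charge t B0 \<beta>" unfolding B0_def
    by (rule same_charge_exchange[OF b'(1) cm]) (simp add: c)
  moreover have "same_charge s B0 (insert (bar b) (\<beta> - {b}))" unfolding B0_def
    by (rule same_charge_exchange2[OF b'(1) cm b'(1) b(1) nb]) (simp_all add: sd bar_dvd_diff)
  then have "same_charge s B0 \<alpha>" using b(4) by simp
  moreover have "energy B0 = n" unfolding B0_def energy_exchange[OF b'(1) cm] using c h(3) by simp
  ultimately have "solution s t \<alpha> \<beta> n B0" using m0 by (simp add: solution_def)
  moreover have "B = B0" if "solution s t \<alpha> \<beta> n B" for B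
  proof -
    have B: "maya B" "self_dual B" "same_charge t B \<beta>" "energy B = energy \<beta> + t"
      using that h(3) by (auto simp: solution_def)
    obtain c' where c': "bar c' = c' + t" "B = insert (bar c') (\<beta> - {c'})"
      using weight_one[OF B(1,2) b' B(3) _ B(4)] t_gt_1 by (metis less_trans zero_less_one)
    have "c' = c" using c c'(1) by (simp add: bar_def)
    then show ?thesis using c'(2) B0_def by simp
  qed
  ultimately show ?thesis by blast
qed

text \<open>Down-closure in both directions. Through \<open>semigroup_large\<close> this bounds the
  distance from a bead down to a gap by the Frobenius number.\<close>

lemma not_semigroup_exchange:
  assumes "down_closed s \<alpha>" "down_closed t \<alpha>" "x \<in> \<alpha>" "y \<notin> \<alpha>"
  shows "\<not> semigroup2 s t (x - y)"
proof
  assume "semigroup2 s t (x - y)"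
  then obtain i j where ij: "i \<ge> 0" "j \<ge> 0" "x - y = i * s + j * t" by (auto simp: semigroup2_def)
  have "x - s * i - t * j \<in> \<alpha>" using down_closed_mult[OF assms(2) down_closed_mult[OF assms(1,3) ij(1)] ij(2)] .
  moreover have "x - s * i - t * j = y" using ij(3) by (simp add: algebra_simps)
  ultimately show False using assms(4) by simp
qed

text \<open>The congruences give \<open>N = t - s + s * t * k\<close> with \<open>k\<close> odd, and
  for either sign of \<open>k\<close> one of \<open>N\<close>, \<open>- N\<close> has nonnegative
  coefficients. So a bead flipped between two (s,t)-cores cannot satisfy both congruences.\<close>

lemma gap_in_semigroup:
  assumes "odd s" "odd t" "odd N" "s dvd N - t" "t dvd N + s"
  shows "semigroup2 s t N \<or> semigroup2 s t (- N)"
proof -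
  have "s dvd N - t + s" using assms(4) by simp
  moreover have "t dvd N - t + s" using dvd_diff[OF assms(5) dvd_refl] by (simp add: algebra_simps)
  ultimately have "s * t dvd N - t + s" by (rule st_dvd)
  then obtain k where k: "N - t + s = s * t * k" by blast
  have "odd (N - t + s)" using assms by simp
  then have "odd k" unfolding k by simp
  then have "k \<noteq> 0" by auto
  then consider "k \<ge> 1" | "k \<le> -1" by linarith
  then show ?thesis
  proof cases
    case 1
    then have "t * k \<ge> 1 * 1" using t_gt_1 by (intro mult_mono) auto
    moreover have "N = (t * k - 1) * s + 1 * t" using k by (simp add: algebra_simps)
    ultimately show ?thesis unfolding semigroup2_def by (intro disjI1 exI[of _ "t * k - 1"] exI[of _ 1] conjI) auto
  next
    case 2
    then have "s * (- k) \<ge> 1 * 1" using s_gt_1 by (intro mult_mono) auto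
    moreover have "- N = 1 * s + (s * (- k) - 1) * t" using k by (simp add: algebra_simps)
    ultimately show ?thesis unfolding semigroup2_def by (intro disjI2 exI[of _ 1] exI[of _ "s * (- k) - 1"] conjI) auto
  qed
qed

text \<open>Closure of \<open>\<gamma>\<close> could only fail if the flipped beads were neighbours,
  \<open>b = c + s\<close> or \<open>b = c + t\<close>; then one of them would satisfy both
  congruences.\<close>

lemma harpoons_middle_core:
  assumes \<alpha>: "sym_core s t \<alpha>" and \<beta>: "sym_core s t \<beta>" and odd: "odd s" "odd t"
    and h: "set_harpoons s t \<alpha> \<beta> b c"
  defines "\<gamma> \<equiv> insert (bar c) (\<beta> - {c})"
  shows "sym_core s t \<gamma>" "\<alpha> = insert (bar b) (\<gamma> - {b})" "b \<in> \<gamma>" "bar b \<notin> \<gamma>"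
proof -
  have a: "maya \<alpha>" "self_dual \<alpha>" "down_closed s \<alpha>" "down_closed t \<alpha>" using \<alpha> by (auto simp: sym_core_def)
  have b': "maya \<beta>" "self_dual \<beta>" "down_closed s \<beta>" "down_closed t \<beta>" using \<beta> by (auto simp: sym_core_def)
  have bc: "b \<noteq> c" "b \<in> \<beta>" "b \<notin> \<alpha>" "c \<in> \<beta>" "c \<notin> \<alpha>" "[bar b - b = t] (mod (2 * s))" "[bar c - c = - s] (mod (2 * t))"
    and \<alpha>eq: "\<alpha> = (\<beta> - {b, c}) \<union> {bar b, bar c}" using h by (auto simp: set_harpoons_def)
  have nb: "bar b \<notin> \<beta>" "bar c \<notin> \<beta>" using bc self_dualD[OF b'(2)] by blast+
  have na: "bar b \<in> \<alpha>" "bar c \<in> \<alpha>" using \<alpha>eq by auto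
  show 2: "\<alpha> = insert (bar b) (\<gamma> - {b})" unfolding \<gamma>_def \<alpha>eq using bc nb by auto
  show "b \<in> \<gamma>" "bar b \<notin> \<gamma>" unfolding \<gamma>_def using bc nb by auto
  have N: "\<not> semigroup2 s t (bar b - b)" "\<not> semigroup2 s t (- (bar b - b))"
    "\<not> semigroup2 s t (bar c - c)" "\<not> semigroup2 s t (- (bar c - c))"
    using not_semigroup_exchange[OF a(3,4) na(1) bc(3)] not_semigroup_exchange[OF b'(3,4) bc(2) nb(1)]
      not_semigroup_exchange[OF a(3,4) na(2) bc(5)] not_semigroup_exchange[OF b'(3,4) bc(4) nb(2)] by simp_all
  have ob: "odd (bar x - x)" for x unfolding bar_def by presburger
  have bs: "s dvd bar b - b - t" using bc(6) by (metis cong_iff_dvd_diff dvd_mult_right)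
  have ct: "t dvd bar c - c + s" using bc(7) by (metis cong_iff_dvd_diff dvd_mult_right diff_minus_eq_add)
  have ns: "b \<noteq> c + s"
  proof
    assume "b = c + s"
    then have "bar c - c - t = (bar b - b - t) * 1 + s * 2" by (simp add: bar_def)
    then have "s dvd bar c - c - t" using dvd_combine[OF bs dvd_refl] by blast
    then show False using gap_in_semigroup[OF odd ob _ ct] N by blast
  qed
  have nt: "b \<noteq> c + t"
  proof
    assume "b = c + t"
    then have "bar b - b + s = (bar c - c + s) * 1 + t * (-2)" by (simp add: bar_def)
    then have "t dvd bar b - b + s" using dvd_combine[OF ct dvd_refl] by blast
    then show False using gap_in_semigroup[OF odd ob bs] N by blast
  qed
  have cl: "down_closed m \<gamma>" if m: "down_closed m \<alpha>" "down_closed m \<beta>" "b \<noteq> c + m" for m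
    unfolding down_closed_def
  proof
    fix y assume "y \<in> \<gamma>"
    then consider "y = bar c" | "y \<in> \<beta>" "y \<noteq> c" by (auto simp: \<gamma>_def)
    then show "y - m \<in> \<gamma>"
    proof cases
      case 1
      then have "y - m \<in> \<alpha>" using na m by (auto simp: down_closed_def)
      then have "y - m \<in> \<gamma> \<or> y - m = bar b" unfolding 2 by auto
      moreover have "y - m \<noteq> bar b" using 1 m(3) by (auto simp: bar_def)
      ultimately show ?thesis by blast
    next
      case 2
      show ?thesis
      proof (cases "y - m = c")
        case True
        then have "y \<notin> \<alpha>" using bc(5) m(1) by (auto simp: down_closed_def)
        then have "y = b" using 2 \<alpha>eq by auto
        then show ?thesis using True m(3) by auto
      next
        case False
        then show ?thesis using m(2) 2(1) by (auto simp: down_closed_def \<gamma>_def)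
      qed
    qed
  qed
  show "sym_core s t \<gamma>" unfolding sym_core_def
    using maya_exchange[OF b'(1)] self_dual_exchange[OF b'(2) bc(4)] cl[OF a(3) b'(3) ns] cl[OF a(4) b'(4) nt]
    unfolding \<gamma>_def by blast
qed

text \<open>Existence places both central hooks on \<open>\<gamma>\<close>. For uniqueness, parity
  yields a diagonal hook of length divisible by \<open>s\<close>, energy forces it to be central,
  and \<open>weight_one\<close> settles the remaining \<open>t\<close>-hook.\<close>

lemma harpoons_unique_solution:
  assumes \<alpha>: "sym_core s t \<alpha>" and \<beta>: "sym_core s t \<beta>" and odd: "odd s" "odd t"
    and h: "set_harpoons s t \<alpha> \<beta> b c" "n = energy ((\<beta> - {c}) \<union> {bar c}) + s + t"
  shows "\<exists>!B. solution s t \<alpha> \<beta> n B"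
proof -
  interpret sw: coprime_pair t s by (rule swap)
  define \<gamma> where "\<gamma> = insert (bar c) (\<beta> - {c})"
  note mid = harpoons_middle_core[OF \<alpha> \<beta> odd h(1), folded \<gamma>_def]
  have a: "maya \<alpha>" "self_dual \<alpha>" "down_closed s \<alpha>" "down_closed t \<alpha>" using \<alpha> by (auto simp: sym_core_def)
  have b': "maya \<beta>" "self_dual \<beta>" "down_closed s \<beta>" "down_closed t \<beta>" using \<beta> by (auto simp: sym_core_def)
  have g: "maya \<gamma>" "self_dual \<gamma>" "down_closed s \<gamma>" "down_closed t \<gamma>" using mid(1) by (auto simp: sym_core_def)
  have bc: "b \<noteq> c" "b \<in> \<beta>" "b \<notin> \<alpha>" "c \<in> \<beta>" "c \<notin> \<alpha>" "[bar b - b = t] (mod (2 * s))" "[bar c - c = - s] (mod (2 * t))"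
    "bar c \<in> \<alpha>" using h(1) by (auto simp: set_harpoons_def)
  have nbc: "bar c \<notin> \<beta>" using bc self_dualD[OF b'(2)] by blast
  have n: "n = energy \<gamma> + s + t" using h(2) by (simp add: \<gamma>_def)
  have E\<gamma>: "energy \<gamma> = energy \<beta> - c + bar c" unfolding \<gamma>_def by (rule energy_exchange[OF b'(1) bc(4) nbc])
  have E\<alpha>: "energy \<alpha> = energy \<gamma> - b + bar b" unfolding mid(2) by (rule energy_exchange[OF g(1) mid(3,4)])
  obtain c1 where c1: "bar c1 = c1 + t" using half_point[OF odd(2)] .
  obtain c2 where c2: "bar c2 = c2 + s" using half_point[OF odd(1)] .
  note m1 = self_dual_core_mem[OF g(2,4) c1] and m2 = self_dual_core_mem[OF g(2,3) c2]
  have sb: "s dvd c1 - b" by (rule half_point_dvd[OF c1 bc(6)])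
  have "[bar (bar c) - bar c = s] (mod (2 * t))"
  proof -
    have "[- (bar c - c) = - (- s)] (mod (2 * t))" using bc(7) cong_minus_minus_iff by blast
    then show ?thesis by simp
  qed
  then have tc: "t dvd c2 - bar c" by (rule sw.half_point_dvd[OF c2])
  have \<beta>eq: "\<beta> = insert c (\<gamma> - {bar c})" unfolding \<gamma>_def using bc(4) nbc by auto
  have cg: "bar c \<in> \<gamma>" "c \<notin> \<gamma>" unfolding \<gamma>_def by auto
  define C1 where "C1 = insert (bar c1) (\<gamma> - {c1})"
  have C1: "maya C1" "self_dual C1" "energy C1 = energy \<gamma> + t" "same_charge t C1 \<gamma>"
    unfolding C1_def using maya_exchange[OF g(1)] self_dual_exchange[OF g(2) m1(1)]
      energy_exchange[OF g(1) m1] same_charge_exchange[OF g(1) m1] c1 by auto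
  have "c1 \<noteq> c2" using c1 c2 not_s_dvd_t by auto
  then have mC: "c2 \<in> C1" "bar c2 \<notin> C1" unfolding C1_def using m1 m2 by auto
  have C1s: "same_charge s C1 \<alpha>" unfolding C1_def mid(2)
    by (rule same_charge_exchange2[OF g(1) m1 g(1) mid(3,4)]) (simp_all add: sb bar_dvd_diff)
  define B0 where "B0 = insert (bar c2) (C1 - {c2})"
  have "solution s t \<alpha> \<beta> n B0" unfolding solution_def
  proof (intro conjI)
    show "maya B0" unfolding B0_def by (rule maya_exchange[OF C1(1)])
    show "self_dual B0" unfolding B0_def by (rule self_dual_exchange[OF C1(2) mC(1)])
    have "same_charge s B0 C1" unfolding B0_def
      by (rule same_charge_exchange[OF C1(1) mC]) (simp add: c2)
    then show "same_charge s B0 \<alpha>" using C1s same_charge_trans by blast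
    have "t dvd bar c2 - bar (bar c)" using tc by (simp only: bar_dvd_diff)
    then show "same_charge t B0 \<beta>" unfolding B0_def \<beta>eq
      by (intro same_charge_exchange2[OF C1(1) mC g(1) cg]) (simp_all add: tc C1(4))
    show "energy B0 = n" unfolding B0_def energy_exchange[OF C1(1) mC] using c2 C1(3) n by simp
  qed
  moreover have "B = B0" if sol: "solution s t \<alpha> \<beta> n B" for B
  proof -
    have B: "maya B" "self_dual B" "same_charge s B \<alpha>" "same_charge t B \<beta>" "energy B = n"
      using sol by (auto simp: solution_def)
    have s0: "s > 0" and t0: "t > 0" using s_gt_1 t_gt_1 by auto
    obtain k where k: "bar b - b - t = 2 * s * k" using bc(6) by (auto simp: cong_iff_dvd_diff)
    \<comment> \<open>The congruence for \<open>b\<close> makes the \<open>s\<close>-weight of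
      \<open>B\<close> odd.\<close>
    have "energy B - energy \<alpha> = s * (2 * (- k) + 1)" using B(5) n E\<alpha> k by (simp add: algebra_simps)
    then obtain a' where a': "a' \<in> B" "s dvd a' - bar a'" "bar a' < a'"
      using odd_weight_diagonal[OF B(1,2) a(1,3) B(3) s0] by metis
    obtain i where i: "a' - bar a' = s * (2 * i + 1)" "i \<ge> 0" using diagonal_multiple[OF a'(2,3) s0] .
    have na': "bar a' \<notin> B" using a'(1) self_dualD[OF B(2)] by blast
    define B' where "B' = insert (bar a') (B - {a'})"
    have B': "maya B'" "self_dual B'" "energy B' = energy B - (a' - bar a')" "same_charge s B' B"
      unfolding B'_def using maya_exchange[OF B(1)] self_dual_exchange[OF B(2) a'(1)]
        energy_exchange[OF B(1) a'(1) na'] same_charge_exchange[OF B(1) a'(1) na' a'(2)] by auto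
    have Bback: "B = insert a' (B' - {bar a'})" unfolding B'_def using exchange_back[OF a'(1) na'] by simp
    \<comment> \<open>Otherwise removing the hook keeps the \<open>t\<close>-core
      \<open>\<beta>\<close>. Its length is at least \<open>s * t\<close>, and with the Frobenius
      bound on \<open>bar c - c\<close> no energy above \<open>\<beta>\<close> remains, so
      \<open>B' = \<beta>\<close>.\<close>
    have ntd: "\<not> t dvd a' - bar a'"
    proof
      assume td: "t dvd a' - bar a'"
      have ct: "same_charge t B' \<beta>"
        using same_charge_exchange[OF B(1) a'(1) na' td] B(4) same_charge_trans unfolding B'_def by blast
      have le: "energy \<beta> \<le> energy B'" by (rule core_energy_le[OF B'(1) b'(1,4) ct t0])
      have "s * t dvd a' - bar a'" using a'(2) td by (rule st_dvd)
      then have ge: "a' - bar a' \<ge> s * t" using zdvd_imp_le a'(3) by simp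
      have "\<not> semigroup2 s t (bar c - c)" by (rule not_semigroup_exchange[OF a(3,4) bc(8,5)])
      then have "bar c - c \<le> s * t - s - t" using semigroup_large by force
      then have "energy B' \<le> energy \<beta>" using B'(3) B(5) n E\<gamma> ge by simp
      then have "B' = \<beta>" by (rule core_energy_eq[OF B'(1) b'(1,4) ct t0])
      then have "same_charge s \<beta> \<alpha>" using B'(4) B(3) same_charge_trans by blast
      then have "\<beta> = \<alpha>" by (rule core_unique[OF b'(1) a(1) b'(3) a(3) _ s0])
      then show False using bc by simp
    qed
    \<comment> \<open>The \<open>t\<close>-core of \<open>B'\<close> is \<open>\<beta>\<close> with
      the top bead \<open>e\<close> of this runner flipped; its energy may not exceed that of
      \<open>B'\<close>.\<close>
    obtain e where e: "t dvd e - a'" "e \<in> \<beta>" "e + t \<notin> \<beta>" using maya_ascend[OF b'(1) t0] by metis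
    have nde: "\<not> t dvd e - bar e"
    proof
      assume "t dvd e - bar e"
      then have "t dvd a' - bar a'" by (rule dvd_combine[OF _ e(1), of _ _ 1 "-2"]) (simp add: bar_def)
      then show False using ntd by simp
    qed
    have ne: "bar e \<notin> \<beta>" using e(2) self_dualD[OF b'(2)] by blast
    have ch: "same_charge t B' (insert (bar e) (\<beta> - {e}))" unfolding B'_def
      by (rule same_charge_exchange2[OF B(1) a'(1) na' b'(1) e(2) ne])
        (simp_all add: bar_dvd_diff e(1) dvd_diff_commute[of t a' e] B(4))
    have "energy (insert (bar e) (\<beta> - {e})) \<le> energy B'"
      by (rule core_energy_le[OF B'(1) maya_exchange[OF b'(1)] self_dual_core_exchange_closed[OF b'(2,4) e(2,3) nde] ch t0])
    then have le: "bar e - e \<le> bar c - c + t - 2 * (s * i)"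
      using energy_exchange[OF b'(1) e(2) ne] B'(3) B(5) n E\<gamma> i(1) by (simp add: algebra_simps)
    have ba: "bar a' = c2 - s * i" using i(1) c2 by (simp add: bar_def algebra_simps)
    \<comment> \<open>For \<open>i > 0\<close> the runner of \<open>bar e\<close> contains the bead
      \<open>bar c - s * i\<close> of \<open>\<beta>\<close>, so the gap \<open>bar e\<close> lies
      at least \<open>t\<close> above it, too high for \<open>le\<close>.\<close>
    have i0: "i = 0"
    proof (rule ccontr)
      assume "i \<noteq> 0"
      then have ip: "i > 0" using i(2) by simp
      have "bar c - s * i \<in> \<gamma>" by (rule down_closed_mult[OF g(3) cg(1) i(2)])
      then have inb: "bar c - s * i \<in> \<beta>" using ip s0 unfolding \<gamma>_def by auto
      have d: "t dvd bar e - (bar c - s * i)"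
      proof -
        have "t dvd bar e - bar a'" using e(1) by (simp add: bar_dvd_diff)
        then show ?thesis by (rule dvd_combine[OF _ tc, of _ _ 1 1]) (simp add: ba)
      qed
      have "bar c - s * i + t \<le> bar e"
      proof (rule ccontr)
        assume n: "\<not> ?thesis"
        show False
        proof (cases "bar e \<le> bar c - s * i")
          case True
          then have "bar e \<in> \<beta>" using down_closed_le[OF b'(4) inb True _ t0] d by (simp add: dvd_diff_commute)
          then show False using ne by simp
        next
          case False
          then have "t \<le> bar e - (bar c - s * i)" using zdvd_imp_le[OF d] by simp
          then show False using n by simp
        qed
      qed
      then show False using le t0 by (simp add: bar_def)
    qed
    then have a'c: "a' = bar c2" using ba by (metis bar_bar diff_zero mult_zero_right)
    have "same_charge t B' \<gamma>" unfolding B'_def \<gamma>_def a'c bar_bar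
    proof (rule same_charge_exchange2[OF B(1) _ _ b'(1) bc(4) nbc _ _ B(4)])
      show "bar c2 \<in> B" "c2 \<notin> B" using a'(1) na' a'c by simp_all
      have "t dvd bar c2 - bar (bar c)" using tc by (simp only: bar_dvd_diff)
      then show "t dvd bar c2 - c" by simp
    qed (rule tc)
    moreover have "energy B' = energy \<gamma> + t" using B'(3) B(5) n i(1) i0 by simp
    ultimately obtain c' where c': "bar c' = c' + t" "B' = insert (bar c') (\<gamma> - {c'})"
      using weight_one[OF B'(1,2) g(1,2,4) _ t0] by metis
    have "c' = c1" using c1 c'(1) by (simp add: bar_def)
    then have "B' = C1" using c'(2) C1_def by simp
    then show ?thesis using Bback a'c unfolding B0_def by simp
  qed
  ultimately show ?thesis by blast
qed

text \<open>The \<open>t\<close>-weight is the odd number \<open>s\<close>, which yields a diagonal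
  hook of length divisible by \<open>t\<close>. Once \<open>s\<close> is shown to divide it as well,
  the energy leaves only the length \<open>s * t\<close>.\<close>

lemma kappa_unique_solution:
  assumes odd: "odd s" "odd t"
  defines "K \<equiv> kappa_set s t"
  shows "\<exists>!B. solution s t K K (energy K + s * t) B"
proof -
  have K: "maya K" "self_dual K" "down_closed s K" "down_closed t K"
    unfolding K_def using kappa_set_maya kappa_set_self_dual kappa_set_closed by auto
  have s0: "s > 0" and t0: "t > 0" using s_gt_1 t_gt_1 by auto
  obtain c where c: "bar c = c + s * t" using half_point[of "s * t"] odd by auto
  note cm = self_dual_core_mem[OF K(2) down_closed_st[OF K(3)] c]
  define B0 where "B0 = insert (bar c) (K - {c})"
  have "solution s t K K (energy K + s * t) B0" unfolding solution_def
  proof (intro conjI)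
    show "maya B0" unfolding B0_def by (rule maya_exchange[OF K(1)])
    show "self_dual B0" unfolding B0_def by (rule self_dual_exchange[OF K(2) cm(1)])
    show "same_charge s B0 K" "same_charge t B0 K" unfolding B0_def
      by (rule same_charge_exchange[OF K(1) cm], simp add: c)+
    show "energy B0 = energy K + s * t" unfolding B0_def energy_exchange[OF K(1) cm] using c by simp
  qed
  moreover have "B = B0" if sol: "solution s t K K (energy K + s * t) B" for B
  proof -
    have B: "maya B" "self_dual B" "same_charge s B K" "same_charge t B K" "energy B = energy K + s * t"
      using sol by (auto simp: solution_def)
    obtain k where k: "s = 2 * k + 1" using odd(1) by (rule oddE)
    have "energy B - energy K = t * (2 * k + 1)" using B(5) k by (simp add: algebra_simps)
    then obtain a where a: "a \<in> B" "t dvd a - bar a" "bar a < a"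
      using odd_weight_diagonal[OF B(1,2) K(1,4) B(4) t0] by metis
    obtain i where i: "a - bar a = t * (2 * i + 1)" "i \<ge> 0" using diagonal_multiple[OF a(2,3) t0] .
    have na: "bar a \<notin> B" using a(1) self_dualD[OF B(2)] by blast
    define B' where "B' = insert (bar a) (B - {a})"
    have B': "maya B'" "energy B' = energy B - (a - bar a)"
      unfolding B'_def using maya_exchange[OF B(1)] energy_exchange[OF B(1) a(1) na] by auto
    have Bback: "B = insert a (B' - {bar a})" unfolding B'_def using exchange_back[OF a(1) na] by simp
    have sda: "s dvd a - bar a"
    proof (rule ccontr)
      assume nsd: "\<not> s dvd a - bar a"
      obtain e where e: "s dvd e - a" "e \<in> K" "e + s \<notin> K" using maya_ascend[OF K(1) s0] by metis
      have nde: "\<not> s dvd e - bar e"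
      proof
        assume "s dvd e - bar e"
        then have "s dvd a - bar a" by (rule dvd_combine[OF _ e(1), of _ _ 1 "-2"]) (simp add: bar_def)
        then show False using nsd by simp
      qed
      have ne: "bar e \<notin> K" using e(2) self_dualD[OF K(2)] by blast
      have ch: "same_charge s B' (insert (bar e) (K - {e}))" unfolding B'_def
        by (rule same_charge_exchange2[OF B(1) a(1) na K(1) e(2) ne])
          (simp_all add: bar_dvd_diff e(1) dvd_diff_commute[of s a e] B(3))
      have "energy (insert (bar e) (K - {e})) \<le> energy B'"
        by (rule core_energy_le[OF B'(1) maya_exchange[OF K(1)] self_dual_core_exchange_closed[OF K(2,3) e(2,3) nde] ch s0])
      then have le: "bar e - e \<le> s * t - t * (2 * i + 1)"
        using energy_exchange[OF K(1) e(2) ne] B'(2) B(5) i(1) by simp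
      let ?h = "(s * t - s - t - 1) div 2"
      obtain i' j where ij: "i' \<ge> 0" "j \<ge> 0" "?h - e = i' * s + j * t"
        using e(2) unfolding K_def kappa_set_def semigroup2_def by auto
      \<comment> \<open>\<open>e\<close> ends its \<open>s\<close>-runner, so it lies on the edge
        \<open>?h - j * t\<close> of the cone.\<close>
      have "i' = 0"
      proof (rule ccontr)
        assume "i' \<noteq> 0"
        then have "i' - 1 \<ge> 0" using ij(1) by simp
        moreover have "?h - (e + s) = (i' - 1) * s + j * t" using ij(3) by (simp add: algebra_simps)
        ultimately have "e + s \<in> K" unfolding K_def kappa_set_def semigroup2_def using ij(2) by blast
        then show False using e(3) by simp
      qed
      then have "e = ?h - j * t" using ij(3) by simp
      then have ee: "2 * e + 1 = s * t - s - t - 2 * (j * t)" using kappa_top by linarith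
      have aa: "2 * a + 1 = t * (2 * i + 1)" using i(1) by (simp add: bar_def)
      \<comment> \<open>\<open>e\<close> and \<open>a\<close> agree modulo \<open>s\<close>;
        comparing \<open>2 * e + 1\<close> with \<open>2 * a + 1\<close> makes \<open>s\<close>
        divide \<open>j + i + 1\<close>, which is then too large for \<open>le\<close>.\<close>
      have "t * (2 * (j + i + 1)) = (e - a) * (-2) + s * (t - 1)"
        using ee aa by (simp add: algebra_simps)
      then have "s dvd t * (2 * (j + i + 1))" using dvd_combine[OF e(1) dvd_refl] by blast
      then have "s dvd 2 * (j + i + 1)" using s_dvd_t_mult by blast
      then have "s dvd j + i + 1" using odd(1) by (metis coprime_dvd_mult_right_iff coprime_right_2_iff_odd)
      then have "s \<le> j + i + 1" using zdvd_imp_le ij(2) i(2) by simp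
      then have "t * s \<le> t * (j + i + 1)" using t0 by simp
      moreover have "2 * (t * (j + i + 1)) + s \<le> 2 * (t * s)"
        using le ee by (simp add: bar_def algebra_simps)
      ultimately show False using s0 by linarith
    qed
    have ct: "same_charge t B' K"
      using same_charge_exchange[OF B(1) a(1) na a(2)] B(4) same_charge_trans unfolding B'_def by blast
    have "s * t dvd a - bar a" using sda a(2) by (rule st_dvd)
    then have ge: "a - bar a \<ge> s * t" using zdvd_imp_le a(3) by simp
    moreover have "energy K \<le> energy B'" by (rule core_energy_le[OF B'(1) K(1,4) ct t0])
    ultimately have eq: "a - bar a = s * t" "energy B' \<le> energy K" using B'(2) B(5) by simp_all
    then have "B' = K" using core_energy_eq[OF B'(1) K(1,4) ct t0] by simp
    moreover have "a = bar c" using eq(1) c by (simp add: bar_def)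
    ultimately show ?thesis using Bback unfolding B0_def by simp
  qed
  ultimately show ?thesis by blast
qed

theorem reduced_classification:
  assumes \<alpha>: "sym_core s t \<alpha>" and \<beta>: "sym_core s t \<beta>"
  shows "(\<exists>!B. solution s t \<alpha> \<beta> n B) \<longleftrightarrow>
    \<alpha> = \<beta> \<and> n = energy \<alpha> \<or>
    odd t \<and> set_harpoon s t \<alpha> \<beta> \<and> n = energy \<beta> + t \<or>
    odd s \<and> set_harpoon t s \<beta> \<alpha> \<and> n = energy \<alpha> + s \<or>
    odd s \<and> odd t \<and> (\<exists>b c. set_harpoons s t \<alpha> \<beta> b c \<and> n = energy ((\<beta> - {c}) \<union> {bar c}) + s + t) \<or>
    odd s \<and> odd t \<and> \<alpha> = kappa_set s t \<and> \<beta> = kappa_set s t \<and> n = energy (kappa_set s t) + s * t"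
  (is "?L \<longleftrightarrow> ?R")
proof
  have a: "maya \<alpha>" "self_dual \<alpha>" "down_closed s \<alpha>" "down_closed t \<alpha>" using \<alpha> by (auto simp: sym_core_def)
  have b: "maya \<beta>" "self_dual \<beta>" "down_closed s \<beta>" "down_closed t \<beta>" using \<beta> by (auto simp: sym_core_def)
  interpret sw: coprime_pair t s by (rule swap)
  {
    assume ?L
    then obtain B where sol: "solution s t \<alpha> \<beta> n B" and uniq: "\<And>C. solution s t \<alpha> \<beta> n C \<Longrightarrow> C = B" by blast
    have B: "maya B" "self_dual B" "same_charge s B \<alpha>" "same_charge t B \<beta>" "energy B = n"
      using sol by (auto simp: solution_def)
    have "unswitchable s t B" by (rule unique_solution_unswitchable[OF sol uniq])
    then interpret rigid_pair s t B \<alpha> \<beta>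
      using a b B by unfold_locales auto
    show ?R
    \<comment> \<open>The central hook of length \<open>s * t\<close> is separated first, because
      its absence is what closes \<open>B\<close> under \<open>s * t\<close>.\<close>
    proof (cases "\<exists>b0\<in>B. bar b0 = b0 - s * t")
      case True
      then obtain b0 where b0: "b0 \<in> B" "bar b0 = b0 - s * t" by blast
      show ?thesis using middle_conclusion[OF b0] B(5) by simp
    next
      case False
      then interpret rigid_pair_closed s t B \<alpha> \<beta> by unfold_locales auto
      interpret swc: rigid_pair_closed t s B \<beta> \<alpha> by (rule rigid_closed_swap)
      consider "\<forall>x\<in>B. bar x \<noteq> x - s" "\<forall>x\<in>B. bar x \<noteq> x - t"
        | x where "x \<in> B" "bar x = x - t" "\<forall>x\<in>B. bar x \<noteq> x - s"
        | y where "y \<in> B" "bar y = y - s" "\<forall>x\<in>B. bar x \<noteq> x - t"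
        | x y where "x \<in> B" "bar x = x - t" "y \<in> B" "bar y = y - s" by blast
      then show ?thesis
      proof cases
        case 1 then show ?thesis using conclude_none B(5) by metis
      next
        case 2 then show ?thesis using conclude_t B(5) by metis
      next
        case 3 then show ?thesis using swc.conclude_t B(5) by metis
      next
        case 4
        obtain b c where "odd s" "odd t" "set_harpoons s t \<alpha> \<beta> b c"
          "energy B = energy ((\<beta> - {c}) \<union> {bar c}) + s + t"
          using conclude_both[OF 4] by metis
        then show ?thesis using B(5) by blast
      qed
    qed
  }
  {
    assume ?R
    then show ?L
    proof (elim disjE conjE exE)
      assume h: "\<alpha> = \<beta>" "n = energy \<alpha>"
      have "solution s t \<alpha> \<beta> n \<alpha>" using a h by (simp add: solution_def)
      moreover have "B = \<alpha>" if "solution s t \<alpha> \<beta> n B" for B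
        using that core_energy_eq[OF _ a(1,3), of B] h s_gt_1 by (auto simp: solution_def)
      ultimately show ?L by blast
    next
      assume "odd t" "set_harpoon s t \<alpha> \<beta>" "n = energy \<beta> + t"
      then show ?L by (rule harpoon_unique_solution[OF \<alpha> \<beta>])
    next
      assume h: "odd s" "set_harpoon t s \<beta> \<alpha>" "n = energy \<alpha> + s"
      have "sym_core t s \<alpha>" "sym_core t s \<beta>" using \<alpha> \<beta> by (auto simp: sym_core_def)
      then have "\<exists>!B. solution t s \<beta> \<alpha> n B" using sw.harpoon_unique_solution h by blast
      then show ?L by (simp only: solution_swap[of s t])
    next
      fix b c assume "odd s" "odd t" "set_harpoons s t \<alpha> \<beta> b c" "n = energy ((\<beta> - {c}) \<union> {bar c}) + s + t"
      then show ?L by (rule harpoons_unique_solution[OF \<alpha> \<beta>])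
    next
      assume "odd s" "odd t" "\<alpha> = kappa_set s t" "\<beta> = kappa_set s t" "n = energy (kappa_set s t) + s * t"
      then show ?L using kappa_unique_solution by simp
    qed
  }
qed

end


section \<open>Reduction to (s,t)-cores\<close>

text \<open>As an involution, \<open>\<phi>\<close> itself tests membership in its images; the bound
  keeps images of Maya diagrams Maya.\<close>

definition sym_shift :: "int \<Rightarrow> int \<Rightarrow> (int \<Rightarrow> int) \<Rightarrow> bool" where
  "sym_shift s t \<phi> \<longleftrightarrow> (\<forall>b. \<phi> (\<phi> b) = b) \<and> (\<forall>b. \<phi> (b + t) = \<phi> b + t) \<and> (\<forall>b. s dvd \<phi> b - b) \<and>
     (\<forall>b. \<phi> (bar b) = bar (\<phi> b)) \<and> (\<exists>M. \<forall>b. \<bar>\<phi> b - b\<bar> \<le> M)"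

lemma wsum_add: "wsum (\<lambda>b. v b + w b) B = wsum v B + wsum w B"
  unfolding wsum_def sum.distrib[symmetric] by (rule sum.cong) (auto simp: algebra_simps)

lemma involution_image_mem: "(\<And>b. \<phi> (\<phi> b) = b) \<Longrightarrow> b \<in> \<phi> ` B \<longleftrightarrow> \<phi> b \<in> B"
  by (metis image_iff)

lemma sym_shift_same_charge:
  assumes \<phi>: "sym_shift s t \<phi>" and B: "maya B"
  shows "same_charge s (\<phi> ` B) B"
  unfolding same_charge_def
proof (intro allI impI)
  fix g :: "int \<Rightarrow> int" assume g: "\<forall>b. g (b + s) = g b"
  have inv: "\<And>b. \<phi> (\<phi> b) = b" and sd: "\<And>b. s dvd \<phi> b - b" using \<phi> by (auto simp: sym_shift_def)
  obtain M where M: "\<And>b. \<bar>\<phi> b - b\<bar> \<le> M" using \<phi> by (auto simp: sym_shift_def)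
  have bij: "bij \<phi>" by (rule o_bij[of \<phi>]) (auto simp: inv)
  have "\<phi> ` B - B = \<phi> ` (B - \<phi> ` B)" using inv by (auto simp: involution_image_mem[OF inv])
  then have "sum g (\<phi> ` B - B) = sum (\<lambda>b. g (\<phi> b)) (B - \<phi> ` B)"
    using bij by (simp add: sum.reindex inj_on_subset[OF bij_is_inj] o_def)
  also have "\<dots> = sum g (B - \<phi> ` B)" by (rule sum.cong) (auto intro: periodic_cong[OF g sd])
  finally show "wsum g (\<phi> ` B) = wsum g B"
    using wsum_diff[OF bij_bounded_maya[OF B bij M] B, of g] by simp
qed

text \<open>The displacement \<open>\<phi> b - b\<close> is a \<open>t\<close>-periodic weight, so
  it sums to the same value over \<open>B\<close> and over \<open>\<tau>\<close>; this is the common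
  change of energy.\<close>

lemma sym_shift_transport:
  assumes \<phi>: "sym_shift s t \<phi>" and \<tau>: "maya \<tau>" and sol: "solution s t \<sigma> \<tau> n B"
  shows "solution s t \<sigma> (\<phi> ` \<tau>) (n - energy \<tau> + energy (\<phi> ` \<tau>)) (\<phi> ` B)"
proof -
  have inv: "\<And>b. \<phi> (\<phi> b) = b" and per: "\<And>b. \<phi> (b + t) = \<phi> b + t" and br: "\<And>b. \<phi> (bar b) = bar (\<phi> b)"
    using \<phi> by (auto simp: sym_shift_def)
  obtain M where M: "\<And>b. \<bar>\<phi> b - b\<bar> \<le> M" using \<phi> by (auto simp: sym_shift_def)
  have bij: "bij \<phi>" by (rule o_bij[of \<phi>]) (auto simp: inv)
  have B: "maya B" "self_dual B" "same_charge s B \<sigma>" "same_charge t B \<tau>" "energy B = n"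
    using sol by (auto simp: solution_def)
  note im = wsum_image_diff[OF B(1) \<tau> bij M]
  show ?thesis unfolding solution_def
  proof (intro conjI)
    show "maya (\<phi> ` B)" by (rule bij_bounded_maya[OF B(1) bij M])
    show "self_dual (\<phi> ` B)" unfolding self_dual_def
      using self_dualD[OF B(2)] by (simp add: involution_image_mem[OF inv] br)
    show "same_charge s (\<phi> ` B) \<sigma>"
      using sym_shift_same_charge[OF \<phi> B(1)] B(3) same_charge_trans by blast
    show "same_charge t (\<phi> ` B) (\<phi> ` \<tau>)" unfolding same_charge_def
    proof (intro allI impI)
      fix g :: "int \<Rightarrow> int" assume g: "\<forall>b. g (b + t) = g b"
      have "wsum (\<lambda>b. g (\<phi> b)) B = wsum (\<lambda>b. g (\<phi> b)) \<tau>"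
        by (rule same_chargeD[OF B(4)]) (simp add: per g)
      then show "wsum g (\<phi> ` B) = wsum g (\<phi> ` \<tau>)" using im[of g] by simp
    qed
    have "wsum (\<lambda>b. \<phi> b - b) B = wsum (\<lambda>b. \<phi> b - b) \<tau>"
      by (rule same_chargeD[OF B(4)]) (simp add: per)
    moreover have "wsum \<phi> X = wsum (\<lambda>b. b) X + wsum (\<lambda>b. \<phi> b - b) X" for X
      using wsum_add[of "\<lambda>b. b" "\<lambda>b. \<phi> b - b" X] by simp
    ultimately show "energy (\<phi> ` B) = n - energy \<tau> + energy (\<phi> ` \<tau>)"
      using im[of "\<lambda>b. b"] B(5) unfolding energy_def by simp
  qed
qed

lemma sym_shift_unique_solution:
  assumes \<phi>: "sym_shift s t \<phi>" and \<tau>: "maya \<tau>"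
  shows "(\<exists>!B. solution s t \<sigma> \<tau> n B) \<longleftrightarrow> (\<exists>!B. solution s t \<sigma> (\<phi> ` \<tau>) (n - energy \<tau> + energy (\<phi> ` \<tau>)) B)"
proof -
  have inv: "\<And>b. \<phi> (\<phi> b) = b" using \<phi> by (auto simp: sym_shift_def)
  have ii: "\<phi> ` \<phi> ` X = X" for X by (auto simp: involution_image_mem[OF inv] inv image_image)
  obtain M where M: "\<And>b. \<bar>\<phi> b - b\<bar> \<le> M" using \<phi> by (auto simp: sym_shift_def)
  have bij: "bij \<phi>" by (rule o_bij[of \<phi>]) (auto simp: inv)
  have \<tau>': "maya (\<phi> ` \<tau>)" by (rule bij_bounded_maya[OF \<tau> bij M])
  let ?P = "solution s t \<sigma> \<tau> n" and ?Q = "solution s t \<sigma> (\<phi> ` \<tau>) (n - energy \<tau> + energy (\<phi> ` \<tau>))"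
  have QP: "?P (\<phi> ` B)" if "?Q B" for B
    using sym_shift_transport[OF \<phi> \<tau>' that] by (simp add: ii)
  have PQ: "?Q (\<phi> ` B)" if "?P B" for B by (rule sym_shift_transport[OF \<phi> \<tau> that])
  have ex1: "\<exists>!B. R B" if h: "\<exists>!B. R' B" "\<And>B. R' B \<Longrightarrow> R (\<phi> ` B)" "\<And>B. R B \<Longrightarrow> R' (\<phi> ` B)" for R R'
  proof -
    obtain B where B: "R' B" "\<And>D. R' D \<Longrightarrow> D = B" using h(1) by blast
    show ?thesis
    proof (rule ex1I)
      show "R (\<phi> ` B)" by (rule h(2)[OF B(1)])
      fix D assume "R D"
      then have "\<phi> ` D = B" using h(3) B(2) by blast
      then show "D = \<phi> ` B" using ii[of D] by simp
    qed
  qed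
  show ?thesis
  proof
    assume "\<exists>!B. ?P B" then show "\<exists>!B. ?Q B" using PQ QP by (rule ex1)
  next
    assume "\<exists>!B. ?Q B" then show "\<exists>!B. ?P B" using QP PQ by (rule ex1)
  qed
qed

lemma sym_shift_energy_less:
  assumes \<phi>: "sym_shift s t \<phi>" and \<tau>: "maya \<tau>"
    and low: "\<And>b. b \<in> \<tau> \<Longrightarrow> \<phi> b \<notin> \<tau> \<Longrightarrow> \<phi> b < b" and y: "y \<in> \<tau>" "\<phi> y \<notin> \<tau>"
  shows "energy (\<phi> ` \<tau>) < energy \<tau>"
proof -
  have inv: "\<And>b. \<phi> (\<phi> b) = b" using \<phi> by (auto simp: sym_shift_def)
  obtain M where M: "\<And>b. \<bar>\<phi> b - b\<bar> \<le> M" using \<phi> by (auto simp: sym_shift_def)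
  have bij: "bij \<phi>" by (rule o_bij[of \<phi>]) (auto simp: inv)
  have \<tau>': "maya (\<phi> ` \<tau>)" by (rule bij_bounded_maya[OF \<tau> bij M])
  let ?D = "\<tau> - \<phi> ` \<tau>"
  have "\<phi> ` \<tau> - \<tau> = \<phi> ` ?D" using inv by (auto simp: involution_image_mem[OF inv])
  then have "sum (\<lambda>b. b) (\<phi> ` \<tau> - \<tau>) = sum \<phi> ?D"
    using bij by (simp add: sum.reindex inj_on_subset[OF bij_is_inj] o_def)
  moreover have "sum \<phi> ?D < sum (\<lambda>b. b) ?D"
  proof (rule sum_strict_mono)
    show "finite ?D" by (rule maya_finite_diff[OF \<tau> \<tau>'])
    show "?D \<noteq> {}" using y involution_image_mem[OF inv, of y \<tau>] by blast
  qed (use low in \<open>auto simp: involution_image_mem[OF inv]\<close>)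
  ultimately show ?thesis using wsum_diff[OF \<tau>' \<tau>, of "\<lambda>b. b"] unfolding energy_def by simp
qed

text \<open>\<open>P\<close> and \<open>Q\<close> are unions of \<open>t\<close>-runners exchanged
  both by the translation and by \<open>bar\<close>, which makes the swap commute with
  \<open>bar\<close>.\<close>

lemma class_swap_sym_shift:
  assumes "s dvd K" "\<And>b. P (b + t) = P b" "\<And>b. Q (b + t) = Q b"
    and "\<And>b. P b \<Longrightarrow> Q (b - K)" "\<And>b. P b \<Longrightarrow> \<not> P (b - K)" "\<And>b. Q b \<Longrightarrow> P (b + K)"
    and "\<And>b. P b \<Longrightarrow> \<not> Q b" "\<And>b. P (bar b) = Q b"
  shows "sym_shift s t (\<lambda>b. if P b then b - K else if Q b then b + K else b)"
proof -
  have Qb: "Q (bar b) = P b" for b using assms(8)[of "bar b"] by simp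
  have e: "bar b - K = bar (b + K)" "bar b + K = bar (b - K)" for b by (simp_all add: bar_def)
  have "\<bar>(if P b then b - K else if Q b then b + K else b) - b\<bar> \<le> \<bar>K\<bar>" for b by auto
  then have "\<exists>M. \<forall>b. \<bar>(if P b then b - K else if Q b then b + K else b) - b\<bar> \<le> M" by blast
  moreover have "(if P (bar b) then bar b - K else if Q (bar b) then bar b + K else bar b) =
      bar (if P b then b - K else if Q b then b + K else b)" for b
    using assms(7)[of b] by (auto simp: assms(8) Qb e)
  ultimately show ?thesis unfolding sym_shift_def using assms(1-7) by auto
qed

lemma not_core_mem_less:
  assumes "down_closed m \<tau>" "m > 0" "y \<in> \<tau>" "x \<notin> \<tau>" "m dvd x - y"
  shows "y < x"
proof (rule ccontr)
  assume "\<not> y < x"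
  then show False using down_closed_le[OF assms(1,3) _ _ assms(2), of x] assms(4,5) by (simp add: dvd_diff_commute)
qed

lemma dvd_shift_iff: "m dvd b + m - r \<longleftrightarrow> m dvd b - r" for m b r :: int
proof -
  have "b + m - r = (b - r) + m" by simp
  then show ?thesis by (simp only: dvd_add_triv_right_iff)
qed

lemma dvd_cong_iff: "m dvd x - y \<Longrightarrow> m dvd x \<longleftrightarrow> m dvd y" for m x y :: int
  by (metis dvd_diff_commute diff_add_cancel dvd_add_right_iff)

section \<open>Symmetric shifts that lower the energy\<close>

context coprime_pair
begin

text \<open>The runners of \<open>y\<close> and \<open>y - K\<close> are mirror images, so swapping
  them is symmetric. A bead moved up into a gap would have to lie both above and below
  \<open>y - K\<close>.\<close>

lemma dual_class_shift:
  assumes \<tau>: "maya \<tau>" "self_dual \<tau>" "down_closed t \<tau>"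
    and y: "y \<in> \<tau>" "y - K \<notin> \<tau>" "K > 0" "s dvd K" "\<not> t dvd K" "t dvd bar y - (y - K)"
  shows "\<exists>\<phi>. sym_shift s t \<phi> \<and> energy (\<phi> ` \<tau>) < energy \<tau>"
proof -
  have t0: "t > 0" using t_gt_1 by simp
  define P Q where "P = (\<lambda>b. t dvd b - y)" and "Q = (\<lambda>b. t dvd b - (y - K))"
  define \<phi> where "\<phi> = (\<lambda>b. if P b then b - K else if Q b then b + K else b)"
  have excl: "\<not> t dvd b - (y - K)" if "t dvd b - y" for b
  proof
    assume "t dvd b - (y - K)"
    then have "t dvd K" by (rule dvd_combine[OF _ that, of _ _ 1 "-1"]) simp
    then show False using y(5) by simp
  qed
  have ss: "sym_shift s t \<phi>" unfolding \<phi>_def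
  proof (rule class_swap_sym_shift[OF y(4)])
    show "P (b + t) = P b" "Q (b + t) = Q b" for b unfolding P_def Q_def by (rule dvd_shift_iff)+
    show "P b \<Longrightarrow> Q (b - K)" "Q b \<Longrightarrow> P (b + K)" for b unfolding P_def Q_def by (simp_all add: algebra_simps)
    show "\<not> P (b - K)" if "P b" for b
    proof
      assume "P (b - K)"
      then have "t dvd (b - y) - (b - K - y)" using that dvd_diff unfolding P_def by blast
      then have "t dvd K" by simp
      then show False using y(5) by simp
    qed
    show "P b \<Longrightarrow> \<not> Q b" for b unfolding P_def Q_def by (rule excl)
    show "P (bar b) = Q b" for b
    proof -
      have "t dvd (bar b - y) - - (b - (y - K))"
        by (rule dvd_combine[OF y(6) dvd_refl, of _ 1 0]) (simp add: bar_def)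
      then show ?thesis unfolding P_def Q_def using dvd_cong_iff dvd_minus_iff by metis
    qed
  qed
  have "\<phi> b < b" if b: "b \<in> \<tau>" "\<phi> b \<notin> \<tau>" for b
  proof (cases "P b")
    case True then show ?thesis using y(3) by (simp add: \<phi>_def)
  next
    case False
    then have Q: "Q b" "b + K \<notin> \<tau>" using b by (auto simp: \<phi>_def split: if_splits)
    then have "t dvd (b + K) - y" unfolding Q_def by (simp add: algebra_simps)
    then have "y < b + K" by (rule not_core_mem_less[OF \<tau>(3) t0 y(1) Q(2)])
    moreover have "b < y - K"
      by (rule not_core_mem_less[OF \<tau>(3) t0 b(1) y(2)]) (use Q in \<open>simp add: Q_def dvd_diff_commute\<close>)
    ultimately show ?thesis by simp
  qed
  moreover have "\<phi> y = y - K" by (simp add: \<phi>_def P_def)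
  ultimately show ?thesis using ss sym_shift_energy_less[OF ss \<tau>(1)] y(1,2) by metis
qed

text \<open>Swapping a self-dual runner with one neighbour is not symmetric; instead the runners of
  \<open>c + s\<close> and \<open>c - s\<close> on either side, mirror images of each other, are
  swapped by \<open>2 * s\<close>.\<close>

lemma self_dual_class_shift:
  assumes \<tau>: "maya \<tau>" "self_dual \<tau>" "down_closed t \<tau>"
    and z: "z \<in> \<tau>" "z - s \<notin> \<tau>" "t dvd z - bar z"
  shows "\<exists>\<phi>. sym_shift s t \<phi> \<and> energy (\<phi> ` \<tau>) < energy \<tau>"
proof -
  interpret sw: coprime_pair t s by (rule swap)
  have t0: "t > 0" using t_gt_1 by simp
  have "z - bar z = 2 * z + 1" by (simp add: bar_def)
  then have odd: "odd t" using z(3) by (metis dvd_trans even_add even_mult_iff odd_one dvd_triv_left)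
  obtain c where c: "bar c = c + t" using half_point[OF odd] .
  note cm = self_dual_core_mem[OF \<tau>(2,3) c]
  have "2 * (c - z) = (bar z - z) - t" using c unfolding bar_def by presburger
  then have "t dvd 2 * (c - z)" using z(3) by (metis dvd_diff dvd_diff_commute dvd_refl)
  then have tc: "t dvd c - z" using odd by (metis coprime_dvd_mult_right_iff coprime_right_2_iff_odd)
  have "t dvd bar c - z" by (rule dvd_combine[OF tc dvd_refl, of _ 1 1]) (simp add: c)
  then have "z < bar c" by (rule not_core_mem_less[OF \<tau>(3) t0 z(1) cm(2)])
  then have "z \<le> c" using tc c zdvd_imp_le[of t "z - c"] by (force simp: dvd_diff_commute)
  \<comment> \<open>\<open>c\<close> is the top bead of this runner, hence not below
    \<open>z\<close>, and the gap at \<open>z - s\<close> propagates up to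
    \<open>c - s\<close>.\<close>
  have ncs: "c - s \<notin> \<tau>"
    using down_closed_le[OF \<tau>(3) _ _ _ t0, of "c - s" "z - s"] z(2) \<open>z \<le> c\<close> tc by auto
  then have "bar (c - s) \<in> \<tau>" using self_dualD[OF \<tau>(2)] by blast
  then have "bar (c - s) - t \<in> \<tau>" using \<tau>(3) by (auto simp: down_closed_def)
  moreover have "bar (c - s) - t = c + s" using c by (simp add: bar_def)
  ultimately have cs: "c + s \<in> \<tau>" by simp
  show ?thesis
  proof (rule dual_class_shift[OF \<tau> cs, of "2 * s"])
    show "c + s - 2 * s \<notin> \<tau>" using ncs by simp
    show "2 * s > 0" using s_gt_1 by simp
    show "\<not> t dvd 2 * s" by (rule sw.not_s_dvd_2t[OF odd])
    have "bar (c + s) - (c + s - 2 * s) = t" using c by (simp add: bar_def)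
    then show "t dvd bar (c + s) - (c + s - 2 * s)" by simp
  qed simp
qed

text \<open>The first three cases are the possible coincidences among the runners of
  \<open>z\<close>, \<open>z - s\<close> and their mirror images; otherwise two disjoint pairs are
  swapped at once.\<close>

lemma lowering_shift:
  assumes \<tau>: "maya \<tau>" "self_dual \<tau>" "down_closed t \<tau>" and "\<not> down_closed s \<tau>"
  shows "\<exists>\<phi>. sym_shift s t \<phi> \<and> energy (\<phi> ` \<tau>) < energy \<tau>"
proof -
  interpret sw: coprime_pair t s by (rule swap)
  have t0: "t > 0" using t_gt_1 by simp
  obtain z where z: "z \<in> \<tau>" "z - s \<notin> \<tau>" using assms(4) by (auto simp: down_closed_def)
  have z': "bar (z - s) \<in> \<tau>" "bar (z - s) - s = bar z" "bar z \<notin> \<tau>"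
    using z self_dualD[OF \<tau>(2)] by (auto simp: bar_def)
  have nts: "\<not> t dvd s" by (rule sw.not_s_dvd_t)
  consider "t dvd bar z - (z - s)" | "t dvd z - bar z" | "t dvd (z - s) - bar (z - s)"
    | "\<not> t dvd bar z - (z - s)" "\<not> t dvd z - bar z" "\<not> t dvd (z - s) - bar (z - s)" by blast
  then show ?thesis
  proof cases
    case 1 show ?thesis by (rule dual_class_shift[OF \<tau> z _ dvd_refl nts 1]) (use s_gt_1 in simp)
  next
    case 2 show ?thesis by (rule self_dual_class_shift[OF \<tau> z 2])
  next
    case 3
    show ?thesis
      by (rule self_dual_class_shift[OF \<tau> z'(1)]) (use z' 3 in \<open>simp_all add: dvd_diff_commute\<close>)
  next
    case 4
    define P Q where "P = (\<lambda>b. t dvd b - z \<or> t dvd b - bar (z - s))" and "Q = (\<lambda>b. t dvd b - (z - s) \<or> t dvd b - bar z)"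
    define \<phi> where "\<phi> = (\<lambda>b. if P b then b - s else if Q b then b + s else b)"
    have sub: "t dvd x - y" if "t dvd b - y" "t dvd b - x" for b x y
      by (rule dvd_combine[OF that, of _ 1 "-1"]) simp
    have excl: "\<not> Q b" if "P b" for b
    proof
      assume "Q b"
      with that have "t dvd (z - s) - z \<or> t dvd (z - s) - bar (z - s) \<or> t dvd bar z - z \<or> t dvd bar z - bar (z - s)"
        unfolding P_def Q_def using sub by blast
      moreover have "(z - s) - z = - s" "bar z - bar (z - s) = - s" by (simp_all add: bar_def)
      ultimately show False using nts 4 by (auto simp: dvd_diff_commute)
    qed
    have PQ: "Q (b - s)" if "P b" for b
    proof -
      have "b - s - (z - s) = b - z" "b - s - bar z = b - bar (z - s)" by (simp_all add: bar_def)
      then show ?thesis using that unfolding P_def Q_def by metis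
    qed
    have QP: "P (b + s)" if "Q b" for b
    proof -
      have "b + s - z = b - (z - s)" "b + s - bar (z - s) = b - bar z" by (simp_all add: bar_def)
      then show ?thesis using that unfolding P_def Q_def by metis
    qed
    have ss: "sym_shift s t \<phi>" unfolding \<phi>_def
    proof (rule class_swap_sym_shift[OF dvd_refl])
      show "P (b + t) = P b" "Q (b + t) = Q b" for b unfolding P_def Q_def by (simp_all only: dvd_shift_iff)
      show "\<not> P (b - s)" if "P b" for b using excl PQ[OF that] by blast
      show "P (bar b) = Q b" for b
      proof -
        have "t dvd bar b - z \<longleftrightarrow> t dvd b - bar z" "t dvd bar b - bar (z - s) \<longleftrightarrow> t dvd b - (z - s)"
          using bar_dvd_diff[of t "bar b" z] bar_dvd_diff[of t b "z - s"] by auto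
        then show ?thesis unfolding P_def Q_def by blast
      qed
    qed (use excl PQ QP in auto)
    have "\<phi> b < b" if b: "b \<in> \<tau>" "\<phi> b \<notin> \<tau>" for b
    proof (cases "P b")
      case True then show ?thesis using s_gt_1 by (simp add: \<phi>_def)
    next
      case False
      then have Q: "Q b" "b + s \<notin> \<tau>" using b by (auto simp: \<phi>_def split: if_splits)
      then consider "t dvd b - (z - s)" | "t dvd b - bar z" unfolding Q_def by blast
      then show ?thesis
      proof cases
        case 1
        then have "t dvd (b + s) - z" by (simp add: algebra_simps)
        then have "z < b + s" by (rule not_core_mem_less[OF \<tau>(3) t0 z(1) Q(2)])
        moreover have "b < z - s"
          by (rule not_core_mem_less[OF \<tau>(3) t0 b(1) z(2)]) (use 1 in \<open>simp add: dvd_diff_commute\<close>)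
        ultimately show ?thesis by simp
      next
        case 2
        have e: "(b + s) - bar (z - s) = b - bar z" by (simp add: bar_def)
        have "bar (z - s) < b + s"
          by (rule not_core_mem_less[OF \<tau>(3) t0 z'(1) Q(2)]) (simp only: e 2)
        moreover have "b < bar z"
          by (rule not_core_mem_less[OF \<tau>(3) t0 b(1) z'(3)]) (use 2 in \<open>simp add: dvd_diff_commute\<close>)
        ultimately show ?thesis using z'(2) by simp
      qed
    qed
    moreover have "\<phi> z = z - s" by (simp add: \<phi>_def P_def)
    ultimately show ?thesis using ss sym_shift_energy_less[OF ss \<tau>(1)] z by metis
  qed
qed

text \<open>Lowering shifts are iterated. The target size changes each time, so the equivalence is
  quantified over \<open>n\<close> inside the induction.\<close>

lemma reduce_to_core:
  assumes "maya \<tau>" "self_dual \<tau>" "down_closed t \<tau>"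
  shows "\<exists>\<beta>. sym_core s t \<beta> \<and> same_charge s \<tau> \<beta> \<and>
    (\<forall>\<sigma> n. (\<exists>!B. solution s t \<sigma> \<tau> n B) \<longleftrightarrow> (\<exists>!B. solution s t \<sigma> \<beta> (n - energy \<tau> + energy \<beta>) B))"
  using assms
proof (induction "nat (energy \<tau>)" arbitrary: \<tau> rule: less_induct)
  case less
  show ?case
  proof (cases "down_closed s \<tau>")
    case True
    then show ?thesis using less.prems by (intro exI[of _ \<tau>]) (simp add: sym_core_def)
  next
    case False
    then obtain \<phi> where \<phi>: "sym_shift s t \<phi>" "energy (\<phi> ` \<tau>) < energy \<tau>"
      using lowering_shift[OF less.prems] by blast
    have inv: "\<And>b. \<phi> (\<phi> b) = b" and per: "\<And>b. \<phi> (b + t) = \<phi> b + t" and br: "\<And>b. \<phi> (bar b) = bar (\<phi> b)"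
      using \<phi>(1) by (auto simp: sym_shift_def)
    obtain M where M: "\<And>b. \<bar>\<phi> b - b\<bar> \<le> M" using \<phi>(1) by (auto simp: sym_shift_def)
    have bij: "bij \<phi>" by (rule o_bij[of \<phi>]) (auto simp: inv)
    have 1: "maya (\<phi> ` \<tau>)" by (rule bij_bounded_maya[OF less.prems(1) bij M])
    have 2: "self_dual (\<phi> ` \<tau>)" unfolding self_dual_def
      using self_dualD[OF less.prems(2)] by (simp add: involution_image_mem[OF inv] br)
    have per': "\<phi> (b - t) = \<phi> b - t" for b using per[of "b - t"] by simp
    have 3: "down_closed t (\<phi> ` \<tau>)"
      using less.prems(3) by (auto simp: down_closed_def involution_image_mem[OF inv] per' inv)
    have "nat (energy (\<phi> ` \<tau>)) < nat (energy \<tau>)" using \<phi>(2) energy_nonneg[of "\<phi> ` \<tau>"] by linarith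
    from less.hyps[OF this 1 2 3] obtain \<beta> where \<beta>: "sym_core s t \<beta>" "same_charge s (\<phi> ` \<tau>) \<beta>"
      "\<And>\<sigma> n. (\<exists>!B. solution s t \<sigma> (\<phi> ` \<tau>) n B) \<longleftrightarrow> (\<exists>!B. solution s t \<sigma> \<beta> (n - energy (\<phi> ` \<tau>) + energy \<beta>) B)"
      by blast
    have "(\<exists>!B. solution s t \<sigma> \<tau> n B) \<longleftrightarrow> (\<exists>!B. solution s t \<sigma> \<beta> (n - energy \<tau> + energy \<beta>) B)" for \<sigma> n
      unfolding sym_shift_unique_solution[OF \<phi>(1) less.prems(1)] \<beta>(3) by simp
    moreover have "same_charge s \<tau> \<beta>"
      using sym_shift_same_charge[OF \<phi>(1) less.prems(1)] \<beta>(2) same_charge_sym same_charge_trans by blast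
    ultimately show ?thesis using \<beta>(1) by blast
  qed
qed

end


section \<open>The largest (s,t)-core\<close>

text \<open>On each runner the differences telescope to the value at its top bead, and the vacuum
  has the tops \<open>-t\<close> to \<open>-1\<close>.\<close>

lemma wsum_telescope:
  assumes "maya C" "down_closed t C" "t > 0"
  shows "wsum (\<lambda>b. G b - G (b - t)) C = (\<Sum>b | b \<in> C \<and> b + t \<notin> C. G b) - (\<Sum>b\<in>{-t..<0}. G b)"
proof -
  obtain N where N: "N \<ge> 0" "\<And>b. b < -N \<Longrightarrow> b \<in> C" "\<And>b. b > N \<Longrightarrow> b \<notin> C"
    using maya_bound[OF assms(1)] by metis
  define f where "f = (\<lambda>b. of_bool (b \<in> C) - of_bool (b < 0) :: int)"
  have f0: "f b = 0" if "b < -N \<or> b > N" for b using that N by (auto simp: f_def)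
  let ?F = "{-N-t..N}"
  have sub: "{b. (b \<in> C) \<noteq> (b < 0)} \<subseteq> ?F"
  proof
    fix b assume "b \<in> {b. (b \<in> C) \<noteq> (b < 0)}"
    then have "f b \<noteq> 0" by (auto simp: f_def)
    then show "b \<in> ?F" using f0[of b] assms(3) by force
  qed
  have "wsum (\<lambda>b. G b - G (b - t)) C = (\<Sum>b\<in>?F. f b * (G b - G (b - t)))"
    unfolding f_def by (rule wsum_superset[OF _ sub]) simp
  also have "\<dots> = (\<Sum>b\<in>?F. f b * G b) - (\<Sum>b\<in>?F. f b * G (b - t))"
    by (simp add: algebra_simps sum_subtractf)
  also have "(\<Sum>b\<in>?F. f b * G (b - t)) = (\<Sum>b\<in>{-N-t-t..N-t}. f (b + t) * G b)"
    by (rule sum.reindex_bij_witness[of _ "\<lambda>b. b + t" "\<lambda>b. b - t"]) auto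
  also have "\<dots> = (\<Sum>b\<in>?F. f (b + t) * G b)"
    by (rule sum.mono_neutral_cong) (use f0 assms(3) in auto)
  also have "(\<Sum>b\<in>?F. f b * G b) - (\<Sum>b\<in>?F. f (b + t) * G b) = (\<Sum>b\<in>?F. (f b - f (b + t)) * G b)"
    by (simp add: algebra_simps sum_subtractf)
  also have "\<dots> = (\<Sum>b\<in>?F. of_bool (b \<in> C \<and> b + t \<notin> C) * G b) - (\<Sum>b\<in>?F. of_bool (b \<in> {-t..<0}) * G b)"
  proof -
    have "f b - f (b + t) = of_bool (b \<in> C \<and> b + t \<notin> C) - of_bool (b \<in> {-t..<0})" for b
    proof -
      have "b + t \<in> C \<Longrightarrow> b \<in> C" using assms(2) by (force simp: down_closed_def)
      then show ?thesis using assms(3) by (auto simp: f_def)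
    qed
    then show ?thesis by (simp add: left_diff_distrib sum_subtractf)
  qed
  also have "(\<Sum>b\<in>?F. of_bool (b \<in> C \<and> b + t \<notin> C) * G b) = (\<Sum>b | b \<in> C \<and> b + t \<notin> C. G b)"
  proof (rule sum.mono_neutral_cong_right)
    show "{b. b \<in> C \<and> b + t \<notin> C} \<subseteq> ?F"
    proof
      fix b assume b: "b \<in> {b. b \<in> C \<and> b + t \<notin> C}"
      then have "b \<le> N" using N(3)[of b] by force
      moreover have "b + t \<ge> -N" using N(2)[of "b + t"] b by force
      ultimately show "b \<in> ?F" by simp
    qed
  qed auto
  also have "(\<Sum>b\<in>?F. of_bool (b \<in> {-t..<0}) * G b) = (\<Sum>b\<in>{-t..<0}. G b)"
    by (rule sum.mono_neutral_cong_right) (use N(1) in auto)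
  finally show ?thesis .
qed

lemma sum_periodic_shift:
  fixes f :: "int \<Rightarrow> int"
  assumes "\<And>j. f (j + t) = f j" "t > 0" "i \<ge> 0"
  shows "(\<Sum>j\<in>{0..<t}. f (j + i)) = (\<Sum>j\<in>{0..<t}. f j)"
proof -
  have step: "(\<Sum>j\<in>{0..<t}. f (j + (int n + 1))) = (\<Sum>j\<in>{0..<t}. f (j + int n))" for n
  proof -
    have "(\<Sum>j\<in>{0..<t}. f (j + (int n + 1))) = (\<Sum>j\<in>{1..t}. f (j + int n))"
      by (rule sum.reindex_bij_witness[of _ "\<lambda>j. j - 1" "\<lambda>j. j + 1"]) (auto simp: algebra_simps)
    also have "{1..t} = insert t {1..<t}" using assms(2) by auto
    also have "(\<Sum>j\<in>insert t {1..<t}. f (j + int n)) = f (t + int n) + (\<Sum>j\<in>{1..<t}. f (j + int n))" by simp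
    also have "f (t + int n) = f (0 + int n)" using assms(1)[of "int n"] by (simp add: add.commute)
    also have "f (0 + int n) + (\<Sum>j\<in>{1..<t}. f (j + int n)) = (\<Sum>j\<in>insert 0 {1..<t}. f (j + int n))" by simp
    also have "insert 0 {1..<t} = {0..<t}" using assms(2) by auto
    finally show ?thesis .
  qed
  have "(\<Sum>j\<in>{0..<t}. f (j + int n)) = (\<Sum>j\<in>{0..<t}. f j)" for n
  proof (induction n)
    case (Suc n)
    then show ?case using step[of n] by (simp add: algebra_simps)
  qed simp
  from this[of "nat i"] show ?thesis using assms(3) by simp
qed

section \<open>Tops of t-runners and maximal energy\<close>

context coprime_pair
begin

text \<open>Runners modulo \<open>t\<close> are indexed by multiples of \<open>s\<close>: raising
  \<open>j\<close> by 1 is a step by \<open>s\<close>, and coprimality lets \<open>j\<close> run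
  through all runners.\<close>

definition row_top :: "int set \<Rightarrow> int \<Rightarrow> int" where
  "row_top C j = (SOME e. t dvd e - j * s \<and> e \<in> C \<and> e + t \<notin> C)"

lemma row_top:
  assumes "maya C"
  shows "t dvd row_top C j - j * s" "row_top C j \<in> C" "row_top C j + t \<notin> C"
proof -
  have "t > 0" using t_gt_1 by simp
  then have "\<exists>e. t dvd e - j * s \<and> e \<in> C \<and> e + t \<notin> C" using maya_ascend[OF assms] by metis
  from someI_ex[OF this, folded row_top_def]
  show "t dvd row_top C j - j * s" "row_top C j \<in> C" "row_top C j + t \<notin> C" by auto
qed

lemma row_top_ge:
  assumes "maya C" "down_closed t C" "x \<in> C" "t dvd x - j * s"
  shows "x \<le> row_top C j"
proof -
  have t0: "t > 0" using t_gt_1 by simp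
  have "t dvd (row_top C j + t) - x"
    using dvd_add[OF dvd_diff[OF row_top(1)[OF assms(1), of j] assms(4)] dvd_refl] by (simp add: algebra_simps)
  then have lt: "x < row_top C j + t" by (rule not_core_mem_less[OF assms(2) t0 assms(3) row_top(3)[OF assms(1)]])
  have "t dvd x - row_top C j" using dvd_diff[OF assms(4) row_top(1)[OF assms(1), of j]] by simp
  then show ?thesis using lt zdvd_imp_le[of t "x - row_top C j"] by fastforce
qed

lemma row_top_eqI:
  assumes "maya C" "down_closed t C" "x \<in> C" "x + t \<notin> C" "t dvd x - j * s"
  shows "row_top C j = x"
proof -
  have t0: "t > 0" using t_gt_1 by simp
  have "t dvd (x + t) - row_top C j"
    using dvd_add[OF dvd_diff[OF assms(5) row_top(1)[OF assms(1), of j]] dvd_refl] by (simp add: algebra_simps)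
  then have lt: "row_top C j < x + t" by (rule not_core_mem_less[OF assms(2) t0 row_top(2)[OF assms(1)] assms(4)])
  have "t dvd row_top C j - x" using dvd_diff[OF row_top(1)[OF assms(1), of j] assms(5)] by simp
  then have "\<not> row_top C j - x > 0" using lt zdvd_imp_le[of t "row_top C j - x"] by fastforce
  then show ?thesis using row_top_ge[OF assms(1-3,5)] by simp
qed

lemma row_top_periodic:
  assumes "maya C" "down_closed t C"
  shows "row_top C (j + t) = row_top C j"
proof (rule row_top_eqI[OF assms row_top(2,3)[OF assms(1)]])
  have "t dvd (row_top C j - j * s) - t * s" by (rule dvd_diff[OF row_top(1)[OF assms(1)] dvd_triv_left])
  then show "t dvd row_top C j - (j + t) * s" by (simp add: algebra_simps)
qed

lemma sum_row_top:
  assumes "maya C" "down_closed t C"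
  shows "(\<Sum>b | b \<in> C \<and> b + t \<notin> C. G b) = (\<Sum>j\<in>{0..<t}. G (row_top C j))"
proof -
  interpret sw: coprime_pair t s by (rule swap)
  have t0: "t > 0" using t_gt_1 by simp
  have "bij_betw (row_top C) {0..<t} {b. b \<in> C \<and> b + t \<notin> C}"
    unfolding bij_betw_def
  proof
    show "inj_on (row_top C) {0..<t}"
    proof (rule inj_onI)
      fix i j assume h: "i \<in> {0..<t}" "j \<in> {0..<t}" "row_top C i = row_top C j"
      have "t dvd (row_top C i - i * s) - (row_top C j - j * s)"
        by (rule dvd_diff[OF row_top(1)[OF assms(1)] row_top(1)[OF assms(1)]])
      then have "t dvd s * (j - i)" using h(3) by (simp add: algebra_simps)
      then have d: "t dvd j - i" using sw.s_dvd_t_mult by blast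
      then have "t dvd i - j" by (simp add: dvd_diff_commute)
      then show "i = j" using h(1,2) d zdvd_imp_le[of t "j - i"] zdvd_imp_le[of t "i - j"] by fastforce
    qed
    show "row_top C ` {0..<t} = {b. b \<in> C \<and> b + t \<notin> C}"
    proof (intro set_eqI iffI)
      fix b assume "b \<in> {b. b \<in> C \<and> b + t \<notin> C}"
      then have b: "b \<in> C" "b + t \<notin> C" by auto
      obtain i j where ij: "b = i * t + j * s" "0 \<le> j" "j < t" by (rule sw.semigroup_representation)
      then have "row_top C j = b" using b by (intro row_top_eqI[OF assms]) auto
      then show "b \<in> row_top C ` {0..<t}" using ij by force
    qed (use row_top[OF assms(1)] in auto)
  qed
  then show ?thesis by (rule sum.reindex_bij_betw[symmetric])
qed

lemma row_top_step:
  assumes C: "maya C" "down_closed s C" "down_closed t C" and "i \<ge> 0"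
  shows "row_top C (j + i) \<le> row_top C j + i * s"
proof -
  have "row_top C (j + i) - s * i \<in> C" by (rule down_closed_mult[OF C(2) row_top(2)[OF C(1)] assms(4)])
  moreover have "t dvd (row_top C (j + i) - s * i) - j * s"
    using row_top(1)[OF C(1), of "j + i"] by (simp add: algebra_simps)
  ultimately have "row_top C (j + i) - s * i \<le> row_top C j" by (rule row_top_ge[OF C(1,3)])
  then show ?thesis by (simp add: algebra_simps)
qed

text \<open>
  The differences of tops lie in \<open>[is - ts, is]\<close>, so each summand is nonnegative; summed over \<open>i\<close> it is, for
  fixed charge, a constant minus a multiple of the energy, and it vanishes exactly at the vertex given by \<open>kappa_set\<close>.
\<close>

definition spread :: "int set \<Rightarrow> int \<Rightarrow> int" where
  "spread C i = (\<Sum>j\<in>{0..<t}. (i * s - (row_top C (j + i) - row_top C j)) * ((row_top C (j + i) - row_top C j) - i * s + t * s))"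

text \<open>The second bound comes from going round the remaining \<open>t - i\<close> steps and
  using periodicity.\<close>

lemma spread_factors:
  assumes C: "maya C" "down_closed s C" "down_closed t C" and i: "0 \<le> i" "i \<le> t"
  shows "i * s - (row_top C (j + i) - row_top C j) \<ge> 0"
    "(row_top C (j + i) - row_top C j) - i * s + t * s \<ge> 0"
proof -
  show "i * s - (row_top C (j + i) - row_top C j) \<ge> 0" using row_top_step[OF C i(1), of j] by simp
  have "row_top C (j + i + (t - i)) \<le> row_top C (j + i) + (t - i) * s" by (rule row_top_step[OF C]) (use i in simp)
  then show "(row_top C (j + i) - row_top C j) - i * s + t * s \<ge> 0"
    using row_top_periodic[OF C(1,3), of j] by (simp add: algebra_simps)
qed

text \<open>After expansion the linear terms cancel by periodicity, and the products of tops, summed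
  over all shifts, give the square of the sum of tops.\<close>

lemma sum_spread:
  assumes C: "maya C" "down_closed t C"
  shows "(\<Sum>i\<in>{0..<t}. spread C i) = (\<Sum>i\<in>{0..<t}. t * (i * s * (t * s - i * s)))
    - 2 * t * (\<Sum>j\<in>{0..<t}. row_top C j * row_top C j) + 2 * (\<Sum>j\<in>{0..<t}. row_top C j) * (\<Sum>j\<in>{0..<t}. row_top C j)"
proof -
  have t0: "t > 0" using t_gt_1 by simp
  let ?T = "row_top C"
  let ?S = "\<Sum>j\<in>{0..<t}. ?T j" and ?Q = "\<Sum>j\<in>{0..<t}. ?T j * ?T j"
  have per: "?T (j + t) = ?T j" for j by (rule row_top_periodic[OF C])
  have sp: "spread C i = t * (i * s * (t * s - i * s)) - 2 * ?Q + 2 * (\<Sum>j\<in>{0..<t}. ?T (j + i) * ?T j)"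
    if "i \<in> {0..<t}" for i
  proof -
    have i: "i \<ge> 0" using that by simp
    have s1: "(\<Sum>j\<in>{0..<t}. ?T (j + i)) = ?S" by (rule sum_periodic_shift[of ?T, OF per t0 i])
    have s2: "(\<Sum>j\<in>{0..<t}. ?T (j + i) * ?T (j + i)) = ?Q"
      by (rule sum_periodic_shift[OF _ t0 i, of "\<lambda>j. ?T j * ?T j"]) (simp add: per)
    have "spread C i = (\<Sum>j\<in>{0..<t}. i * s * (t * s - i * s) + (2 * i * s - t * s) * (?T (j + i) - ?T j)
        - ?T (j + i) * ?T (j + i) - ?T j * ?T j + 2 * (?T (j + i) * ?T j))"
      unfolding spread_def by (rule sum.cong) (auto simp: algebra_simps)
    also have "\<dots> = (\<Sum>j\<in>{0..<t}. i * s * (t * s - i * s)) + (2 * i * s - t * s) * ((\<Sum>j\<in>{0..<t}. ?T (j + i)) - ?S)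
        - (\<Sum>j\<in>{0..<t}. ?T (j + i) * ?T (j + i)) - ?Q + 2 * (\<Sum>j\<in>{0..<t}. ?T (j + i) * ?T j)"
      by (simp add: sum.distrib sum_subtractf sum_distrib_left right_diff_distrib)
    also have "\<dots> = t * (i * s * (t * s - i * s)) - 2 * ?Q + 2 * (\<Sum>j\<in>{0..<t}. ?T (j + i) * ?T j)"
      unfolding s1 s2 using t0 by simp
    finally show ?thesis .
  qed
  have "(\<Sum>i\<in>{0..<t}. \<Sum>j\<in>{0..<t}. ?T (j + i) * ?T j) = (\<Sum>j\<in>{0..<t}. \<Sum>i\<in>{0..<t}. ?T (i + j) * ?T j)"
    by (subst sum.swap) (simp add: add.commute)
  also have "\<dots> = (\<Sum>j\<in>{0..<t}. ?S * ?T j)"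
  proof (rule sum.cong[OF refl])
    fix j assume "j \<in> {0..<t}"
    then have "(\<Sum>i\<in>{0..<t}. ?T (i + j)) = ?S" by (intro sum_periodic_shift[of ?T, OF per t0]) simp
    then show "(\<Sum>i\<in>{0..<t}. ?T (i + j) * ?T j) = ?S * ?T j" by (metis sum_distrib_right)
  qed
  also have "\<dots> = ?S * ?S" by (simp add: sum_distrib_left)
  finally have cross: "(\<Sum>i\<in>{0..<t}. \<Sum>j\<in>{0..<t}. ?T (j + i) * ?T j) = ?S * ?S" .
  have "(\<Sum>i\<in>{0..<t}. spread C i) = (\<Sum>i\<in>{0..<t}. t * (i * s * (t * s - i * s)) - 2 * ?Q + 2 * (\<Sum>j\<in>{0..<t}. ?T (j + i) * ?T j))"
    by (rule sum.cong) (auto simp: sp)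
  also have "\<dots> = (\<Sum>i\<in>{0..<t}. t * (i * s * (t * s - i * s))) - (\<Sum>i\<in>{0..<t}. 2 * ?Q) + 2 * (\<Sum>i\<in>{0..<t}. \<Sum>j\<in>{0..<t}. ?T (j + i) * ?T j)"
    by (simp only: sum.distrib sum_subtractf sum_distrib_left)
  also have "(\<Sum>i\<in>{0..<t}. 2 * ?Q) = 2 * t * ?Q" using t0 by simp
  finally show ?thesis unfolding cross by simp
qed

text \<open>Zero charge fixes the sum of the tops, and the energy determines the sum of their
  squares, so nothing else can vary in \<open>sum_spread\<close>.\<close>

lemma energy_spread:
  assumes C: "maya C" "down_closed t C" "wsum (\<lambda>_. 1) C = 0" and D: "maya D" "down_closed t D" "wsum (\<lambda>_. 1) D = 0"
  shows "(\<Sum>i\<in>{0..<t}. spread C i) - (\<Sum>i\<in>{0..<t}. spread D i) = 4 * t * t * (energy D - energy C)"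
    "(\<Sum>j\<in>{0..<t}. row_top C j) = (\<Sum>j\<in>{0..<t}. row_top D j)"
proof -
  have t0: "t > 0" using t_gt_1 by simp
  have scale: "wsum (\<lambda>b. k * w b) X = k * wsum w X" for k w X
    by (simp add: wsum_def sum_distrib_left algebra_simps)
  have S: "(\<Sum>j\<in>{0..<t}. row_top X j) = (\<Sum>b\<in>{-t..<0}. b)" if X: "maya X" "down_closed t X" "wsum (\<lambda>_. 1) X = 0" for X
  proof -
    have "wsum (\<lambda>b. b - (b - t)) X = (\<Sum>j\<in>{0..<t}. row_top X j) - (\<Sum>b\<in>{-t..<0}. b)"
      using wsum_telescope[OF X(1,2) t0, of "\<lambda>b. b"] sum_row_top[OF X(1,2), of "\<lambda>b. b"] by simp
    then show ?thesis using scale[of t "\<lambda>_. 1" X] X(3) by simp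
  qed
  have Q: "2 * t * energy X = (\<Sum>j\<in>{0..<t}. row_top X j * row_top X j) + t * (\<Sum>j\<in>{0..<t}. row_top X j) - (\<Sum>b\<in>{-t..<0}. b * b + t * b)"
    if X: "maya X" "down_closed t X" for X
  proof -
    \<comment> \<open>The quadratic is chosen so that its \<open>t\<close>-difference is linear
      without constant term.\<close>
    have "(\<lambda>b. (b * b + t * b) - ((b - t) * (b - t) + t * (b - t))) = (\<lambda>b. (2 * t) * b)" by (auto simp: algebra_simps)
    then have "2 * t * energy X = (\<Sum>j\<in>{0..<t}. row_top X j * row_top X j + t * row_top X j) - (\<Sum>b\<in>{-t..<0}. b * b + t * b)"
      using wsum_telescope[OF X t0, of "\<lambda>b. b * b + t * b"] sum_row_top[OF X, of "\<lambda>b. b * b + t * b"] scale[of "2 * t" "\<lambda>b. b" X]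
      unfolding energy_def by simp
    then show ?thesis by (simp add: sum.distrib sum_distrib_left)
  qed
  show "(\<Sum>j\<in>{0..<t}. row_top C j) = (\<Sum>j\<in>{0..<t}. row_top D j)" using S[OF C] S[OF D] by simp
  then have "(\<Sum>j\<in>{0..<t}. row_top D j * row_top D j) - (\<Sum>j\<in>{0..<t}. row_top C j * row_top C j) = 2 * t * (energy D - energy C)"
    using Q[OF C(1,2)] Q[OF D(1,2)] by (simp add: algebra_simps)
  then have "2 * t * ((\<Sum>j\<in>{0..<t}. row_top D j * row_top D j) - (\<Sum>j\<in>{0..<t}. row_top C j * row_top C j)) = 4 * t * t * (energy D - energy C)"
    by simp
  moreover have "(\<Sum>i\<in>{0..<t}. spread C i) - (\<Sum>i\<in>{0..<t}. spread D i) =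
    2 * t * ((\<Sum>j\<in>{0..<t}. row_top D j * row_top D j) - (\<Sum>j\<in>{0..<t}. row_top C j * row_top C j))"
    unfolding sum_spread[OF C(1,2)] sum_spread[OF D(1,2)] \<open>(\<Sum>j\<in>{0..<t}. row_top C j) = _\<close> by (simp add: algebra_simps)
  ultimately show "(\<Sum>i\<in>{0..<t}. spread C i) - (\<Sum>i\<in>{0..<t}. spread D i) = 4 * t * t * (energy D - energy C)" by simp
qed

lemma kappa_row_top:
  obtains m where "row_top (kappa_set s t) j = (s * t - s - t - 1) div 2 - m * s" "0 \<le> m" "m < t"
proof -
  let ?K = "kappa_set s t" and ?h = "(s * t - s - t - 1) div 2"
  note rt = row_top[OF kappa_set_maya, of j]
  obtain m k where mk: "m \<ge> 0" "k \<ge> 0" "?h - row_top ?K j = m * s + k * t"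
    using rt(2) unfolding kappa_set_def semigroup2_def by auto
  have k0: "k = 0"
  proof (rule ccontr)
    assume "k \<noteq> 0"
    then have "k - 1 \<ge> 0" using mk(2) by simp
    moreover have "?h - (row_top ?K j + t) = m * s + (k - 1) * t" using mk(3) by (simp add: algebra_simps)
    ultimately have "row_top ?K j + t \<in> ?K" unfolding kappa_set_def semigroup2_def using mk(1) by blast
    then show False using rt(3) by simp
  qed
  have "m < t"
  proof (rule ccontr)
    assume "\<not> m < t"
    then have "m - t \<ge> 0" by simp
    moreover have "?h - (row_top ?K j + t) = (m - t) * s + (s - 1) * t" using mk(3) k0 by (simp add: algebra_simps)
    moreover have "s - 1 \<ge> 0" using s_gt_1 by simp
    ultimately have "row_top ?K j + t \<in> ?K" unfolding kappa_set_def semigroup2_def by blast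
    then show False using rt(3) by simp
  qed
  then show thesis using that[of m] mk k0 by simp
qed

text \<open>The tops of the cone lie on its edge \<open>?h - m * s\<close> with \<open>m\<close>
  below \<open>t\<close>, so their differences only take the two values at which a factor
  vanishes.\<close>

lemma kappa_spread:
  assumes "i \<in> {0..<t}"
  shows "spread (kappa_set s t) i = 0"
  unfolding spread_def
proof (rule sum.neutral, rule ballI)
  interpret sw: coprime_pair t s by (rule swap)
  fix j assume "j \<in> {0..<t}"
  let ?T = "row_top (kappa_set s t)" and ?h = "(s * t - s - t - 1) div 2"
  obtain m where m: "?T j = ?h - m * s" "0 \<le> m" "m < t" by (rule kappa_row_top)
  obtain m' where m': "?T (j + i) = ?h - m' * s" "0 \<le> m'" "m' < t" by (rule kappa_row_top)
  have "t dvd (?T (j + i) - (j + i) * s) - (?T j - j * s)"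
    by (rule dvd_diff[OF row_top(1)[OF kappa_set_maya] row_top(1)[OF kappa_set_maya]])
  then have "t dvd s * (m - m' - i)" unfolding m(1) m'(1) by (simp add: algebra_simps)
  then have "t dvd m - m' - i" using sw.s_dvd_t_mult by blast
  then obtain k where k: "m - m' - i = t * k" by blast
  have t0: "t > 0" using t_gt_1 by simp
  have i: "0 \<le> i" "i < t" using assms by auto
  have "k < 1"
  proof (rule ccontr)
    assume "\<not> k < 1"
    then have "t \<le> t * k" using t0 by simp
    then show False using k m(2,3) m'(2,3) i by linarith
  qed
  moreover have "k > -2"
  proof (rule ccontr)
    assume "\<not> k > -2"
    then have "t * k \<le> t * (-2)" using t0 by (intro mult_left_mono) auto
    then show False using k m(2,3) m'(2,3) i by linarith
  qed
  ultimately have "k = 0 \<or> k = -1" by auto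
  then have "m - m' = i \<or> m - m' = i - t" using k by auto
  moreover have "?T (j + i) - ?T j = (m - m') * s" unfolding m(1) m'(1) by (simp add: algebra_simps)
  ultimately have "?T (j + i) - ?T j = i * s \<or> ?T (j + i) - ?T j = (i - t) * s" by auto
  then show "(i * s - (?T (j + i) - ?T j)) * ((?T (j + i) - ?T j) - i * s + t * s) = 0"
  proof (elim disjE)
    assume e: "?T (j + i) - ?T j = (i - t) * s"
    show ?thesis unfolding e by (simp add: algebra_simps)
  qed simp
qed

theorem kappa_set_maximal:
  assumes C: "maya C" "down_closed s C" "down_closed t C" "wsum (\<lambda>_. 1) C = 0"
  shows "energy C \<le> energy (kappa_set s t)" "energy C = energy (kappa_set s t) \<Longrightarrow> C = kappa_set s t"
proof -
  let ?K = "kappa_set s t"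
  have t0: "t > 0" using t_gt_1 by simp
  have K: "maya ?K" "down_closed t ?K" "wsum (\<lambda>_. 1) ?K = 0"
    using kappa_set_maya kappa_set_closed self_dual_charge[OF kappa_set_self_dual] by auto
  have tm: "(i * s - (row_top C (j + i) - row_top C j)) * ((row_top C (j + i) - row_top C j) - i * s + t * s) \<ge> 0"
    if "i \<in> {0..<t}" for i j
    by (rule mult_nonneg_nonneg; rule spread_factors[OF C(1-3)]) (use that in auto)
  then have pos: "spread C i \<ge> 0" if "i \<in> {0..<t}" for i unfolding spread_def using that by (intro sum_nonneg) auto
  have eq: "(\<Sum>i\<in>{0..<t}. spread C i) = 4 * t * t * (energy ?K - energy C)"
    using energy_spread(1)[OF C(1,3,4) K] kappa_spread by simp
  moreover have "(\<Sum>i\<in>{0..<t}. spread C i) \<ge> 0" using pos by (intro sum_nonneg) auto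
  ultimately have "4 * t * t * (energy ?K - energy C) \<ge> 0" by simp
  then show "energy C \<le> energy ?K"
    using mult_pos_neg[of "4 * t * t" "energy ?K - energy C"] t0 by fastforce
  assume "energy C = energy ?K"
  then have "(\<Sum>i\<in>{0..<t}. spread C i) = 0" using eq by simp
  \<comment> \<open>The shift by 1 suffices: consecutive tops then differ by \<open>s\<close> or
    \<open>s * (1 - t)\<close>, so all are congruent modulo \<open>s\<close> and the cone criterion
    applies.\<close>
  then have "spread C 1 = 0" using pos t_gt_1 by (subst (asm) sum_nonneg_eq_0_iff) auto
  then have z: "(1 * s - (row_top C (j + 1) - row_top C j)) * ((row_top C (j + 1) - row_top C j) - 1 * s + t * s) = 0"
    if "j \<in> {0..<t}" for j
    using that tm[of 1] t_gt_1 unfolding spread_def by (subst (asm) sum_nonneg_eq_0_iff) auto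
  have "s dvd row_top C (j + 1) - row_top C j" if "j \<in> {0..<t}" for j
  proof -
    have "row_top C (j + 1) - row_top C j = s \<or> row_top C (j + 1) - row_top C j = s * (1 - t)"
      using z[OF that] unfolding mult_eq_0_iff by (auto simp: algebra_simps)
    then show ?thesis by auto
  qed
  then have "s dvd row_top C (int n) - row_top C 0" if "int n < t" for n
    using that
  proof (induction n)
    case (Suc n)
    then have "s dvd (row_top C (int n + 1) - row_top C (int n)) + (row_top C (int n) - row_top C 0)"
      by (intro dvd_add) auto
    then show ?case by (simp add: algebra_simps)
  qed simp
  then have d0: "s dvd row_top C j - row_top C 0" if "j \<in> {0..<t}" for j
    using that by (metis atLeastLessThan_iff nonneg_int_cases)
  have "s dvd x - y" if xy: "x \<in> C" "x + t \<notin> C" "y \<in> C" "y + t \<notin> C" for x y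
  proof -
    interpret sw: coprime_pair t s by (rule swap)
    have "s dvd w - row_top C 0" if w: "w \<in> C" "w + t \<notin> C" for w
    proof -
      obtain i j where ij: "w = i * t + j * s" "0 \<le> j" "j < t" by (rule sw.semigroup_representation)
      then have "row_top C j = w" using w by (intro row_top_eqI[OF C(1,3)]) auto
      then show ?thesis using d0[of j] ij by simp
    qed
    then have "s dvd (x - row_top C 0) - (y - row_top C 0)" using xy dvd_diff by blast
    then show ?thesis by simp
  qed
  then obtain h where h: "C = {b. semigroup2 s t (h - b)}"
    using cone_if_tops_congruent[OF C(1-3)] by metis
  \<comment> \<open>Zero charge fixes the apex, since translating the cone by \<open>d\<close>
    changes the sum of the tops by \<open>d * t\<close>.\<close>
  define d where "d = h - (s * t - s - t - 1) div 2"
  have mem: "b \<in> C \<longleftrightarrow> b - d \<in> ?K" for b unfolding h kappa_set_def d_def by (simp add: algebra_simps)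
  let ?tops = "\<lambda>X. {b. b \<in> X \<and> b + t \<notin> X}"
  have "(\<Sum>b\<in>?tops C. b) = (\<Sum>b\<in>?tops ?K. b + d)"
    by (rule sum.reindex_bij_witness[of _ "\<lambda>b. b + d" "\<lambda>b. b - d"]) (auto simp: mem algebra_simps)
  also have "\<dots> = (\<Sum>b\<in>?tops ?K. b) + d * (\<Sum>b\<in>?tops ?K. 1)" by (simp add: sum.distrib)
  also have "(\<Sum>b\<in>?tops ?K. 1) = t" using sum_row_top[OF K(1,2), of "\<lambda>_. 1 :: int"] t0 by simp
  finally have "(\<Sum>j\<in>{0..<t}. row_top C j) = (\<Sum>j\<in>{0..<t}. row_top ?K j) + d * t"
    using sum_row_top[OF K(1,2), of "\<lambda>b. b"] sum_row_top[OF C(1,3), of "\<lambda>b. b"] by simp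
  then have "d = 0" using energy_spread(2)[OF C(1,3,4) K] t0 by simp
  then show "C = ?K" using mem by auto
qed

end


section \<open>Partitions and beta-sets\<close>

definition bead :: "(nat \<Rightarrow> nat) \<Rightarrow> nat \<Rightarrow> int" where
  "bead \<nu> r = int (\<nu> r) - (int r + 1)"

lemma beta_set_bead: "beta_set \<nu> = range (bead \<nu>)"
  unfolding beta_set_def bead_def by blast

lemma partition_antimono: "is_partition \<nu> \<Longrightarrow> r \<le> q \<Longrightarrow> \<nu> q \<le> \<nu> r"
  by (simp add: is_partition_def antimonoD)

lemma partition_zero:
  assumes "is_partition \<nu>"
  obtains N where "\<And>r. r \<ge> N \<Longrightarrow> \<nu> r = 0"
proof -
  have "finite {r. \<nu> r \<noteq> 0}" using assms by (simp add: is_partition_def)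
  then obtain N where "\<forall>r\<in>{r. \<nu> r \<noteq> 0}. r < N" using finite_nat_set_iff_bounded by blast
  then show thesis using that[of N] by force
qed

lemma bead_less: "is_partition \<nu> \<Longrightarrow> r < q \<Longrightarrow> bead \<nu> q < bead \<nu> r"
  using partition_antimono[of \<nu> r q] by (simp add: bead_def)

lemma bead_inj: "is_partition \<nu> \<Longrightarrow> bead \<nu> r = bead \<nu> q \<longleftrightarrow> r = q"
  using bead_less[of \<nu> r q] bead_less[of \<nu> q r] by (metis less_irrefl linorder_neqE_nat)

lemma beta_set_split:
  assumes "\<And>r. r \<ge> N \<Longrightarrow> \<nu> r = 0"
  shows "b \<in> beta_set \<nu> \<longleftrightarrow> b \<in> bead \<nu> ` {..<N} \<or> b < - int N"
proof
  assume "b \<in> beta_set \<nu>"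
  then obtain r where r: "b = bead \<nu> r" by (auto simp: beta_set_bead)
  show "b \<in> bead \<nu> ` {..<N} \<or> b < - int N"
    using r assms[of r] by (cases "r < N") (auto simp: bead_def)
next
  assume "b \<in> bead \<nu> ` {..<N} \<or> b < - int N"
  then show "b \<in> beta_set \<nu>"
  proof
    assume "b < - int N"
    then have "b = bead \<nu> (nat (- b - 1))" using assms[of "nat (- b - 1)"] by (simp add: bead_def)
    then show ?thesis by (auto simp: beta_set_bead)
  qed (auto simp: beta_set_bead)
qed

lemma wsum_beta_set:
  assumes "is_partition \<nu>" "\<And>r. r \<ge> N \<Longrightarrow> \<nu> r = 0"
  shows "maya (beta_set \<nu>)" "wsum w (beta_set \<nu>) = (\<Sum>r<N. w (bead \<nu> r)) - (\<Sum>r<N. w (- int r - 1))"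
proof -
  let ?B = "beta_set \<nu>"
  let ?I = "bead \<nu> ` {..<N}" and ?J = "(\<lambda>r. - int r - 1) ` {..<N}"
  note split = beta_set_split[of N \<nu>, OF assms(2)]
  have I_ge: "b \<ge> - int N" if "b \<in> ?I" for b using that by (auto simp: bead_def)
  have J: "b \<in> ?J \<longleftrightarrow> - int N \<le> b \<and> b < 0" for b
  proof
    assume "- int N \<le> b \<and> b < 0"
    then show "b \<in> ?J" by (intro image_eqI[of _ _ "nat (- b - 1)"]) auto
  qed auto
  have sub: "{b. (b \<in> ?B) \<noteq> (b < 0)} \<subseteq> ?I \<union> ?J"
  proof
    fix b assume b: "b \<in> {b. (b \<in> ?B) \<noteq> (b < 0)}"
    show "b \<in> ?I \<union> ?J"
    proof (cases "b < 0")
      case True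
      then have "b \<notin> ?B" using b by simp
      then have "\<not> b < - int N" using split by blast
      then show ?thesis using True J by simp
    next
      case False
      then have "b \<in> ?B" using b by simp
      then show ?thesis using split[of b] False by auto
    qed
  qed
  show "maya ?B" unfolding maya_def by (rule finite_subset[OF sub]) simp
  have "wsum w ?B = (\<Sum>b\<in>?I \<union> ?J. (of_bool (b \<in> ?B) - of_bool (b < 0)) * w b)"
    by (rule wsum_superset[OF _ sub]) simp
  also have "\<dots> = (\<Sum>b\<in>?I \<union> ?J. of_bool (b \<in> ?I) * w b) - (\<Sum>b\<in>?I \<union> ?J. of_bool (b \<in> ?J) * w b)"
    unfolding sum_subtractf[symmetric]
  proof (rule sum.cong[OF refl])
    fix b assume b: "b \<in> ?I \<union> ?J"
    then have "b \<ge> - int N" using I_ge J by blast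
    then have "b \<in> ?B \<longleftrightarrow> b \<in> ?I" "b < 0 \<longleftrightarrow> b \<in> ?J" using split[of b] J[of b] by auto
    then show "(of_bool (b \<in> ?B) - of_bool (b < 0)) * w b = of_bool (b \<in> ?I) * w b - of_bool (b \<in> ?J) * w b"
      by (simp only: left_diff_distrib)
  qed
  also have "(\<Sum>b\<in>?I \<union> ?J. of_bool (b \<in> ?I) * w b) = (\<Sum>b\<in>?I. w b)"
    by (rule sum.mono_neutral_cong_right) auto
  also have "(\<Sum>b\<in>?I \<union> ?J. of_bool (b \<in> ?J) * w b) = (\<Sum>b\<in>?J. w b)"
    by (rule sum.mono_neutral_cong_right) auto
  also have "(\<Sum>b\<in>?I. w b) = (\<Sum>r<N. w (bead \<nu> r))"
    by (subst sum.reindex) (auto simp: inj_on_def bead_inj[OF assms(1)])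
  also have "(\<Sum>b\<in>?J. w b) = (\<Sum>r<N. w (- int r - 1))"
    by (subst sum.reindex) (auto simp: inj_on_def)
  finally show "wsum w ?B = (\<Sum>r<N. w (bead \<nu> r)) - (\<Sum>r<N. w (- int r - 1))" .
qed

lemma maya_beta_set: "is_partition \<nu> \<Longrightarrow> maya (beta_set \<nu>)"
  using wsum_beta_set(1) partition_zero by metis

lemma charge_beta_set:
  assumes "is_partition \<nu>"
  shows "wsum (\<lambda>_. 1) (beta_set \<nu>) = 0"
proof -
  obtain N where "\<And>r. r \<ge> N \<Longrightarrow> \<nu> r = 0" using partition_zero[OF assms] by metis
  from wsum_beta_set(2)[OF assms this, where w = "\<lambda>_. 1"] show ?thesis by simp
qed

lemma psize_sum:
  assumes "\<And>r. r \<ge> N \<Longrightarrow> \<nu> r = 0"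
  shows "psize \<nu> = (\<Sum>r<N. \<nu> r)"
  unfolding psize_def
proof (rule sum.mono_neutral_left)
  show "{r. \<nu> r \<noteq> 0} \<subseteq> {..<N}" using assms by (metis (mono_tags, lifting) lessThan_iff mem_Collect_eq not_le subsetI)
qed auto

lemma energy_beta_set:
  assumes "is_partition \<nu>"
  shows "energy (beta_set \<nu>) = int (psize \<nu>)"
proof -
  obtain N where N: "\<And>r. r \<ge> N \<Longrightarrow> \<nu> r = 0" using partition_zero[OF assms] by metis
  have "energy (beta_set \<nu>) = (\<Sum>r<N. bead \<nu> r) - (\<Sum>r<N. - int r - 1)"
    unfolding energy_def by (rule wsum_beta_set(2)[OF assms N])
  also have "\<dots> = (\<Sum>r<N. int (\<nu> r))" unfolding sum_subtractf[symmetric] by (rule sum.cong) (auto simp: bead_def)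
  finally show ?thesis using psize_sum[OF N] by simp
qed

lemma beta_set_inject:
  assumes "is_partition \<nu>" "is_partition \<mu>" "beta_set \<nu> = beta_set \<mu>"
  shows "\<nu> = \<mu>"
proof -
  have le: "bead x r \<le> bead y r"
    if xy: "is_partition x" "is_partition y" "beta_set x = beta_set y" "\<And>q. q < r \<Longrightarrow> bead x q = bead y q" for x y r
  proof -
    obtain q where q: "bead x r = bead y q" using xy(3) by (auto simp: beta_set_bead)
    have "\<not> q < r" using q xy(4) bead_inj[OF xy(1), of r q] by (metis less_irrefl)
    then show ?thesis using q bead_less[OF xy(2), of r q] by (cases "q = r") auto
  qed
  have eq: "bead \<nu> r = bead \<mu> r" for r
  proof (induction r rule: less_induct)
    case (less r)
    then show ?case using le[OF assms(1,2,3), of r] le[OF assms(2,1) assms(3)[symmetric], of r] by force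
  qed
  have "\<nu> r = \<mu> r" for r using eq[of r] by (simp add: bead_def)
  then show ?thesis by (rule ext)
qed

lemma partition_upd:
  assumes "is_partition \<mu>" "bead \<mu> r + 1 \<notin> beta_set \<mu>"
  shows "is_partition (\<mu>(r := \<mu> r + 1))"
    "beta_set (\<mu>(r := \<mu> r + 1)) = insert (bead \<mu> r + 1) (beta_set \<mu> - {bead \<mu> r})"
proof -
  let ?\<nu> = "\<mu>(r := \<mu> r + 1)"
  have step: "\<mu> r + 1 \<le> \<mu> q" if "q < r" for q
  proof -
    have "bead \<mu> q > bead \<mu> (r - 1) \<or> q = r - 1" using that bead_less[OF assms(1), of q "r - 1"] by linarith
    moreover have "bead \<mu> (r - 1) \<noteq> bead \<mu> r + 1" using assms(2) unfolding beta_set_bead by (metis rangeI)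
    then have "\<mu> (r - 1) \<ge> \<mu> r + 1"
      using that partition_antimono[OF assms(1), of "r - 1" r] by (cases "\<mu> (r - 1) = \<mu> r") (auto simp: bead_def)
    moreover have "\<mu> q \<ge> \<mu> (r - 1)" using that by (intro partition_antimono[OF assms(1)]) simp
    ultimately show ?thesis by simp
  qed
  have "antimono ?\<nu>"
    unfolding monotone_def using partition_antimono[OF assms(1)] step by (auto simp: le_Suc_eq)
  moreover have "finite {q. ?\<nu> q \<noteq> 0}"
    by (rule finite_subset[of _ "insert r {q. \<mu> q \<noteq> 0}"]) (use assms(1) in \<open>auto simp: is_partition_def\<close>)
  ultimately show "is_partition ?\<nu>" by (simp add: is_partition_def)
  have "bead ?\<nu> = (\<lambda>q. if q = r then bead \<mu> r + 1 else bead \<mu> q)" by (auto simp: bead_def)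
  then have "beta_set ?\<nu> = range (\<lambda>q. if q = r then bead \<mu> r + 1 else bead \<mu> q)" by (simp only: beta_set_bead)
  also have "\<dots> = insert (bead \<mu> r + 1) (beta_set \<mu> - {bead \<mu> r})"
    unfolding beta_set_bead by (auto simp: bead_inj[OF assms(1)])
  finally show "beta_set ?\<nu> = insert (bead \<mu> r + 1) (beta_set \<mu> - {bead \<mu> r})" .
qed

text \<open>A 1-core of charge zero is the vacuum, the beta-set of the empty partition; otherwise
  some bead is lowered by one and the corresponding node is added back.\<close>

lemma beta_set_surj:
  assumes "maya B" "wsum (\<lambda>_. 1) B = 0"
  shows "\<exists>\<nu>. is_partition \<nu> \<and> beta_set \<nu> = B"
  using assms
proof (induction "nat (energy B)" arbitrary: B rule: less_induct)
  case less
  show ?case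
  proof (cases "down_closed 1 B")
    case True
    let ?z = "\<lambda>_::nat. 0::nat"
    have z: "is_partition ?z" by (simp add: is_partition_def monotone_def)
    have bz: "b \<in> beta_set ?z \<longleftrightarrow> b < 0" for b using beta_set_split[of 0 ?z b] by simp
    have "same_charge 1 B (beta_set ?z)" unfolding same_charge_def
    proof (intro allI impI)
      fix g :: "int \<Rightarrow> int" assume g: "\<forall>b. g (b + 1) = g b"
      have gc: "g = (\<lambda>_. g 0)" using periodic_cong[OF g, of _ 0] by (intro ext) simp
      have "wsum g X = g 0 * wsum (\<lambda>_. 1) X" for X
        by (subst gc) (simp add: wsum_def sum_distrib_left mult.commute)
      then show "wsum g B = wsum g (beta_set ?z)" using less.prems(2) charge_beta_set[OF z] by simp
    qed
    then have "B = beta_set ?z"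
      using core_unique[OF less.prems(1) maya_beta_set[OF z] True] by (simp add: down_closed_def bz)
    then show ?thesis using z by blast
  next
    case False
    then obtain z where z: "z \<in> B" "z - 1 \<notin> B" by (auto simp: down_closed_def)
    define B' where "B' = insert (z - 1) (B - {z})"
    have B': "maya B'" "energy B' = energy B - 1" "wsum (\<lambda>_. 1) B' = 0"
      unfolding B'_def using maya_exchange[OF less.prems(1)] energy_exchange[OF less.prems(1) z]
        wsum_exchange[OF less.prems(1) z, of "\<lambda>_. 1"] less.prems(2) by auto
    have "nat (energy B') < nat (energy B)" using B'(2) energy_nonneg[of B'] by linarith
    from less.hyps[OF this B'(1,3)] obtain \<mu> where \<mu>: "is_partition \<mu>" "beta_set \<mu> = B'" by blast
    have "z - 1 \<in> beta_set \<mu>" using \<mu>(2) by (simp add: B'_def)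
    then obtain r where r: "z - 1 = bead \<mu> r" by (auto simp: beta_set_bead)
    then have zr: "bead \<mu> r + 1 = z" by simp
    have "bead \<mu> r + 1 \<notin> beta_set \<mu>" unfolding zr \<mu>(2) B'_def by simp
    note up = partition_upd[OF \<mu>(1) this]
    have "insert z (B' - {z - 1}) = B" unfolding B'_def using exchange_back[OF z] by simp
    then have "beta_set (\<mu>(r := \<mu> r + 1)) = B" using up(2) unfolding zr \<mu>(2) r[symmetric] by simp
    then show ?thesis using up(1) by blast
  qed
qed

section \<open>Conjugation on beta-sets\<close>

definition dual_set :: "int set \<Rightarrow> int set" where
  "dual_set B = {b. bar b \<notin> B}"

lemma dual_set_self_dual: "self_dual B \<longleftrightarrow> dual_set B = B"
  unfolding self_dual_def dual_set_def by blast

lemma wsum_dual_set: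
  assumes "maya B"
  shows "maya (dual_set B)" "wsum w (dual_set B) = - wsum (\<lambda>b. w (bar b)) B"
proof -
  have neg: "bar b < 0 \<longleftrightarrow> \<not> b < 0" for b by (auto simp: bar_def)
  let ?F = "{b. (b \<in> B) \<noteq> (b < 0)}" and ?G = "{b. (b \<in> dual_set B) \<noteq> (b < 0)}"
  have bij: "bij_betw bar ?F ?G"
    by (rule bij_betw_byWitness[where f' = bar]) (auto simp: dual_set_def neg)
  then show "maya (dual_set B)" using assms unfolding maya_def using bij_betw_finite by blast
  have "wsum w (dual_set B) = (\<Sum>b\<in>?F. (of_bool (bar b \<in> dual_set B) - of_bool (bar b < 0)) * w (bar b))"
    unfolding wsum_def by (rule sum.reindex_bij_betw[OF bij, symmetric])
  also have "\<dots> = (\<Sum>b\<in>?F. - ((of_bool (b \<in> B) - of_bool (b < 0)) * w (bar b)))"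
    by (rule sum.cong) (auto simp: dual_set_def neg)
  also have "\<dots> = - wsum (\<lambda>b. w (bar b)) B" unfolding wsum_def by (rule sum_negf)
  finally show "wsum w (dual_set B) = - wsum (\<lambda>b. w (bar b)) B" .
qed

text \<open>The dual of the core is again a core with the same charges.\<close>

lemma core_self_dual:
  assumes B: "maya B" "self_dual B" and C: "maya C" "down_closed m C" "same_charge m B C" and "m > 0"
  shows "self_dual C"
proof -
  have "down_closed m (dual_set C)" unfolding down_closed_def dual_set_def
  proof
    fix b assume "b \<in> {b. bar b \<notin> C}"
    moreover have "bar (b - m) - m = bar b" by (simp add: bar_def)
    ultimately show "b - m \<in> {b. bar b \<notin> C}" using C(2) unfolding down_closed_def by (metis mem_Collect_eq)
  qed
  moreover have "same_charge m (dual_set C) C" unfolding same_charge_def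
  proof (intro allI impI)
    fix g :: "int \<Rightarrow> int" assume g: "\<forall>b. g (b + m) = g b"
    have "g (bar (b + m)) = g (bar b)" for b
      by (rule periodic_cong[OF g]) (simp add: bar_def)
    then have "wsum (\<lambda>b. g (bar b)) B = wsum (\<lambda>b. g (bar b)) C" by (rule same_chargeD[OF C(3)])
    then have "wsum g (dual_set C) = wsum g (dual_set B)" using wsum_dual_set(2) B(1) C(1) by simp
    also have "\<dots> = wsum g B" using B(2) dual_set_self_dual by simp
    also have "\<dots> = wsum g C" using same_chargeD[OF C(3)] g by simp
    finally show "wsum g (dual_set C) = wsum g C" .
  qed
  ultimately have "dual_set C = C" using core_unique[OF wsum_dual_set(1)[OF C(1)] C(1) _ C(2) _ assms(6)] by blast
  then show ?thesis by (simp add: dual_set_self_dual)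
qed

lemma less_conjugate_iff:
  assumes "is_partition \<nu>"
  shows "c < conjugate_partition \<nu> r \<longleftrightarrow> r < \<nu> c"
proof -
  let ?A = "{c. \<nu> c \<ge> r + 1}"
  obtain N where N: "\<And>r. r \<ge> N \<Longrightarrow> \<nu> r = 0" using partition_zero[OF assms] by metis
  define k where "k = (LEAST c. \<not> \<nu> c \<ge> r + 1)"
  have "\<not> \<nu> N \<ge> r + 1" using N[of N] by simp
  then have k: "\<not> \<nu> k \<ge> r + 1" unfolding k_def by (rule LeastI)
  have mem: "c \<in> ?A \<longleftrightarrow> c < k" for c
  proof
    assume "c \<in> ?A"
    then show "c < k" using k partition_antimono[OF assms, of k c] by (metis mem_Collect_eq le_trans not_le)
  next
    assume "c < k"
    then show "c \<in> ?A" using not_less_Least[of c "\<lambda>c. \<not> \<nu> c \<ge> r + 1"] unfolding k_def by simp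
  qed
  then have "?A = {..<k}" by blast
  then have "conjugate_partition \<nu> r = k" by (simp add: conjugate_partition_def)
  then show ?thesis using mem[of c] by (simp add: Suc_le_eq)
qed

lemma conjugate_is_partition:
  assumes "is_partition \<nu>"
  shows "is_partition (conjugate_partition \<nu>)"
  unfolding is_partition_def
proof
  show "antimono (conjugate_partition \<nu>)"
  proof (rule antimonoI)
    fix x y :: nat assume "x \<le> y"
    then show "conjugate_partition \<nu> y \<le> conjugate_partition \<nu> x"
      using less_conjugate_iff[OF assms] by (meson leI le_less_trans less_irrefl)
  qed
  have "{r. conjugate_partition \<nu> r \<noteq> 0} \<subseteq> {..<\<nu> 0}"
    using less_conjugate_iff[OF assms, of 0] by auto
  then show "finite {r. conjugate_partition \<nu> r \<noteq> 0}" using finite_subset by blast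
qed

text \<open>One inclusion is checked on rows; equality follows because both sets have charge
  zero.\<close>

lemma beta_set_conjugate:
  assumes "is_partition \<nu>"
  shows "beta_set (conjugate_partition \<nu>) = dual_set (beta_set \<nu>)"
proof -
  let ?B = "beta_set (conjugate_partition \<nu>)" and ?D = "dual_set (beta_set \<nu>)"
  have p: "is_partition (conjugate_partition \<nu>)" by (rule conjugate_is_partition[OF assms])
  have sub: "?B \<subseteq> ?D"
  proof
    fix b assume "b \<in> ?B"
    then obtain r where r: "b = bead (conjugate_partition \<nu>) r" by (auto simp: beta_set_bead)
    \<comment> \<open>Equality would mean that \<open>\<nu> c - r\<close> and
      \<open>conjugate_partition \<nu> r - c\<close> add up to 1 as integers, but they are both
      positive or both nonpositive.\<close>
    have "bar b \<noteq> bead \<nu> c" for c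
      using less_conjugate_iff[OF assms, of c r] unfolding r bead_def bar_def by linarith
    then show "b \<in> ?D" by (auto simp: dual_set_def beta_set_bead)
  qed
  have m: "maya ?B" "maya ?D" using maya_beta_set[OF p] wsum_dual_set(1)[OF maya_beta_set[OF assms]] by auto
  have "wsum (\<lambda>_. 1) ?B = 0" "wsum (\<lambda>_. 1) ?D = 0"
    using charge_beta_set[OF p] wsum_dual_set(2)[OF maya_beta_set[OF assms], of "\<lambda>_. 1"] charge_beta_set[OF assms] by auto
  then have "int (card (?B - ?D)) - int (card (?D - ?B)) = 0" using wsum_diff[OF m, of "\<lambda>_. 1"] by simp
  moreover have "?B - ?D = {}" using sub by blast
  ultimately have "card (?D - ?B) = 0" by simp
  then have "?D - ?B = {}" using maya_finite_diff[OF m(2,1)] by simp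
  then show ?thesis using sub by blast
qed

lemma self_conjugate_iff:
  assumes "is_partition \<nu>"
  shows "conjugate_partition \<nu> = \<nu> \<longleftrightarrow> self_dual (beta_set \<nu>)"
proof -
  have "conjugate_partition \<nu> = \<nu> \<longleftrightarrow> beta_set (conjugate_partition \<nu>) = beta_set \<nu>"
    using beta_set_inject[OF conjugate_is_partition[OF assms] assms] by metis
  then show ?thesis unfolding beta_set_conjugate[OF assms] dual_set_self_dual .
qed


section \<open>Rim hooks, cores and weights\<close>

text \<open>Inside the strip the bead of row \<open>r\<close> of \<open>\<mu>\<close> is the bead of
  row \<open>r + 1\<close> of \<open>\<nu>\<close>, so only one bead changes.\<close>

lemma strip_beta_set:
  assumes \<nu>: "is_partition \<nu>" and \<mu>: "is_partition \<mu>" and pq: "p \<le> q"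
    and out: "\<And>r. r < p \<or> q < r \<Longrightarrow> \<mu> r = \<nu> r" and mid: "\<And>r. p \<le> r \<Longrightarrow> r < q \<Longrightarrow> \<mu> r + 1 = \<nu> (r + 1)"
    and lt: "\<mu> q < \<nu> q"
  shows "beta_set \<mu> = insert (bead \<mu> q) (beta_set \<nu> - {bead \<nu> p})" "bead \<mu> q \<notin> beta_set \<nu>"
proof -
  have o: "bead \<mu> r = bead \<nu> r" if "r < p \<or> q < r" for r using out[OF that] by (simp add: bead_def)
  have m: "bead \<mu> r = bead \<nu> (r + 1)" if "p \<le> r" "r < q" for r using mid[OF that] by (simp add: bead_def)
  show "bead \<mu> q \<notin> beta_set \<nu>"
  proof
    assume "bead \<mu> q \<in> beta_set \<nu>"
    then obtain r where r: "bead \<mu> q = bead \<nu> r" by (auto simp: beta_set_bead)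
    have 1: "bead \<mu> q < bead \<nu> q" using lt by (simp add: bead_def)
    have 2: "bead \<nu> (q + 1) < bead \<mu> q" using bead_less[OF \<mu>, of q "q + 1"] o[of "q + 1"] by simp
    show False
    proof (cases "r \<le> q")
      case True then show False using r 1 bead_less[OF \<nu>, of r q] by (cases "r = q") auto
    next
      case False then show False using r 2 bead_less[OF \<nu>, of "q + 1" r] by (cases "r = q + 1") auto
    qed
  qed
  show "beta_set \<mu> = insert (bead \<mu> q) (beta_set \<nu> - {bead \<nu> p})"
  proof (intro set_eqI iffI)
    fix x assume "x \<in> beta_set \<mu>"
    then obtain r where r: "x = bead \<mu> r" by (auto simp: beta_set_bead)
    consider "r < p \<or> q < r" | "p \<le> r" "r < q" | "r = q" by linarith
    then show "x \<in> insert (bead \<mu> q) (beta_set \<nu> - {bead \<nu> p})"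
    proof cases
      case 1
      then have "r \<noteq> p" using pq by auto
      then show ?thesis using r o[OF 1] by (auto simp: beta_set_bead bead_inj[OF \<nu>])
    next
      case 2
      then show ?thesis using r m[OF 2] by (auto simp: beta_set_bead bead_inj[OF \<nu>])
    next
      case 3 then show ?thesis using r by simp
    qed
  next
    fix x assume "x \<in> insert (bead \<mu> q) (beta_set \<nu> - {bead \<nu> p})"
    then consider "x = bead \<mu> q" | r where "x = bead \<nu> r" "r \<noteq> p" by (auto simp: beta_set_bead)
    then show "x \<in> beta_set \<mu>"
    proof cases
      case 1 then show ?thesis by (simp add: beta_set_bead)
    next
      case 2
      consider "r < p \<or> q < r" | "p < r" "r \<le> q" using 2(2) by linarith
      then show ?thesis
      proof cases
        case 1 then show ?thesis using 2 o[OF 1] by (metis beta_set_bead rangeI)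
      next
        case c: 2
        then have "bead \<mu> (r - 1) = bead \<nu> r" using m[of "r - 1"] by simp
        then show ?thesis using 2 by (metis beta_set_bead rangeI)
      qed
    qed
  qed
qed

lemma skew_card:
  assumes \<nu>: "is_partition \<nu>" and \<mu>: "is_partition \<mu>" and le: "\<And>r. \<mu> r \<le> \<nu> r"
  shows "finite {(r, c). \<mu> r \<le> c \<and> c < \<nu> r}" "psize \<nu> = psize \<mu> + card {(r, c). \<mu> r \<le> c \<and> c < \<nu> r}"
proof -
  obtain N where N: "\<And>r. r \<ge> N \<Longrightarrow> \<nu> r = 0" using partition_zero[OF \<nu>] by metis
  have N': "\<mu> r = 0" if "r \<ge> N" for r using le[of r] N[OF that] by simp
  have "\<not> N \<le> r" if "c < \<nu> r" for r c using N[of r] that by auto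
  then have H: "{(r, c). \<mu> r \<le> c \<and> c < \<nu> r} = (SIGMA r:{..<N}. {\<mu> r..<\<nu> r})" by (auto simp: not_le)
  show "finite {(r, c). \<mu> r \<le> c \<and> c < \<nu> r}" unfolding H by simp
  have "card {(r, c). \<mu> r \<le> c \<and> c < \<nu> r} = (\<Sum>r<N. \<nu> r - \<mu> r)" unfolding H by simp
  moreover have "(\<Sum>r<N. \<nu> r) = (\<Sum>r<N. \<mu> r) + (\<Sum>r<N. \<nu> r - \<mu> r)"
    unfolding sum.distrib[symmetric] by (rule sum.cong) (use le in auto)
  ultimately show "psize \<nu> = psize \<mu> + card {(r, c). \<mu> r \<le> c \<and> c < \<nu> r}"
    using psize_sum[OF N] psize_sum[OF N'] by simp
qed

text \<open>A path in \<open>H\<close> that leaves row \<open>r\<close> downwards must contain a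
  vertical step; this turns connectedness into overlap of consecutive rows.\<close>

lemma crossing:
  assumes "(x, y) \<in> (adjacent_nodes \<inter> H \<times> H)\<^sup>*" "fst x \<le> r" "r < fst y"
  shows "\<exists>c. (r, c) \<in> H \<and> (r + 1, c) \<in> H"
  using assms
proof (induction rule: rtrancl_induct)
  case (step y z)
  show ?case
  proof (cases "r < fst y")
    case True then show ?thesis using step by blast
  next
    case False
    obtain a b a' b' where yz: "y = (a, b)" "z = (a', b')" by (metis surj_pair)
    have "((a, b), (a', b')) \<in> adjacent_nodes" "(a, b) \<in> H" "(a', b') \<in> H" using step yz by auto
    moreover have "a \<le> r" "r < a'" using False step yz by auto
    ultimately have "a = r" "a' = r + 1" "b' = b" by (auto simp: adjacent_nodes_def)
    then show ?thesis using \<open>(a, b) \<in> H\<close> \<open>(a', b') \<in> H\<close> by blast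
  qed
qed simp

text \<open>Connectedness makes the rows of the hook an interval from \<open>p\<close> to
  \<open>q\<close> and, with the rim condition, fixes the overlap of consecutive rows at one column;
  the sizes give the distance \<open>s\<close>.\<close>

lemma remove_rim_hook_beta:
  assumes \<nu>: "is_partition \<nu>" and h: "remove_rim_hook s \<nu> \<mu>" and s: "s > 0"
  obtains z where "z \<in> beta_set \<nu>" "z - int s \<notin> beta_set \<nu>" "beta_set \<mu> = insert (z - int s) (beta_set \<nu> - {z})"
proof -
  obtain H where \<mu>: "is_partition \<mu>" and H: "H \<subseteq> rim \<nu>" "card H = s" "connected_nodes H"
    "young_diagram \<mu> = young_diagram \<nu> - H"
    using h by (auto simp: remove_rim_hook_def is_rim_hook_def)
  have mem: "c < \<mu> r \<longleftrightarrow> c < \<nu> r \<and> (r, c) \<notin> H" for r c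
    using H(4) unfolding young_diagram_def by (auto simp: set_eq_iff)
  have HY: "c < \<nu> r" "\<nu> (r + 1) \<le> c + 1" if "(r, c) \<in> H" for r c
    using that H(1) by (auto simp: rim_def young_diagram_def)
  have le: "\<mu> r \<le> \<nu> r" for r using mem[of "\<nu> r" r] by (metis less_irrefl not_less)
  have Heq: "(r, c) \<in> H \<longleftrightarrow> \<mu> r \<le> c \<and> c < \<nu> r" for r c using mem[of c r] HY(1)[of r c] by auto
  have Hset: "H = {(r, c). \<mu> r \<le> c \<and> c < \<nu> r}" using Heq by auto
  have sz: "psize \<nu> = psize \<mu> + s" using skew_card(2)[OF \<nu> \<mu> le] H(2) Hset by simp
  define R where "R = {r. \<mu> r < \<nu> r}"
  have RH: "r \<in> R \<Longrightarrow> (r, \<mu> r) \<in> H" for r by (simp add: R_def Heq)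
  have HR: "(r, c) \<in> H \<Longrightarrow> r \<in> R" for r c by (auto simp: R_def Heq)
  have "finite {r. \<nu> r \<noteq> 0}" using \<nu> by (simp add: is_partition_def)
  then have finR: "finite R" by (rule finite_subset[rotated]) (auto simp: R_def)
  have "H \<noteq> {}" using H(2) s by auto
  then have neR: "R \<noteq> {}" using HR by fastforce
  define p q where "p = Min R" and "q = Max R"
  have pR: "p \<in> R" "q \<in> R" using finR neR by (auto simp: p_def q_def)
  have pq: "p \<le> q" using finR pR by (simp add: p_def)
  have step: "r + 1 \<in> R \<and> \<mu> r + 1 = \<nu> (r + 1)" if r: "r \<in> R" "r < q" for r
  proof -
    have "((r, \<mu> r), (q, \<mu> q)) \<in> (adjacent_nodes \<inter> H \<times> H)\<^sup>*"
      using H(3) RH[OF r(1)] RH[OF pR(2)] by (simp add: connected_nodes_def)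
    then obtain c where c: "(r, c) \<in> H" "(r + 1, c) \<in> H" using crossing[of "(r, \<mu> r)" "(q, \<mu> q)" H r] r(2) by auto
    have "\<mu> r \<le> c" "c < \<nu> (r + 1)" using c Heq by auto
    moreover have "\<nu> (r + 1) \<le> \<mu> r + 1" using HY(2)[OF RH[OF r(1)]] .
    ultimately show ?thesis using HR[OF c(2)] by simp
  qed
  have inR: "r \<in> R" if "p \<le> r" "r \<le> q" for r
    using that
  proof (induction r rule: dec_induct)
    case base show ?case by (rule pR)
  next
    case (step r) then show ?case using \<open>\<And>r. r \<in> R \<Longrightarrow> r < q \<Longrightarrow> r + 1 \<in> R \<and> \<mu> r + 1 = \<nu> (r + 1)\<close>[of r] by simp
  qed
  have out: "\<mu> r = \<nu> r" if "r < p \<or> q < r" for r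
  proof -
    have "r \<notin> R" using that Min_le[OF finR, of r] Max_ge[OF finR, of r] by (auto simp: p_def q_def)
    then show ?thesis using le[of r] by (simp add: R_def)
  qed
  have mid: "\<mu> r + 1 = \<nu> (r + 1)" if "p \<le> r" "r < q" for r using step[OF inR] that by simp
  have ltq: "\<mu> q < \<nu> q" using pR(2) by (simp add: R_def)
  have st: "beta_set \<mu> = insert (bead \<mu> q) (beta_set \<nu> - {bead \<nu> p})" "bead \<mu> q \<notin> beta_set \<nu>"
    using strip_beta_set[of \<nu> \<mu> p q] \<nu> \<mu> pq out mid ltq by blast+
  have pin: "bead \<nu> p \<in> beta_set \<nu>" by (simp add: beta_set_bead)
  have "energy (beta_set \<mu>) = energy (beta_set \<nu>) - bead \<nu> p + bead \<mu> q"
    unfolding st(1) by (rule energy_exchange[OF maya_beta_set[OF \<nu>] pin st(2)])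
  then have "bead \<mu> q = bead \<nu> p - int s"
    using energy_beta_set[OF \<nu>] energy_beta_set[OF \<mu>] sz by simp
  then show thesis using that[OF pin] st by simp
qed

lemma rim_hook_exists:
  assumes \<nu>: "is_partition \<nu>" and z: "z \<in> beta_set \<nu>" "z - int s \<notin> beta_set \<nu>" and s: "s > 0"
  shows "\<exists>H. is_rim_hook s \<nu> H"
proof -
  obtain p where p: "z = bead \<nu> p" using z(1) by (auto simp: beta_set_bead)
  obtain N where N: "\<And>r. r \<ge> N \<Longrightarrow> \<nu> r = 0" using partition_zero[OF \<nu>] by metis
  let ?Q = "{r. z - int s < bead \<nu> r}"
  have "?Q \<subseteq> {..N + nat \<bar>z - int s\<bar>}"
  proof
    fix r assume r: "r \<in> ?Q"
    show "r \<in> {..N + nat \<bar>z - int s\<bar>}"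
      using r N[of r] by (cases "r \<ge> N") (auto simp: bead_def)
  qed
  then have finQ: "finite ?Q" by (rule finite_subset) simp
  have pQ: "p \<in> ?Q" using p s by simp
  \<comment> \<open>The last row whose bead lies above the target position
    \<open>z - s\<close>.\<close>
  define q where "q = Max ?Q"
  have qQ: "z - int s < bead \<nu> q" using Max_in[OF finQ] pQ unfolding q_def by blast
  have pq: "p \<le> q" unfolding q_def using finQ pQ by simp
  have "q + 1 \<notin> ?Q" using Max_ge[OF finQ, of "q + 1"] unfolding q_def by auto
  moreover have "z - int s \<noteq> bead \<nu> (q + 1)" using z(2) by (auto simp: beta_set_bead)
  ultimately have q1: "bead \<nu> (q + 1) < z - int s" by simp
  \<comment> \<open>The length that row \<open>q\<close> needs for its bead to sit at
    \<open>z - s\<close>.\<close>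
  define m where "m = nat (z - int s + int q + 1)"
  have m: "int m = z - int s + int q + 1" "\<nu> (q + 1) \<le> m" "m < \<nu> q"
    using q1 qQ by (simp_all add: m_def bead_def)
  define \<mu> where "\<mu> = (\<lambda>r. if r < p \<or> q < r then \<nu> r else if r < q then \<nu> (r + 1) - 1 else m)"
  have anti: "\<nu> b \<le> \<nu> a" if "a \<le> b" for a b using partition_antimono[OF \<nu> that] .
  have pos: "\<nu> (r + 1) \<ge> 1" if "r < q" for r using anti[of "r + 1" q] m(3) that by simp
  have le: "\<mu> r \<le> \<nu> r" for r
    using anti[of r "r + 1"] m(3) by (auto simp: \<mu>_def)
  have "\<mu> (Suc r) \<le> \<mu> r" for r
  proof -
    consider "Suc r < p \<or> q < r" | "Suc r = p" | "p \<le> r" "Suc r < q" | "p \<le> r" "Suc r = q" | "p \<le> r" "r = q" by linarith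
    then show ?thesis
    proof cases
      case 1 then show ?thesis using anti[of r "Suc r"] by (auto simp: \<mu>_def)
    next
      case 2 then show ?thesis using le[of "Suc r"] anti[of r "Suc r"] by (simp add: \<mu>_def)
    next
      case 3 then show ?thesis using anti[of "Suc r" "Suc (Suc r)"] by (auto simp: \<mu>_def)
    next
      case 4 then show ?thesis using m(3) by (auto simp: \<mu>_def)
    next
      case 5 then show ?thesis using m(2) by (auto simp: \<mu>_def)
    qed
  qed
  then have "antimono \<mu>" by (rule antimono_iff_le_Suc[THEN iffD2, rule_format])
  moreover have "finite {r. \<mu> r \<noteq> 0}"
  proof (rule finite_subset)
    show "{r. \<mu> r \<noteq> 0} \<subseteq> {r. \<nu> r \<noteq> 0}" using le by (metis (mono_tags, lifting) Collect_mono le_zero_eq)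
    show "finite {r. \<nu> r \<noteq> 0}" using \<nu> by (simp add: is_partition_def)
  qed
  ultimately have \<mu>: "is_partition \<mu>" by (simp add: is_partition_def)
  define H where "H = {(r, c). \<mu> r \<le> c \<and> c < \<nu> r}"
  have out: "\<mu> r = \<nu> r" if "r < p \<or> q < r" for r using that by (simp add: \<mu>_def)
  have mid: "\<mu> r + 1 = \<nu> (r + 1)" if "p \<le> r" "r < q" for r using that pos[of r] by (simp add: \<mu>_def)
  have \<mu>q: "\<mu> q = m" using pq by (simp add: \<mu>_def)
  have ltq: "\<mu> q < \<nu> q" using m(3) \<mu>q by simp
  have st: "beta_set \<mu> = insert (bead \<mu> q) (beta_set \<nu> - {bead \<nu> p})" "bead \<mu> q \<notin> beta_set \<nu>"
    using strip_beta_set[of \<nu> \<mu> p q] \<nu> \<mu> pq out mid ltq by blast+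
  have bq: "bead \<mu> q = z - int s" using m(1) \<mu>q by (simp add: bead_def)
  have "energy (beta_set \<mu>) = energy (beta_set \<nu>) - bead \<nu> p + bead \<mu> q"
    unfolding st(1) by (rule energy_exchange[OF maya_beta_set[OF \<nu>] _ st(2)]) (simp add: beta_set_bead)
  then have "int (psize \<nu>) = int (psize \<mu>) + int s"
    using energy_beta_set[OF \<nu>] energy_beta_set[OF \<mu>] bq p by simp
  then have cardH: "card H = s" using skew_card(2)[OF \<nu> \<mu> le] by (simp add: H_def)
  have young: "young_diagram \<mu> = young_diagram \<nu> - H"
    using le by (auto simp: young_diagram_def H_def not_le intro: less_le_trans)
  have rows: "p \<le> r \<and> r \<le> q" if "(r, c) \<in> H" for r c
    using that out[of r] by (fastforce simp: H_def)
  have rim: "H \<subseteq> rim \<nu>"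
  proof
    fix x assume "x \<in> H"
    then obtain r c where rc: "x = (r, c)" "\<mu> r \<le> c" "c < \<nu> r" "(r, c) \<in> H" by (auto simp: H_def)
    have "\<nu> (r + 1) \<le> c + 1"
    proof (cases "r < q")
      case True then show ?thesis using mid[of r] rows[OF rc(4)] rc(2) by simp
    next
      case False then show ?thesis using rows[OF rc(4)] rc(2) m(2) \<mu>q by simp
    qed
    then show "x \<in> rim \<nu>" using rc by (simp add: rim_def young_diagram_def)
  qed
  let ?E = "adjacent_nodes \<inter> H \<times> H"
  have symE: "sym ?E" by (auto simp: sym_def adjacent_nodes_def)
  have row: "((r, c), (r, c + k)) \<in> ?E\<^sup>*" if "(r, c) \<in> H" "(r, c + k) \<in> H" for r c k
    using that
  proof (induction k)
    case (Suc k)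
    have "(r, c + k) \<in> H" using Suc.prems by (auto simp: H_def)
    moreover have "((r, c + k), (r, c + Suc k)) \<in> ?E" using Suc.prems calculation by (auto simp: adjacent_nodes_def)
    ultimately show ?case using Suc by (meson rtrancl.rtrancl_into_rtrancl)
  qed simp
  have row': "((r, c), (r, c')) \<in> ?E\<^sup>*" if "(r, c) \<in> H" "(r, c') \<in> H" for r c c'
  proof (cases "c \<le> c'")
    case True then show ?thesis using row[of r c "c' - c"] that by simp
  next
    case False
    then have "((r, c'), (r, c)) \<in> ?E\<^sup>*" using row[of r c' "c - c'"] that by simp
    then show ?thesis using sym_rtrancl[OF symE] by (simp add: sym_def)
  qed
  have base: "(q, m) \<in> H" using m(3) \<mu>q by (simp add: H_def)
  have conn: "((r, c), (q, m)) \<in> ?E\<^sup>*" if "(r, c) \<in> H" for r c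
    using that
  proof (induction "q - r" arbitrary: r c)
    case 0
    then have "r = q" using rows[OF 0(2)] by simp
    then show ?case using row'[OF 0(2)] base by blast
  next
    case (Suc k)
    then have r: "p \<le> r" "r < q" using rows[OF Suc(3)] by auto
    \<comment> \<open>Rows \<open>r\<close> and \<open>r + 1\<close> of the strip meet in the last
      column of row \<open>r + 1\<close>.\<close>
    let ?c = "\<nu> (r + 1) - 1"
    have c1: "(r, ?c) \<in> H" using mid[OF r] anti[of r "r + 1"] unfolding H_def by (simp, linarith)
    have c2: "(r + 1, ?c) \<in> H"
    proof -
      have "\<mu> (r + 1) < \<nu> (r + 1)"
      proof (cases "r + 1 = q")
        case True then show ?thesis using ltq by simp
      next
        case False
        then have "\<mu> (r + 1) + 1 = \<nu> (r + 1 + 1)" using r by (intro mid) auto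
        then show ?thesis using anti[of "r + 1" "r + 1 + 1"] by simp
      qed
      then show ?thesis by (auto simp: H_def)
    qed
    have "((r, ?c), (r + 1, ?c)) \<in> ?E" using c1 c2 by (auto simp: adjacent_nodes_def)
    moreover have "((r + 1, ?c), (q, m)) \<in> ?E\<^sup>*" using Suc.hyps(1)[of "r + 1"] Suc.hyps(2) c2 by simp
    ultimately show ?case using row'[OF Suc(3) c1]
      by (meson converse_rtrancl_into_rtrancl rtrancl_trans)
  qed
  have "connected_nodes H" unfolding connected_nodes_def
  proof (intro ballI)
    fix x y assume "x \<in> H" "y \<in> H"
    then have "(x, (q, m)) \<in> ?E\<^sup>*" "(y, (q, m)) \<in> ?E\<^sup>*" using conn by (metis surj_pair)+
    then show "(x, y) \<in> ?E\<^sup>*" using sym_rtrancl[OF symE] by (meson rtrancl_trans symD)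
  qed
  then show ?thesis unfolding is_rim_hook_def using rim cardH young \<mu> by blast
qed

lemma is_core_iff:
  assumes "s > 0"
  shows "is_core s \<nu> \<longleftrightarrow> is_partition \<nu> \<and> down_closed (int s) (beta_set \<nu>)"
proof (cases "is_partition \<nu>")
  case True
  have "down_closed (int s) (beta_set \<nu>)" if "\<not> (\<exists>H. is_rim_hook s \<nu> H)"
    using that rim_hook_exists[OF True _ _ assms] unfolding down_closed_def by blast
  moreover have "\<not> is_rim_hook s \<nu> H" if d: "down_closed (int s) (beta_set \<nu>)" for H
  proof
    assume "is_rim_hook s \<nu> H"
    then obtain \<mu> where "remove_rim_hook s \<nu> \<mu>" unfolding remove_rim_hook_def is_rim_hook_def by blast
    then show False using remove_rim_hook_beta[OF True _ assms] d unfolding down_closed_def by metis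
  qed
  ultimately show ?thesis using True unfolding is_core_def by blast
qed (simp add: is_core_def)

lemma remove_rim_hook_invariants:
  assumes "is_partition \<nu>" "remove_rim_hook s \<nu> \<mu>" "s > 0"
  shows "is_partition \<mu>" "same_charge (int s) (beta_set \<mu>) (beta_set \<nu>)" "psize \<nu> = psize \<mu> + s"
proof -
  show \<mu>: "is_partition \<mu>" using assms(2) by (simp add: remove_rim_hook_def)
  obtain z where z: "z \<in> beta_set \<nu>" "z - int s \<notin> beta_set \<nu>" "beta_set \<mu> = insert (z - int s) (beta_set \<nu> - {z})"
    using remove_rim_hook_beta[OF assms] by metis
  show "same_charge (int s) (beta_set \<mu>) (beta_set \<nu>)" unfolding z(3)
    by (rule same_charge_exchange[OF maya_beta_set[OF assms(1)] z(1,2)]) simp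
  have "energy (beta_set \<mu>) = energy (beta_set \<nu>) - int s"
    unfolding z(3) energy_exchange[OF maya_beta_set[OF assms(1)] z(1,2)] by simp
  then show "psize \<nu> = psize \<mu> + s" using energy_beta_set[OF assms(1)] energy_beta_set[OF \<mu>] by simp
qed

lemma relpow_remove_invariants:
  assumes "(remove_rim_hook s ^^ w) \<nu> \<mu>" "is_partition \<nu>" "s > 0"
  shows "is_partition \<mu> \<and> same_charge (int s) (beta_set \<mu>) (beta_set \<nu>) \<and> psize \<nu> = psize \<mu> + s * w"
  using assms(1)
proof (induction w arbitrary: \<mu>)
  case (Suc w)
  then obtain \<rho> where \<rho>: "(remove_rim_hook s ^^ w) \<nu> \<rho>" "remove_rim_hook s \<rho> \<mu>" by auto
  then show ?case using Suc.IH[OF \<rho>(1)] remove_rim_hook_invariants[OF _ \<rho>(2) assms(3)] same_charge_trans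
    by (auto simp: algebra_simps)
qed (use assms(2) in simp)

lemma core_reachable:
  assumes "is_partition \<nu>" "s > 0"
  shows "\<exists>w \<mu>. (remove_rim_hook s ^^ w) \<nu> \<mu> \<and> is_core s \<mu>"
  using assms(1)
proof (induction "psize \<nu>" arbitrary: \<nu> rule: less_induct)
  case less
  show ?case
  proof (cases "is_core s \<nu>")
    case True then show ?thesis by (intro exI[of _ 0] exI[of _ \<nu>]) simp
  next
    case False
    then obtain \<mu> where \<mu>: "remove_rim_hook s \<nu> \<mu>"
      using less.prems unfolding is_core_def remove_rim_hook_def is_rim_hook_def by blast
    note inv = remove_rim_hook_invariants[OF less.prems \<mu> assms(2)]
    have "psize \<mu> < psize \<nu>" using inv(3) assms(2) by simp
    from less.hyps[OF this inv(1)] obtain w \<kappa> where "(remove_rim_hook s ^^ w) \<mu> \<kappa>" "is_core s \<kappa>" by blast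
    then show ?thesis using \<mu> by (metis relpowp_Suc_I2)
  qed
qed

lemma core_eqI:
  assumes "is_core s \<mu>" "is_core s \<rho>" "same_charge (int s) (beta_set \<mu>) (beta_set \<rho>)" "s > 0"
  shows "\<mu> = \<rho>"
proof -
  have m: "is_partition \<mu>" "down_closed (int s) (beta_set \<mu>)" "is_partition \<rho>" "down_closed (int s) (beta_set \<rho>)"
    using assms by (auto simp: is_core_iff)
  have "beta_set \<mu> = beta_set \<rho>"
    by (rule core_unique[OF maya_beta_set[OF m(1)] maya_beta_set[OF m(3)] m(2,4) assms(3)]) (use assms(4) in simp)
  then show ?thesis by (rule beta_set_inject[OF m(1,3)])
qed

text \<open>Hook removal keeps the charges, which determine the core, and the size then determines
  the number of steps; so both \<open>THE\<close> descriptions are meaningful.\<close>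

lemma cor_wei:
  assumes "is_partition \<nu>" "s > 0"
  shows "is_core s (cor s \<nu>)" "same_charge (int s) (beta_set \<nu>) (beta_set (cor s \<nu>))"
    "psize \<nu> = psize (cor s \<nu>) + s * wei s \<nu>"
proof -
  obtain w \<mu> where w: "(remove_rim_hook s ^^ w) \<nu> \<mu>" "is_core s \<mu>" using core_reachable[OF assms] by blast
  note inv = relpow_remove_invariants[OF w(1) assms]
  have uniq: "\<mu>' = \<mu> \<and> w' = w" if h: "(remove_rim_hook s ^^ w') \<nu> \<mu>'" "is_core s \<mu>'" for w' \<mu>'
  proof -
    note inv' = relpow_remove_invariants[OF h(1) assms]
    have "same_charge (int s) (beta_set \<mu>') (beta_set \<mu>)"
      using inv inv' same_charge_sym same_charge_trans by blast
    then have "\<mu>' = \<mu>" using core_eqI[OF h(2) w(2)] assms(2) by blast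
    then show ?thesis using inv inv' assms(2) by simp
  qed
  have "cor s \<nu> = \<mu>" unfolding cor_def
  proof (rule the_equality)
    show "(remove_rim_hook s)\<^sup>*\<^sup>* \<nu> \<mu> \<and> is_core s \<mu>" using w relpowp_imp_rtranclp by metis
    show "\<mu>' = \<mu>" if "(remove_rim_hook s)\<^sup>*\<^sup>* \<nu> \<mu>' \<and> is_core s \<mu>'" for \<mu>'
      using that uniq by (metis rtranclp_imp_relpowp)
  qed
  moreover have "wei s \<nu> = w" unfolding wei_def
    by (rule the_equality) (use w uniq in blast)+
  ultimately show "is_core s (cor s \<nu>)" "same_charge (int s) (beta_set \<nu>) (beta_set (cor s \<nu>))"
    "psize \<nu> = psize (cor s \<nu>) + s * wei s \<nu>" using w inv same_charge_sym by auto
qed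

lemma cor_eq_iff:
  assumes "is_partition \<nu>" "is_core s \<sigma>" "s > 0"
  shows "cor s \<nu> = \<sigma> \<longleftrightarrow> same_charge (int s) (beta_set \<nu>) (beta_set \<sigma>)"
  using cor_wei[OF assms(1,3)] core_eqI[OF _ assms(2) _ assms(3), of "cor s \<nu>"] same_charge_sym same_charge_trans
  by metis


section \<open>The classification\<close>

lemma kappa_partition:
  assumes "coprime_pair (int s) (int t)"
  shows "is_partition (kappa s t)" "beta_set (kappa s t) = kappa_set (int s) (int t)"
proof -
  interpret coprime_pair "int s" "int t" by (rule assms)
  let ?K = "kappa_set (int s) (int t)"
  have st: "s > 0" "t > 0" using s_gt_1 t_gt_1 by auto
  obtain \<kappa> where \<kappa>: "is_partition \<kappa>" "beta_set \<kappa> = ?K"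
    using beta_set_surj[OF kappa_set_maya self_dual_charge[OF kappa_set_self_dual]] by blast
  have core: "is_core s \<kappa>" "is_core t \<kappa>" using \<kappa> kappa_set_closed st by (auto simp: is_core_iff)
  have max: "psize \<mu> \<le> psize \<kappa>" "psize \<mu> = psize \<kappa> \<Longrightarrow> \<mu> = \<kappa>" if "is_core s \<mu>" "is_core t \<mu>" for \<mu>
  proof -
    have \<mu>: "is_partition \<mu>" "down_closed (int s) (beta_set \<mu>)" "down_closed (int t) (beta_set \<mu>)"
      using that st by (auto simp: is_core_iff)
    note m = kappa_set_maximal[OF maya_beta_set[OF \<mu>(1)] \<mu>(2,3) charge_beta_set[OF \<mu>(1)]]
    note e = energy_beta_set[OF \<mu>(1)] energy_beta_set[OF \<kappa>(1), unfolded \<kappa>(2)]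
    show "psize \<mu> \<le> psize \<kappa>" using m(1) e by simp
    show "\<mu> = \<kappa>" if "psize \<mu> = psize \<kappa>"
      using m(2) e that beta_set_inject[OF \<mu>(1) \<kappa>(1)] \<kappa>(2) by simp
  qed
  have "kappa s t = \<kappa>" unfolding kappa_def
    by (rule the_equality) (use core max in \<open>auto intro: order_antisym\<close>)
  then show "is_partition (kappa s t)" "beta_set (kappa s t) = ?K" using \<kappa> by auto
qed

lemma harpoon_iff: "harpoon p q \<alpha> \<beta> \<longleftrightarrow> set_harpoon (int p) (int q) (beta_set \<alpha>) (beta_set \<beta>)"
  by (simp add: harpoon_def set_harpoon_def)

lemma harpoons_via_iff: "harpoons_via s t \<alpha> \<beta> b c \<longleftrightarrow> set_harpoons (int s) (int t) (beta_set \<alpha>) (beta_set \<beta>) b c"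
  by (simp add: harpoons_via_def set_harpoons_def)

text \<open>\<open>\<alpha>\<close> and \<open>\<beta>\<close> determine the pair of flipped beads,
  so a different \<open>c'\<close> would equal \<open>b\<close> and satisfy both
  congruences.\<close>

lemma (in coprime_pair) set_harpoons_unique:
  assumes "sym_core s t \<alpha>" "sym_core s t \<beta>" "odd s" "odd t"
    and h: "set_harpoons s t \<alpha> \<beta> b c" "set_harpoons s t \<alpha> \<beta> b' c'"
  shows "c' = c"
proof (rule ccontr)
  assume ne: "c' \<noteq> c"
  have h1: "b \<noteq> c" "b \<in> \<beta>" "b \<notin> \<alpha>" "c \<in> \<beta>" "c \<notin> \<alpha>" "[bar b - b = t] (mod (2 * s))"
    "\<alpha> = (\<beta> - {b, c}) \<union> {bar b, bar c}" using h(1) by (auto simp: set_harpoons_def)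
  have h2: "c' \<in> \<beta>" "c' \<notin> \<alpha>" "[bar c' - c' = - s] (mod (2 * t))" using h(2) by (auto simp: set_harpoons_def)
  have "c' = b" using h2 h1(7) ne by auto
  then have "t dvd bar b - b + s" using h2(3) by (metis cong_iff_dvd_diff dvd_mult_right diff_minus_eq_add)
  moreover have "s dvd bar b - b - t" using h1(6) by (metis cong_iff_dvd_diff dvd_mult_right)
  moreover have "odd (bar b - b)" unfolding bar_def by presburger
  ultimately have "semigroup2 s t (bar b - b) \<or> semigroup2 s t (- (bar b - b))"
    using gap_in_semigroup assms(3,4) by blast
  moreover have "\<not> semigroup2 s t (bar b - b)"
    by (rule not_semigroup_exchange[of \<alpha>]) (use assms(1) h1 in \<open>auto simp: sym_core_def\<close>)
  moreover have "bar b \<notin> \<beta>" using h1(2) assms(2) self_dualD by (auto simp: sym_core_def)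
  then have "\<not> semigroup2 s t (b - bar b)"
    using not_semigroup_exchange[of \<beta> b "bar b"] assms(2) h1(2) by (auto simp: sym_core_def)
  ultimately show False by simp
qed

lemma psize_star:
  assumes cp: "coprime_pair (int s) (int t)" and odd: "odd s" "odd t"
    and \<alpha>: "sym_core (int s) (int t) (beta_set \<alpha>)" and \<beta>: "sym_core (int s) (int t) (beta_set \<beta>)"
    and h: "harpoons_via s t \<alpha> \<beta> b c"
  shows "int (psize (star s t \<alpha> \<beta>)) = energy ((beta_set \<beta> - {c}) \<union> {bar c})"
proof -
  interpret coprime_pair "int s" "int t" by (rule cp)
  have odd': "odd (int s)" "odd (int t)" using odd by auto
  let ?C = "(beta_set \<beta> - {c}) \<union> {bar c}"
  have sh: "set_harpoons (int s) (int t) (beta_set \<alpha>) (beta_set \<beta>) b c" using h by (simp add: harpoons_via_iff)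
  have "sym_core (int s) (int t) ?C" using harpoons_middle_core(1)[OF \<alpha> \<beta> odd' sh] by simp
  then obtain \<gamma> where \<gamma>: "is_partition \<gamma>" "beta_set \<gamma> = ?C"
    using beta_set_surj[of ?C] self_dual_charge by (auto simp: sym_core_def)
  have "star s t \<alpha> \<beta> = \<gamma>" unfolding star_def
  proof (rule the_equality)
    show "is_partition \<gamma> \<and> (\<exists>b c. harpoons_via s t \<alpha> \<beta> b c \<and> beta_set \<gamma> = beta_set \<beta> - {c} \<union> {bar c})"
      using \<gamma> h by blast
    fix \<gamma>' assume "is_partition \<gamma>' \<and> (\<exists>b c. harpoons_via s t \<alpha> \<beta> b c \<and> beta_set \<gamma>' = beta_set \<beta> - {c} \<union> {bar c})"
    then obtain b' c' where g': "is_partition \<gamma>'" "harpoons_via s t \<alpha> \<beta> b' c'" "beta_set \<gamma>' = beta_set \<beta> - {c'} \<union> {bar c'}" by blast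
    have "c' = c" using set_harpoons_unique[OF \<alpha> \<beta> odd' sh] g'(2) by (simp add: harpoons_via_iff)
    then show "\<gamma>' = \<gamma>" using beta_set_inject[OF g'(1) \<gamma>(1)] g'(3) \<gamma>(2) by simp
  qed
  then show ?thesis using energy_beta_set[OF \<gamma>(1)] \<gamma>(2) by simp
qed

lemma ex1_image_iff:
  assumes "\<And>x. P x \<Longrightarrow> Q (f x)" "\<And>y. Q y \<Longrightarrow> \<exists>x. P x \<and> f x = y" "\<And>x x'. P x \<Longrightarrow> P x' \<Longrightarrow> f x = f x' \<Longrightarrow> x = x'"
  shows "(\<exists>!x. P x) \<longleftrightarrow> (\<exists>!y. Q y)"
  using assms by metis

theorem theorem5p15:
  fixes s t n :: nat and \<sigma> \<tau> :: "nat \<Rightarrow> nat"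
  assumes "s > 1" and "t > 1" and "coprime s t"
    and "is_core s \<sigma>" and "is_core t \<tau>"
  shows "(\<exists>!\<nu>. \<nu> \<in> {\<nu>. is_partition \<nu> \<and> psize \<nu> = n \<and> cor s \<nu> = \<sigma> \<and> cor t \<nu> = \<tau>} \<and>
              conjugate_partition \<nu> = \<nu>) \<longleftrightarrow>
    conjugate_partition \<sigma> = \<sigma> \<and> conjugate_partition \<tau> = \<tau> \<and>
    ((cor t \<sigma> = cor s \<tau> \<and>
        int n = int (psize \<sigma>) + int (psize \<tau>) - int (psize (cor t \<sigma>))) \<or>
     (odd t \<and> harpoon s t (cor t \<sigma>) (cor s \<tau>) \<and>
        n = psize \<tau> + t * (wei t \<sigma> + 1)) \<or>
     (odd s \<and> harpoon t s (cor s \<tau>) (cor t \<sigma>) \<and>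
        n = psize \<sigma> + s * (wei s \<tau> + 1)) \<or>
     (odd s \<and> odd t \<and> harpoons s t (cor t \<sigma>) (cor s \<tau>) \<and>
        n = psize (star s t (cor t \<sigma>) (cor s \<tau>)) + s * (wei s \<tau> + 1) + t * (wei t \<sigma> + 1)) \<or>
     (odd s \<and> odd t \<and> cor t \<sigma> = kappa s t \<and> cor s \<tau> = kappa s t \<and>
        int n = int (psize \<sigma>) + int (psize \<tau>) - int (psize (kappa s t)) + int s * int t))"
  (is "?L \<longleftrightarrow> ?R")
proof -
  have st0: "s > 0" "t > 0" using assms by auto
  have cp: "coprime_pair (int s) (int t)" using assms(1-3) by unfold_locales auto
  then interpret coprime_pair "int s" "int t" .
  interpret sw: coprime_pair "int t" "int s" by (rule swap)
  have \<sigma>: "is_partition \<sigma>" "down_closed (int s) (beta_set \<sigma>)" and \<tau>: "is_partition \<tau>" "down_closed (int t) (beta_set \<tau>)"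
    using assms(4,5) st0 by (auto simp: is_core_iff)
  note m\<sigma> = maya_beta_set[OF \<sigma>(1)] and m\<tau> = maya_beta_set[OF \<tau>(1)]
  let ?sol = "solution (int s) (int t)"
  \<comment> \<open>Charge zero, needed to return from a solution to a partition, holds by
    self-duality.\<close>
  have L: "?L \<longleftrightarrow> (\<exists>!B. ?sol (beta_set \<sigma>) (beta_set \<tau>) (int n) B)"
  proof (rule ex1_image_iff[where f = beta_set])
    fix \<nu> assume "\<nu> \<in> {\<nu>. is_partition \<nu> \<and> psize \<nu> = n \<and> cor s \<nu> = \<sigma> \<and> cor t \<nu> = \<tau>} \<and> conjugate_partition \<nu> = \<nu>"
    then have \<nu>: "is_partition \<nu>" "psize \<nu> = n" "cor s \<nu> = \<sigma>" "cor t \<nu> = \<tau>" "conjugate_partition \<nu> = \<nu>" by auto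
    show "?sol (beta_set \<sigma>) (beta_set \<tau>) (int n) (beta_set \<nu>)" unfolding solution_def
      using \<nu> maya_beta_set[OF \<nu>(1)] self_conjugate_iff[OF \<nu>(1)] cor_eq_iff[OF \<nu>(1) assms(4) st0(1)]
        cor_eq_iff[OF \<nu>(1) assms(5) st0(2)] energy_beta_set[OF \<nu>(1)] by simp
  next
    fix B assume "?sol (beta_set \<sigma>) (beta_set \<tau>) (int n) B"
    then have B: "maya B" "self_dual B" "same_charge (int s) B (beta_set \<sigma>)" "same_charge (int t) B (beta_set \<tau>)" "energy B = int n"
      by (auto simp: solution_def)
    obtain \<nu> where \<nu>: "is_partition \<nu>" "beta_set \<nu> = B" using beta_set_surj[OF B(1) self_dual_charge[OF B(2)]] by blast
    show "\<exists>\<nu>. (\<nu> \<in> {\<nu>. is_partition \<nu> \<and> psize \<nu> = n \<and> cor s \<nu> = \<sigma> \<and> cor t \<nu> = \<tau>} \<and> conjugate_partition \<nu> = \<nu>) \<and> beta_set \<nu> = B"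
      using \<nu> B self_conjugate_iff[OF \<nu>(1)] cor_eq_iff[OF \<nu>(1) assms(4) st0(1)]
        cor_eq_iff[OF \<nu>(1) assms(5) st0(2)] energy_beta_set[OF \<nu>(1)] by (intro exI[of _ \<nu>]) simp
  qed (use beta_set_inject in blast)
  show ?thesis
  proof (cases "self_dual (beta_set \<sigma>) \<and> self_dual (beta_set \<tau>)")
    \<comment> \<open>Cores of self-conjugate partitions are self-conjugate, so both sides fail
      here.\<close>
    case False
    have "\<not> ?L"
    proof
      assume ?L
      then have "\<exists>!B. ?sol (beta_set \<sigma>) (beta_set \<tau>) (int n) B" by (rule L[THEN iffD1])
      then obtain B where B: "?sol (beta_set \<sigma>) (beta_set \<tau>) (int n) B" by (rule ex1E)
      have "self_dual (beta_set \<sigma>)"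
        by (rule core_self_dual[OF _ _ m\<sigma> \<sigma>(2), of B]) (use B st0 in \<open>simp_all add: solution_def\<close>)
      moreover have "self_dual (beta_set \<tau>)"
        by (rule core_self_dual[OF _ _ m\<tau> \<tau>(2), of B]) (use B st0 in \<open>simp_all add: solution_def\<close>)
      ultimately show False using False by simp
    qed
    moreover have "\<not> ?R" using False self_conjugate_iff[OF \<sigma>(1)] self_conjugate_iff[OF \<tau>(1)] by blast
    ultimately show ?thesis by blast
  next
    case True
    define \<alpha> \<beta> where "\<alpha> = cor t \<sigma>" and "\<beta> = cor s \<tau>"
    note c\<alpha> = cor_wei[OF \<sigma>(1) st0(2), folded \<alpha>_def] and c\<beta> = cor_wei[OF \<tau>(1) st0(1), folded \<beta>_def]
    have p: "is_partition \<alpha>" "down_closed (int t) (beta_set \<alpha>)" "is_partition \<beta>" "down_closed (int s) (beta_set \<beta>)"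
      using c\<alpha>(1) c\<beta>(1) st0 by (auto simp: is_core_iff)
    obtain \<beta>' where r\<beta>: "sym_core (int s) (int t) \<beta>' \<and> same_charge (int s) (beta_set \<tau>) \<beta>' \<and>
      (\<forall>\<sigma> n. (\<exists>!B. ?sol \<sigma> (beta_set \<tau>) n B) \<longleftrightarrow> (\<exists>!B. ?sol \<sigma> \<beta>' (n - energy (beta_set \<tau>) + energy \<beta>') B))"
      using reduce_to_core[OF m\<tau> conjunct2[OF True] \<tau>(2)] by (rule exE)
    note \<beta>' = conjunct1[OF r\<beta>] conjunct1[OF conjunct2[OF r\<beta>]] conjunct2[OF conjunct2[OF r\<beta>], rule_format]
    obtain \<alpha>' where r\<alpha>: "sym_core (int t) (int s) \<alpha>' \<and> same_charge (int t) (beta_set \<sigma>) \<alpha>' \<and>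
      (\<forall>\<tau> n. (\<exists>!B. solution (int t) (int s) \<tau> (beta_set \<sigma>) n B) \<longleftrightarrow>
        (\<exists>!B. solution (int t) (int s) \<tau> \<alpha>' (n - energy (beta_set \<sigma>) + energy \<alpha>') B))"
      using sw.reduce_to_core[OF m\<sigma> conjunct1[OF True] \<sigma>(2)] by (rule exE)
    note \<alpha>' = conjunct1[OF r\<alpha>] conjunct1[OF conjunct2[OF r\<alpha>]] conjunct2[OF conjunct2[OF r\<alpha>], rule_format]
    have \<beta>eq: "\<beta>' = beta_set \<beta>"
    proof (rule core_unique[OF _ maya_beta_set[OF p(3)] _ p(4)])
      show "same_charge (int s) \<beta>' (beta_set \<beta>)" by (rule same_charge_trans[OF same_charge_sym[OF \<beta>'(2)] c\<beta>(2)])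
    qed (use \<beta>'(1) st0 in \<open>simp_all add: sym_core_def\<close>)
    have \<alpha>eq: "\<alpha>' = beta_set \<alpha>"
    proof (rule core_unique[OF _ maya_beta_set[OF p(1)] _ p(2)])
      show "same_charge (int t) \<alpha>' (beta_set \<alpha>)" by (rule same_charge_trans[OF same_charge_sym[OF \<alpha>'(2)] c\<alpha>(2)])
    qed (use \<alpha>'(1) st0 in \<open>simp_all add: sym_core_def\<close>)
    have sc: "sym_core (int s) (int t) (beta_set \<alpha>)" "sym_core (int s) (int t) (beta_set \<beta>)"
      using \<alpha>'(1) \<beta>'(1) \<alpha>eq \<beta>eq by (auto simp: sym_core_def)
    \<comment> \<open>The size left after both reductions, each of which removes the weight of one
      of the given cores.\<close>
    define n' where "n' = int n - int t * int (wei t \<sigma>) - int s * int (wei s \<tau>)"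
    note E = energy_beta_set[OF \<sigma>(1)] energy_beta_set[OF \<tau>(1)] energy_beta_set[OF p(1)] energy_beta_set[OF p(3)]
    have sz: "int (psize \<sigma>) = int (psize \<alpha>) + int t * int (wei t \<sigma>)" "int (psize \<tau>) = int (psize \<beta>) + int s * int (wei s \<tau>)"
      using c\<alpha>(3) c\<beta>(3) by simp_all
    have "?L \<longleftrightarrow> (\<exists>!B. ?sol (beta_set \<sigma>) (beta_set \<beta>) (int n - energy (beta_set \<tau>) + energy (beta_set \<beta>)) B)"
      unfolding L \<beta>'(3) \<beta>eq ..
    also have "\<dots> \<longleftrightarrow> (\<exists>!B. ?sol (beta_set \<alpha>) (beta_set \<beta>) (int n - energy (beta_set \<tau>) + energy (beta_set \<beta>) - energy (beta_set \<sigma>) + energy (beta_set \<alpha>)) B)"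
      unfolding solution_swap[of "int s" "int t"] \<alpha>'(3) \<alpha>eq ..
    also have "int n - energy (beta_set \<tau>) + energy (beta_set \<beta>) - energy (beta_set \<sigma>) + energy (beta_set \<alpha>) = n'"
      unfolding E n'_def sz by simp
    finally have LL: "?L \<longleftrightarrow> (\<exists>!B. ?sol (beta_set \<alpha>) (beta_set \<beta>) n' B)" .
    note kp = kappa_partition[OF cp]
    have inj: "beta_set \<alpha> = beta_set \<beta> \<longleftrightarrow> \<alpha> = \<beta>" "beta_set \<alpha> = kappa_set (int s) (int t) \<longleftrightarrow> \<alpha> = kappa s t"
      "beta_set \<beta> = kappa_set (int s) (int t) \<longleftrightarrow> \<beta> = kappa s t"
      using beta_set_inject p(1,3) kp by metis+
    have 1: "\<alpha> = \<beta> \<and> n' = energy (beta_set \<alpha>) \<longleftrightarrow> \<alpha> = \<beta> \<and> int n = int (psize \<sigma>) + int (psize \<tau>) - int (psize \<alpha>)"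
      unfolding E n'_def sz by auto
    have 2: "n' = energy (beta_set \<beta>) + int t \<longleftrightarrow> n = psize \<tau> + t * (wei t \<sigma> + 1)"
      unfolding E n'_def c\<beta>(3) by (auto simp: algebra_simps simp flip: of_nat_mult of_nat_add)
    have 3: "n' = energy (beta_set \<alpha>) + int s \<longleftrightarrow> n = psize \<sigma> + s * (wei s \<tau> + 1)"
      unfolding E n'_def c\<alpha>(3) by (auto simp: algebra_simps simp flip: of_nat_mult of_nat_add)
    have 4: "(\<exists>b c. set_harpoons (int s) (int t) (beta_set \<alpha>) (beta_set \<beta>) b c \<and> n' = energy ((beta_set \<beta> - {c}) \<union> {bar c}) + int s + int t)
      \<longleftrightarrow> harpoons s t \<alpha> \<beta> \<and> n = psize (star s t \<alpha> \<beta>) + s * (wei s \<tau> + 1) + t * (wei t \<sigma> + 1)" if odd: "odd s" "odd t"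
    proof -
      have "n' = energy ((beta_set \<beta> - {c}) \<union> {bar c}) + int s + int t \<longleftrightarrow>
        n = psize (star s t \<alpha> \<beta>) + s * (wei s \<tau> + 1) + t * (wei t \<sigma> + 1)" if "harpoons_via s t \<alpha> \<beta> b c" for b c
        unfolding psize_star[OF cp odd sc that, symmetric] n'_def
        by (auto simp: algebra_simps simp flip: of_nat_mult of_nat_add)
      then show ?thesis unfolding harpoons_def harpoons_via_iff by blast
    qed
    then have c4: "odd s \<and> odd t \<and> (\<exists>b c. set_harpoons (int s) (int t) (beta_set \<alpha>) (beta_set \<beta>) b c \<and> n' = energy ((beta_set \<beta> - {c}) \<union> {bar c}) + int s + int t)
      \<longleftrightarrow> odd s \<and> odd t \<and> harpoons s t \<alpha> \<beta> \<and> n = psize (star s t \<alpha> \<beta>) + s * (wei s \<tau> + 1) + t * (wei t \<sigma> + 1)"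
      by (intro conj_cong refl)
    have 5: "\<alpha> = kappa s t \<and> \<beta> = kappa s t \<and> n' = energy (kappa_set (int s) (int t)) + int s * int t \<longleftrightarrow>
      \<alpha> = kappa s t \<and> \<beta> = kappa s t \<and> int n = int (psize \<sigma>) + int (psize \<tau>) - int (psize (kappa s t)) + int s * int t"
      using energy_beta_set[OF kp(1)] unfolding kp(2) n'_def sz by auto
    have "?L \<longleftrightarrow> (\<alpha> = \<beta> \<and> int n = int (psize \<sigma>) + int (psize \<tau>) - int (psize \<alpha>)) \<or>
     (odd t \<and> harpoon s t \<alpha> \<beta> \<and> n = psize \<tau> + t * (wei t \<sigma> + 1)) \<or>
     (odd s \<and> harpoon t s \<beta> \<alpha> \<and> n = psize \<sigma> + s * (wei s \<tau> + 1)) \<or>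
     (odd s \<and> odd t \<and> harpoons s t \<alpha> \<beta> \<and> n = psize (star s t \<alpha> \<beta>) + s * (wei s \<tau> + 1) + t * (wei t \<sigma> + 1)) \<or>
     (odd s \<and> odd t \<and> \<alpha> = kappa s t \<and> \<beta> = kappa s t \<and>
        int n = int (psize \<sigma>) + int (psize \<tau>) - int (psize (kappa s t)) + int s * int t)"
      unfolding LL reduced_classification[OF sc] inj harpoon_iff[symmetric] even_of_nat 1 2 3 c4 5 ..
    moreover have "conjugate_partition \<sigma> = \<sigma>" "conjugate_partition \<tau> = \<tau>"
      using True self_conjugate_iff[OF \<sigma>(1)] self_conjugate_iff[OF \<tau>(1)] by simp_all
    ultimately show ?thesis unfolding \<alpha>_def \<beta>_def by (simp only: simp_thms)
  qed
qed

end
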